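(* For every $f \in \mathrm{Frac}(\mathcal{A})$, we have $$\sum_{z \in F^{\mathrm{s}} \sqcup \{\infty\}} \mathrm{sres}_{z,0}(f) = 0$$ in $K\otimes_F F^{\mathrm{s}}$.
   Context: Let $K$ be a field with an automorphism $\theta$ of finite order $r$, and $F = \{a\in K : \theta(a)=a\}$. Let $\mathcal{A} = K[X^{\pm 1};\theta]$ (skew Laurent polynomials, $Xa = \theta(a)X$ for $a\in K$), $Y = X^r$, $\mathcal{C} = K[Y^{\pm1}]$, and $\mathcal{Z} = F[Y^{\pm 1}]$ (the centre of $\mathcal{A}$). $\mathrm{Frac}(\mathcal{A}) = \mathrm{Frac}(\mathcal{Z})\otimes_{\mathcal{Z}}\mathcal{A}$ is the skew field of fractions of $\mathcal{A}$. A "$K$-algebra" is a ring $B$ with a ring homomorphism $K\to B$ (image not necessarily central). Section operators: for $j\in\mathbb{Z}$, $\sigma_j:\mathcal{A}\to\mathcal{C}$ is $\sigma_j(\sum_i a_iX^i)=\sum_i a_{j+ir}Y^i$; it is $\mathcal{Z}$-linear and extends to $\mathrm{Frac}(\mathcal{A})\to\mathrm{Frac}(\mathcal{C})$, to $\mathcal{A}/N\mathcal{A}\to\mathcal{C}/N\mathcal{C}$ for $N \in \mathcal{Z}$, and coefficientwise to series in $T$. Fix a separable closure $F^{\mathrm{s}}$ of $F$ and an embedding $K\hookrightarrow F^{\mathrm{s}}$. Let $z\in F^{\mathrm{s}}$, $z\ne0$, with minimal polynomial $N\in F[Y]$ over $F$; identify $\mathcal{Z}/N\mathcal{Z}$ with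 $F(z)$ via $Y\mapsto z$, so $z$ also denotes the class of $Y$ in $\mathcal{Z}/N\mathcal{Z}$. Let $\hat{\mathcal{A}}_N=\varprojlim_m\mathcal{A}/N^m\mathcal{A}$. A morphism of $K$-algebras $\tau:\hat{\mathcal{A}}_N\to(\mathcal{A}/N\mathcal{A})[[T]]$ ($T$ central) is $z$-admissible if $\tau(X)\equiv X\pmod T$ and $\tau(Y)=z+T$. For each such $z$ a $z$-admissible morphism $\tau_z$ is chosen, and $\mathrm{TS}_z:\mathrm{Frac}(\mathcal{A})=\mathrm{Frac}(\mathcal{Z})\otimes_{\mathcal{Z}}\mathcal{A}\to\mathrm{Frac}(\mathcal{Z})\otimes_{\mathcal{Z}}\hat{\mathcal{A}}_N\to(\mathcal{A}/N\mathcal{A})((T))$ is the map induced by $\tau_z$. Let $\iota_z:\mathcal{C}/N\mathcal{C}\to K\otimes_F F^{\mathrm{s}}$ be the $K$-linear extension of $\mathcal{Z}/N\mathcal{Z}\hookrightarrow F^{\mathrm{s}}$, $Y\mapsto z$. For $f\in\mathrm{Frac}(\mathcal{A})$, $\mathrm{sres}_z(f)\in\mathcal{A}/N\mathcal{A}$ is the coefficient of $T^{-1}$ in $\mathrm{TS}_z(f)$, and for $0\le j<r$ the $j$-th partial skew residue is $\mathrm{sres}_{z,j}(f)=\iota_z(\sigma_j(\mathrm{sres}_z(f)))\in K\otimes_F F^{\mathrm{s}}$. At $0$: $\mathrm{TS}_0:\mathrm{Frac}(\mathcal{A})\to K((X;\theta))$ is the canonical embedding into the ring of skew Laurent series (with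 $Xc=\theta(c)X$), induced by $\mathrm{Frac}(\mathcal{Z})=F(Y)\subset F((Y))$; $\mathrm{sres}_{0,j}(f)$ is the coefficient of $X^{j-r}$ in $\mathrm{TS}_0(f)$. At $\infty$: with $\tilde X=X^{-1}$, $\mathrm{TS}_\infty:\mathrm{Frac}(\mathcal{A})\to K((\tilde X;\theta^{-1}))$ is the analogous expansion, and $\mathrm{sres}_{\infty,j}(f)$ is the opposite of the coefficient of $\tilde X^{r-j}$ in $\mathrm{TS}_\infty(f)$. Both are elements of $K$, viewed in $K\otimes_FF^{\mathrm{s}}$ via $c\mapsto c\otimes1$. The sum over $z$ is over its finitely many nonzero terms.
   Formalization: The formula is proved for f having a denominator in F[Y] that splits over F^s (automatic if F is perfect); without this it fails, e.g. θ = id, K = F of characteristic p, t not a p-th power, f = X^(p-1)/(X^p - t), where the sum is -1. *)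

theory Defs
  imports
    "HOL-Algebra.QuotRing"
    "HOL-Algebra.Free_Abelian_Groups"
    "HOL-Algebra.Algebraic_Closure_Type"
    "HOL-Computational_Algebra.Polynomial"
begin

section \<open>Skew Laurent polynomials and skew Laurent series\<close>

text \<open>
  The fields K and F^s are types of class \<open>field\<close> (regarded as ring records through
  \<open>ring_of_type_algebra\<close>); the noncommutative rings depend on the automorphism \<open>\<theta>\<close>
  and are ring records. A (Laurent) series, the sum of the c(i) X^i, is the coefficient function
  \<open>c :: int \<Rightarrow> 'k\<close>.
\<close>

definition aut_pow :: "('k \<Rightarrow> 'k) \<Rightarrow> int \<Rightarrow> 'k \<Rightarrow> 'k" where
  "aut_pow \<theta> i = (if i \<ge> 0 then \<theta> ^^ nat i else inv_into UNIV \<theta> ^^ nat (- i))"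

text \<open>The rule X c = \<open>\<theta>\<close>(c) X gives (a X^i)(b X^j) = a \<open>\<theta>\<close>^i(b) X^(i+j).\<close>

definition skew_mult :: "('k::field \<Rightarrow> 'k) \<Rightarrow> (int \<Rightarrow> 'k) \<Rightarrow> (int \<Rightarrow> 'k) \<Rightarrow> int \<Rightarrow> 'k" where
  "skew_mult \<theta> a b n = (\<Sum>i | a i \<noteq> 0 \<and> b (n - i) \<noteq> 0. a i * aut_pow \<theta> i (b (n - i)))"

definition skew_monom :: "'k::zero \<Rightarrow> int \<Rightarrow> int \<Rightarrow> 'k" where
  "skew_monom c n = (\<lambda>i. if i = n then c else 0)"

definition skew_series :: "('k::field \<Rightarrow> 'k) \<Rightarrow> (int \<Rightarrow> 'k) ring" where
  "skew_series \<theta> = \<lparr>carrier = {a. \<exists>m. \<forall>i<m. a i = 0}, monoid.mult = skew_mult \<theta>,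
     one = skew_monom 1 0, zero = (\<lambda>_. 0), add = (\<lambda>a b i. a i + b i)\<rparr>"

definition skew_poly :: "('k::field \<Rightarrow> 'k) \<Rightarrow> (int \<Rightarrow> 'k) ring" where
  "skew_poly \<theta> = (skew_series \<theta>)\<lparr>carrier := {a. finite {i. a i \<noteq> 0}}\<rparr>"

definition fixed_field :: "('k \<Rightarrow> 'k) \<Rightarrow> 'k set" where
  "fixed_field \<theta> = {a. \<theta> a = a}"

text \<open>The subring F[Y, Y^{-1}] of the skew Laurent polynomials, where Y = X^r.\<close>

definition skew_centre :: "('k::field \<Rightarrow> 'k) \<Rightarrow> nat \<Rightarrow> (int \<Rightarrow> 'k) set" where
  "skew_centre \<theta> r =
     {a \<in> carrier (skew_poly \<theta>). \<forall>n. a n \<noteq> 0 \<longrightarrow> int r dvd n \<and> a n \<in> fixed_field \<theta>}"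

definition poly_at_Y :: "nat \<Rightarrow> 'k::zero poly \<Rightarrow> int \<Rightarrow> 'k" where
  "poly_at_Y r P = (\<lambda>n. if n \<ge> 0 \<and> int r dvd n then poly.coeff P (nat (n div int r)) else 0)"

text \<open>
  The section operator with index j, with values in C = K[Y, Y^{-1}]; an element of C is its
  coefficient function with respect to the powers of Y.
\<close>

definition sect :: "nat \<Rightarrow> int \<Rightarrow> (int \<Rightarrow> 'k) \<Rightarrow> int \<Rightarrow> 'k" where
  "sect r j a = (\<lambda>i. a (j + i * int r))"


section \<open>Skew rational functions\<close>

text \<open>
  Localising the skew Laurent polynomials at the nonzero central elements: the class of
  \<open>(D, a)\<close> is the fraction \<open>D\<inverse> a\<close>, that is, the tensor of 1/D and a in
  Frac(Z) \<open>\<otimes>\<close> A over Z = \<open>skew_centre \<theta> r\<close>.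
\<close>

definition frac_pairs :: "('k::field \<Rightarrow> 'k) \<Rightarrow> nat \<Rightarrow> ((int \<Rightarrow> 'k) \<times> (int \<Rightarrow> 'k)) set" where
  "frac_pairs \<theta> r = (skew_centre \<theta> r - {\<zero>\<^bsub>skew_poly \<theta>\<^esub>}) \<times> carrier (skew_poly \<theta>)"

definition frac_rel ::
  "('k::field \<Rightarrow> 'k) \<Rightarrow> nat \<Rightarrow> (((int \<Rightarrow> 'k) \<times> (int \<Rightarrow> 'k)) \<times> ((int \<Rightarrow> 'k) \<times> (int \<Rightarrow> 'k))) set" where
  "frac_rel \<theta> r = {((D, a), (D', a')). (D, a) \<in> frac_pairs \<theta> r \<and> (D', a') \<in> frac_pairs \<theta> r \<and>
     D' \<otimes>\<^bsub>skew_poly \<theta>\<^esub> a = D \<otimes>\<^bsub>skew_poly \<theta>\<^esub> a'}"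

definition skew_frac :: "('k::field \<Rightarrow> 'k) \<Rightarrow> nat \<Rightarrow> ((int \<Rightarrow> 'k) \<times> (int \<Rightarrow> 'k)) set set" where
  "skew_frac \<theta> r = frac_pairs \<theta> r // frac_rel \<theta> r"

text \<open>
  The map induced on fractions by a morphism \<open>h\<close> to a ring \<open>R\<close> in which the images of nonzero
  central elements are invertible.
\<close>

definition frac_map ::
  "('b, 'm) ring_scheme \<Rightarrow> ((int \<Rightarrow> 'k) \<Rightarrow> 'b) \<Rightarrow> ((int \<Rightarrow> 'k) \<times> (int \<Rightarrow> 'k)) set \<Rightarrow> 'b" where
  "frac_map R h f = the_elem ((\<lambda>(D, a). (inv\<^bsub>R\<^esub> (h D)) \<otimes>\<^bsub>R\<^esub> h a) ` f)"


section \<open>Separable closures and minimal polynomials\<close>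

definition polys_over :: "'k::zero set \<Rightarrow> 'k poly set" where
  "polys_over F = {P. \<forall>i. poly.coeff P i \<in> F}"

definition separable_poly :: "'s::field poly \<Rightarrow> bool" where
  "separable_poly P \<longleftrightarrow> coprime P (pderiv P)"

text \<open>The field \<open>'s\<close> is a separable closure of \<open>F\<close>, embedded by the restriction of \<open>e\<close> to \<open>F\<close>.\<close>

definition separable_closure :: "'k::field set \<Rightarrow> ('k \<Rightarrow> 's::field) \<Rightarrow> bool" where
  "separable_closure F e \<longleftrightarrow>
     (\<forall>z. \<exists>P \<in> polys_over F. separable_poly (map_poly e P) \<and> poly (map_poly e P) z = 0) \<and>
     (\<forall>Q :: 's poly. separable_poly Q \<and> degree Q > 0 \<longrightarrow> (\<exists>x. poly Q x = 0))"

definition min_poly :: "'k::field set \<Rightarrow> ('k \<Rightarrow> 's::field) \<Rightarrow> 's \<Rightarrow> 'k poly" where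
  "min_poly F e z = (THE N. N \<in> polys_over F \<and> lead_coeff N = 1 \<and> poly (map_poly e N) z = 0 \<and>
     (\<forall>M \<in> polys_over F. M \<noteq> 0 \<and> poly (map_poly e M) z = 0 \<longrightarrow> degree N \<le> degree M))"


section \<open>The tensor product of \<open>'k\<close> and \<open>'s\<close> over a subfield\<close>

text \<open>
  The additive group of the tensor product over \<open>F\<close>; as usual in this library, free abelian
  groups and their quotients are written multiplicatively.
\<close>

definition tensor_relators :: "'k::field set \<Rightarrow> ('k \<Rightarrow> 's::field) \<Rightarrow> ('k \<times> 's \<Rightarrow>\<^sub>0 int) set" where
  "tensor_relators F e =
     {frag_of (a + b, s) - frag_of (a, s) - frag_of (b, s) |a b s. True} \<union>
     {frag_of (a, s + t) - frag_of (a, s) - frag_of (a, t) |a s t. True} \<union>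
     {frag_of (a * c, s) - frag_of (a, e c * s) |a c s. c \<in> F}"

definition tensor_subgroup :: "'k::field set \<Rightarrow> ('k \<Rightarrow> 's::field) \<Rightarrow> ('k \<times> 's \<Rightarrow>\<^sub>0 int) set" where
  "tensor_subgroup F e = generate (free_Abelian_group UNIV) (tensor_relators F e)"

definition tensor_product ::
  "'k::field set \<Rightarrow> ('k \<Rightarrow> 's::field) \<Rightarrow> ('k \<times> 's \<Rightarrow>\<^sub>0 int) set monoid" where
  "tensor_product F e = free_Abelian_group UNIV Mod tensor_subgroup F e"

definition pure_tensor ::
  "'k::field set \<Rightarrow> ('k \<Rightarrow> 's::field) \<Rightarrow> 'k \<Rightarrow> 's \<Rightarrow> ('k \<times> 's \<Rightarrow>\<^sub>0 int) set" where
  "pure_tensor F e a s = tensor_subgroup F e #>\<^bsub>free_Abelian_group UNIV\<^esub> frag_of (a, s)"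

text \<open>
  The map from C/NC to the tensor product, where N is the minimal polynomial of z: the class of
  the sum of the c(i) Y^i is sent to the sum of the c(i) \<open>\<otimes>\<close> z^i.
\<close>

definition iota ::
  "'k::field set \<Rightarrow> ('k \<Rightarrow> 's::field) \<Rightarrow> 's \<Rightarrow> (int \<Rightarrow> 'k) set \<Rightarrow> ('k \<times> 's \<Rightarrow>\<^sub>0 int) set" where
  "iota F e z S = the_elem
     ((\<lambda>c. finprod (tensor_product F e) (\<lambda>i. pure_tensor F e (c i) (z powi i)) {i. c i \<noteq> 0}) ` S)"


section \<open>Central Laurent and power series over a ring\<close>

definition laurent_series :: "('a, 'm) ring_scheme \<Rightarrow> (int \<Rightarrow> 'a) ring" where
  "laurent_series R = \<lparr>
     carrier = {f. (\<forall>i. f i \<in> carrier R) \<and> (\<exists>m. \<forall>i<m. f i = \<zero>\<^bsub>R\<^esub>)},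
     monoid.mult = (\<lambda>f g n. \<Oplus>\<^bsub>R\<^esub>i \<in> {i. f i \<noteq> \<zero>\<^bsub>R\<^esub> \<and> g (n - i) \<noteq> \<zero>\<^bsub>R\<^esub>}. f i \<otimes>\<^bsub>R\<^esub> g (n - i)),
     one = (\<lambda>i. if i = 0 then \<one>\<^bsub>R\<^esub> else \<zero>\<^bsub>R\<^esub>),
     zero = (\<lambda>_. \<zero>\<^bsub>R\<^esub>),
     add = (\<lambda>f g i. f i \<oplus>\<^bsub>R\<^esub> g i)\<rparr>"

definition power_series :: "('a, 'm) ring_scheme \<Rightarrow> (int \<Rightarrow> 'a) ring" where
  "power_series R = (laurent_series R)
     \<lparr>carrier := {f \<in> carrier (laurent_series R). \<forall>i<0. f i = \<zero>\<^bsub>R\<^esub>}\<rparr>"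


section \<open>Completion at a central element, and admissible morphisms\<close>

definition central_ideal :: "('k::field \<Rightarrow> 'k) \<Rightarrow> (int \<Rightarrow> 'k) \<Rightarrow> (int \<Rightarrow> 'k) set" where
  "central_ideal \<theta> N = N <#\<^bsub>skew_poly \<theta>\<^esub> carrier (skew_poly \<theta>)"

definition skew_quot :: "('k::field \<Rightarrow> 'k) \<Rightarrow> (int \<Rightarrow> 'k) \<Rightarrow> (int \<Rightarrow> 'k) set ring" where
  "skew_quot \<theta> N = skew_poly \<theta> Quot central_ideal \<theta> N"

definition skew_class :: "('k::field \<Rightarrow> 'k) \<Rightarrow> (int \<Rightarrow> 'k) \<Rightarrow> (int \<Rightarrow> 'k) \<Rightarrow> (int \<Rightarrow> 'k) set" where
  "skew_class \<theta> N a = central_ideal \<theta> N +>\<^bsub>skew_poly \<theta>\<^esub> a"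

text \<open>
  The inverse limit of the quotients by the N^m. The transition maps send a coset to the coset
  containing it, so compatibility of a family is expressed by inclusion.
\<close>

definition completion :: "('k::field \<Rightarrow> 'k) \<Rightarrow> (int \<Rightarrow> 'k) \<Rightarrow> (nat \<Rightarrow> (int \<Rightarrow> 'k) set) ring" where
  "completion \<theta> N = (let Q = (\<lambda>m::nat. skew_quot \<theta> (N [^]\<^bsub>skew_poly \<theta>\<^esub> m)) in
     \<lparr>carrier = {u. (\<forall>m. u m \<in> carrier (Q m)) \<and> (\<forall>m. u (Suc m) \<subseteq> u m)},
      monoid.mult = (\<lambda>u v m. u m \<otimes>\<^bsub>Q m\<^esub> v m),
      one = (\<lambda>m. \<one>\<^bsub>Q m\<^esub>),
      zero = (\<lambda>m. \<zero>\<^bsub>Q m\<^esub>),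
      add = (\<lambda>u v m. u m \<oplus>\<^bsub>Q m\<^esub> v m)\<rparr>)"

definition to_completion ::
  "('k::field \<Rightarrow> 'k) \<Rightarrow> (int \<Rightarrow> 'k) \<Rightarrow> (int \<Rightarrow> 'k) \<Rightarrow> nat \<Rightarrow> (int \<Rightarrow> 'k) set" where
  "to_completion \<theta> N a = (\<lambda>m. skew_class \<theta> (N [^]\<^bsub>skew_poly \<theta>\<^esub> m) a)"

definition min_poly_Y :: "('k::field \<Rightarrow> 'k) \<Rightarrow> nat \<Rightarrow> ('k \<Rightarrow> 's::field) \<Rightarrow> 's \<Rightarrow> int \<Rightarrow> 'k" where
  "min_poly_Y \<theta> r e z = poly_at_Y r (min_poly (fixed_field \<theta>) e z)"

text \<open>
  The four conditions below say that \<open>\<tau>\<close> is a ring morphism, that it is compatible with the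
  structure maps from K, that \<open>\<tau>\<close>(X) is X modulo T, and that \<open>\<tau>\<close>(Y) = z + T, where z stands for
  the class of Y = X^r modulo N.
\<close>

definition z_admissible ::
  "('k::field \<Rightarrow> 'k) \<Rightarrow> nat \<Rightarrow> ('k \<Rightarrow> 's::field) \<Rightarrow> 's \<Rightarrow>
   ((nat \<Rightarrow> (int \<Rightarrow> 'k) set) \<Rightarrow> int \<Rightarrow> (int \<Rightarrow> 'k) set) \<Rightarrow> bool" where
  "z_admissible \<theta> r e z \<tau> \<longleftrightarrow> (let N = min_poly_Y \<theta> r e z; B = skew_quot \<theta> N in
     \<tau> \<in> ring_hom (completion \<theta> N) (power_series B) \<and>
     (\<forall>c. \<tau> (to_completion \<theta> N (skew_monom c 0)) =
            (\<lambda>i. if i = 0 then skew_class \<theta> N (skew_monom c 0) else \<zero>\<^bsub>B\<^esub>)) \<and>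
     \<tau> (to_completion \<theta> N (skew_monom 1 1)) 0 = skew_class \<theta> N (skew_monom 1 1) \<and>
     \<tau> (to_completion \<theta> N (skew_monom 1 (int r))) =
       (\<lambda>i. if i = 0 then skew_class \<theta> N (skew_monom 1 (int r))
            else if i = 1 then \<one>\<^bsub>B\<^esub> else \<zero>\<^bsub>B\<^esub>))"


section \<open>Taylor expansions and partial skew residues\<close>

definition TS_zero ::
  "('k::field \<Rightarrow> 'k) \<Rightarrow> ((int \<Rightarrow> 'k) \<times> (int \<Rightarrow> 'k)) set \<Rightarrow> int \<Rightarrow> 'k" where
  "TS_zero \<theta> = frac_map (skew_series \<theta>) (\<lambda>a. a)"

text \<open>The expansion at infinity is a series in the inverse of X, which twists by the inverse of \<open>\<theta>\<close>.\<close>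

definition TS_infinity ::
  "('k::field \<Rightarrow> 'k) \<Rightarrow> ((int \<Rightarrow> 'k) \<times> (int \<Rightarrow> 'k)) set \<Rightarrow> int \<Rightarrow> 'k" where
  "TS_infinity \<theta> = frac_map (skew_series (inv_into UNIV \<theta>)) (\<lambda>a n. a (- n))"

definition TS ::
  "('k::field \<Rightarrow> 'k) \<Rightarrow> nat \<Rightarrow> ('k \<Rightarrow> 's::field) \<Rightarrow>
   ('s \<Rightarrow> (nat \<Rightarrow> (int \<Rightarrow> 'k) set) \<Rightarrow> int \<Rightarrow> (int \<Rightarrow> 'k) set) \<Rightarrow> 's \<Rightarrow>
   ((int \<Rightarrow> 'k) \<times> (int \<Rightarrow> 'k)) set \<Rightarrow> int \<Rightarrow> (int \<Rightarrow> 'k) set" where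
  "TS \<theta> r e \<tau> z = (let N = min_poly_Y \<theta> r e z in
     frac_map (laurent_series (skew_quot \<theta> N)) (\<lambda>a. \<tau> z (to_completion \<theta> N a)))"

definition sres ::
  "('k::field \<Rightarrow> 'k) \<Rightarrow> nat \<Rightarrow> ('k \<Rightarrow> 's::field) \<Rightarrow>
   ('s \<Rightarrow> (nat \<Rightarrow> (int \<Rightarrow> 'k) set) \<Rightarrow> int \<Rightarrow> (int \<Rightarrow> 'k) set) \<Rightarrow> 's \<Rightarrow>
   ((int \<Rightarrow> 'k) \<times> (int \<Rightarrow> 'k)) set \<Rightarrow> (int \<Rightarrow> 'k) set" where
  "sres \<theta> r e \<tau> z f = TS \<theta> r e \<tau> z f (- 1)"

text \<open>
  The partial skew residue with index j at a point of \<open>'s option\<close>, where \<open>None\<close> is the point at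
  infinity. The residue at a nonzero z is a coset of N A; its image under the section operator is
  a coset of N C.
\<close>

definition psres ::
  "('k::field \<Rightarrow> 'k) \<Rightarrow> nat \<Rightarrow> ('k \<Rightarrow> 's::field) \<Rightarrow>
   ('s \<Rightarrow> (nat \<Rightarrow> (int \<Rightarrow> 'k) set) \<Rightarrow> int \<Rightarrow> (int \<Rightarrow> 'k) set) \<Rightarrow> nat \<Rightarrow> 's option \<Rightarrow>
   ((int \<Rightarrow> 'k) \<times> (int \<Rightarrow> 'k)) set \<Rightarrow> ('k \<times> 's \<Rightarrow>\<^sub>0 int) set" where
  "psres \<theta> r e \<tau> j p f = (case p of
       None \<Rightarrow> pure_tensor (fixed_field \<theta>) e (- TS_infinity \<theta> f (int r - int j)) 1
     | Some z \<Rightarrow>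
         if z = 0 then pure_tensor (fixed_field \<theta>) e (TS_zero \<theta> f (int j - int r)) 1
         else iota (fixed_field \<theta>) e z (sect r (int j) ` sres \<theta> r e \<tau> z f))"


section \<open>Skew rational functions with poles in the separable closure\<close>

text \<open>
  Some denominator of \<open>f\<close> in F[Y] splits into linear factors over \<open>'s\<close>, that is, all its
  irreducible factors over F are separable. This is automatic if F is perfect. If F is imperfect,
  it can fail, and so can the residue formula: for F = K of characteristic p, \<open>\<theta> = id\<close> and t in F
  not a p-th power, X^(p-1) / (X^p - t) has residue -1 at infinity, but no pole in the separable
  closure.
\<close>

definition separable_poles ::
  "('k::field \<Rightarrow> 'k) \<Rightarrow> nat \<Rightarrow> ('k \<Rightarrow> 's::field) \<Rightarrow> ((int \<Rightarrow> 'k) \<times> (int \<Rightarrow> 'k)) set \<Rightarrow> bool" where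
  "separable_poles \<theta> r e f \<longleftrightarrow>
     (\<exists>P \<in> polys_over (fixed_field \<theta>). (\<exists>a. (poly_at_Y r P, a) \<in> f) \<and>
        (\<exists>c xs. map_poly e P = smult c (\<Prod>x\<leftarrow>xs. [:- x, 1:])))"

text \<open>
  In particular the condition holds for every \<open>f\<close> if \<open>'s\<close> is algebraically closed, as is
  the case if F is perfect.
\<close>

lemma aut_pow_dvd:
  assumes "\<theta> ^^ r = id" "int r dvd n"
  shows "aut_pow \<theta> n = id"
proof -
  obtain q where q: "n = int r * q" using assms(2) by blast
  have 1: "\<theta> ^^ (r * m) = id" for m
    by (induction m) (simp_all add: funpow_add assms(1))
  show ?thesis
  proof (cases "n \<ge> 0 \<or> r = 0")
    case True
    then have "nat n = r * nat q" unfolding q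
      by (cases "r = 0") (auto simp: nat_mult_distrib zero_le_mult_iff)
    then show ?thesis using 1 True q by (auto simp: aut_pow_def)
  next
    case False
    then have n: "nat (- n) = r * nat (- q)" unfolding q
      by (metis mult_minus_right nat_int nat_mult_distrib of_nat_0_le_iff)
    have bij: "bij \<theta>"
    proof (rule o_bij)
      show "(\<theta> ^^ (r - 1)) \<circ> \<theta> = id" "\<theta> \<circ> (\<theta> ^^ (r - 1)) = id"
        using False assms(1) by (metis Suc_diff_1 funpow_Suc_right gr0I, metis False Suc_diff_1 funpow.simps(2) gr0I assms(1))
    qed
    have "inv_into UNIV \<theta> ^^ (r * nat (- q)) = inv_into UNIV (\<theta> ^^ (r * nat (- q)))"
      using inv_fn[OF bij] by metis
    then show ?thesis using False n by (simp add: aut_pow_def 1)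
  qed
qed

lemma separable_poles_alg_closed:
  fixes e :: "'k::field \<Rightarrow> 's::alg_closed_field"
  assumes "\<theta> \<in> ring_iso ring_of_type_algebra ring_of_type_algebra"
    and r: "r > 0" "\<theta> ^^ r = id"
    and "f \<in> skew_frac \<theta> r"
  shows "separable_poles \<theta> r e f"
proof -
  have \<theta>0: "\<theta> 0 = 0"
  proof -
    have "\<forall>x y. \<theta> (x + y) = \<theta> x + \<theta> y"
      using assms(1) unfolding ring_iso_def ring_hom_def by (auto simp: ring_of_type_algebra_def)
    then have "\<theta> (0 + 0) = \<theta> 0 + \<theta> 0" by (rule allE) blast
    then show ?thesis by (metis add_0_left add_right_cancel)
  qed
  obtain D a where f: "f = frac_rel \<theta> r `` {(D, a)}" and Da: "(D, a) \<in> frac_pairs \<theta> r"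
    using assms(4) unfolding skew_frac_def quotient_def by auto
  then have Dfin: "finite {i. D i \<noteq> 0}" and afin: "finite {i. a i \<noteq> 0}"
    and Dr: "\<And>n. D n \<noteq> 0 \<Longrightarrow> int r dvd n \<and> \<theta> (D n) = D n" and D0: "D \<noteq> (\<lambda>_. 0)"
    by (auto simp: frac_pairs_def skew_centre_def skew_poly_def skew_series_def fixed_field_def)
  obtain k :: nat where k: "\<And>i. D i \<noteq> 0 \<Longrightarrow> \<bar>i\<bar> \<le> int k"
  proof -
    have "\<exists>k::nat. \<forall>i\<in>{i. D i \<noteq> 0}. nat \<bar>i\<bar> \<le> k"
      using Dfin by (metis finite_imageI finite_nat_set_iff_bounded_le imageI)
    then show ?thesis using that by (metis (mono_tags) mem_Collect_eq nat_le_iff)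
  qed
  define s where "s = int r * int k"
  have s: "s \<ge> int k" using r(1) unfolding s_def by (simp add: mult_le_cancel_right1)
  define P where "P = Abs_poly (\<lambda>m. D (int r * int m - s))"
  have cP: "poly.coeff P m = D (int r * int m - s)" for m
  proof -
    have "finite {m. D (int r * int m - s) \<noteq> 0}"
    proof (rule finite_subset)
      show "{m. D (int r * int m - s) \<noteq> 0} \<subseteq> {..nat (s + k)}"
      proof
        fix m assume "m \<in> {m. D (int r * int m - s) \<noteq> 0}"
        then have "int r * int m \<le> s + k" using k[of "int r * int m - s"] by auto
        moreover have "int m \<le> int r * int m" using r(1) by (simp add: mult_le_cancel_right1)
        ultimately show "m \<in> {..nat (s + k)}" by auto
      qed
    qed simp
    then show ?thesis unfolding P_def by (simp add: Abs_poly_inverse eventually_cofinite)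
  qed
  define D' a' where "D' = (\<lambda>n. D (n - s))" and "a' = (\<lambda>n. a (n - s))"
  have PD: "poly_at_Y r P = D'"
  proof
    fix n
    show "poly_at_Y r P n = D' n"
    proof (cases "n \<ge> 0 \<and> int r dvd n")
      case True
      then show ?thesis using r(1)
        by (auto simp: poly_at_Y_def cP D'_def pos_imp_zdiv_nonneg_iff)
    next
      case False
      have "D (n - s) = 0"
      proof (rule ccontr)
        assume h: "D (n - s) \<noteq> 0"
        then have "n \<ge> 0" using k[OF h] s by linarith
        moreover have "int r dvd n" using Dr[OF h] unfolding s_def by (simp add: dvd_diff_left_iff)
        ultimately show False using False by blast
      qed
      then show ?thesis using False by (auto simp: poly_at_Y_def D'_def)
    qed
  qed
  have fin: "finite {n. g (n - s) \<noteq> 0}" if "finite {n. g n \<noteq> 0}" for g :: "int \<Rightarrow> 'k"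
  proof -
    have "{n. g (n - s) \<noteq> 0} = (\<lambda>n. n + s) ` {n. g n \<noteq> 0}"
      by (auto simp: image_iff intro!: exI[of _ "_ - s"])
    then show ?thesis using that by simp
  qed
  have "D' \<noteq> (\<lambda>_. 0)" using D0 unfolding D'_def by (metis add_diff_cancel_right')
  moreover have "int r dvd n \<and> \<theta> (D' n) = D' n" if "D' n \<noteq> 0" for n
    using Dr[of "n - s"] that unfolding D'_def s_def by (simp add: dvd_diff_left_iff)
  ultimately have pair: "(D', a') \<in> frac_pairs \<theta> r"
    using fin[OF Dfin] fin[OF afin]
    by (auto simp: frac_pairs_def skew_centre_def skew_poly_def skew_series_def fixed_field_def
        D'_def a'_def)
  have "skew_mult \<theta> D' a n = skew_mult \<theta> D a' n" for n
  proof -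
    have "skew_mult \<theta> D' a n = (\<Sum>i | D' i \<noteq> 0 \<and> a (n - i) \<noteq> 0. D' i * a (n - i))"
      unfolding skew_mult_def using Dr[of "_ - s"]
      by (intro sum.cong refl) (auto simp: D'_def s_def dvd_diff_left_iff aut_pow_dvd[OF r(2)])
    also have "\<dots> = (\<Sum>i | D i \<noteq> 0 \<and> a' (n - i) \<noteq> 0. D i * a' (n - i))"
      by (rule sum.reindex_bij_witness[of _ "\<lambda>i. i + s" "\<lambda>i. i - s"])
        (auto simp: D'_def a'_def algebra_simps)
    also have "\<dots> = skew_mult \<theta> D a' n"
      unfolding skew_mult_def using Dr
      by (intro sum.cong refl) (auto simp: aut_pow_dvd[OF r(2)])
    finally show ?thesis .
  qed
  then have "(D', a') \<in> f"
    using pair Da unfolding f frac_rel_def by (auto simp: skew_poly_def skew_series_def)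
  moreover have "P \<in> polys_over (fixed_field \<theta>)"
    using Dr \<theta>0 unfolding polys_over_def fixed_field_def by (auto simp: cP) metis
  moreover have "\<exists>c xs. map_poly e P = smult c (\<Prod>x\<leftarrow>xs. [:- x, 1:])"
  proof (cases "map_poly e P = 0")
    case False
    then obtain A where "map_poly e P = smult (lead_coeff (map_poly e P)) (\<Prod>x\<in>#A. [:- x, 1:])"
      using alg_closed_imp_factorization by blast
    moreover obtain xs where "A = mset xs" by (metis ex_mset)
    ultimately show ?thesis by (metis mset_map prod_mset_prod_list)
  qed (auto intro: exI[of _ 0])
  ultimately show ?thesis unfolding separable_poles_def PD[symmetric] by blast
qed

end

theory Submission
  imports Defs "HOL-Computational_Algebra.Formal_Laurent_Series"
begin

text \<open>
  Write f = a / P(Y) with P over F and a a skew Laurent polynomial; all the residues are additive in a,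
  so let a = c X^n with c in K. Every coefficient w of the expansion of c X^n / P at a nonzero z satisfies
  w b = \<theta>^n(b) w for b in K, because the expansion is a morphism of K-algebras. If r does not divide n,
  this forces the 0-th section of w to vanish. If n = i r, the expansion is c times the usual Taylor
  expansion of the rational function Y^i / P(Y) at z, whatever the admissible morphism is, since Y is
  sent to z + T. So the residue at every point p, 0 and infinity included, is the tensor of c and of the
  usual residue of Y^i / P(Y) at p, and the claim is the classical residue theorem for a rational function
  with split denominator, which follows from partial fractions.
\<close>

section \<open>Residues of rational functions with split denominator\<close>

text \<open>No structure theory of A/NA enters. An admissible morphism is pinned down only on K, on
  Y and, modulo T, on X; the series that are computed explicitly are the images of polynomials in Y
  over F and of powers of Y. These lie in a copy of F(z)((T)) inside (A/NA)((T)), a commutative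
  field, so products and inverses are taken there and transported. At 0 and at infinity the same
  role is played by F((Y)) and F((1/Y)), whose coefficients reach F^s through \<open>e\<close>. For
  a fixed fraction a / P(Y), let c_i be the coefficient of X^(i r) in a. Each partial residue is
  brought to the form of a sum over i of c_i \<otimes> w_p(i), where c_i does not depend on the
  point p and w_p(i) lies in F^s. The sum over p is then performed in the second factor, separately
  for each i, and a residue theorem is needed only there. Residues are those of forms in dY and not
  in dY/Y: index 0 selects the coefficient of X^(-r), that is, of Y^(-1).\<close>

definition eval_fls :: "'a::field fls \<Rightarrow> 'a poly \<Rightarrow> 'a fls" where
  "eval_fls u p = poly (map_poly fls_const p) u"

lemma eval_fls_0 [simp]: "eval_fls u 0 = 0"
  by (simp add: eval_fls_def)

lemma eval_fls_pCons [simp]: "eval_fls u (pCons a p) = fls_const a + u * eval_fls u p"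
  by (cases "pCons a p = 0") (auto simp: eval_fls_def map_poly_pCons)

lemma eval_fls_1 [simp]: "eval_fls u 1 = 1"
  by (simp add: one_pCons)

lemma eval_fls_smult [simp]: "eval_fls u (smult c p) = fls_const c * eval_fls u p"
  by (induction p) (simp_all add: algebra_simps fls_const_mult_const)

lemma eval_fls_add: "eval_fls u (p + q) = eval_fls u p + eval_fls u q"
  by (induction p q rule: poly_induct2) (simp_all add: algebra_simps fls_plus_const)

lemma eval_fls_mult: "eval_fls u (p * q) = eval_fls u p * eval_fls u q"
  by (induction p) (simp_all add: algebra_simps eval_fls_add)

lemma eval_fls_linear_factors:
  "eval_fls u (\<Prod>x\<leftarrow>xs. [:- x, 1:]) = (\<Prod>x\<leftarrow>xs. u - fls_const x)"
proof (induction xs)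
  case (Cons a xs)
  have "eval_fls u [:- a, 1:] = u - fls_const a"
    by (simp add: fls_const_uminus)
  then show ?case using Cons by (simp only: list.map prod_list.Cons eval_fls_mult)
qed simp

text \<open>The expansion of Y in a uniformizer: T = Y - z at a finite point z, W = 1/Y at
  infinity.\<close>

definition local_param :: "'a::field option \<Rightarrow> 'a fls" where
  "local_param p = (case p of None \<Rightarrow> fls_X_inv | Some z \<Rightarrow> fls_const z + fls_X)"

text \<open>At infinity, with parameter W = 1/Y, the form dY is -dW/W^2, hence the coefficient of W.\<close>

definition residue_at :: "'a::field option \<Rightarrow> 'a fls \<Rightarrow> 'a" where
  "residue_at p g = (case p of None \<Rightarrow> - fls_nth g 1 | Some _ \<Rightarrow> fls_nth g (- 1))"

lemma residue_at_add: "residue_at p (g + h) = residue_at p g + residue_at p h"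
  and residue_at_scale: "residue_at p (fls_const c * g) = c * residue_at p g"
  by (cases p; simp add: residue_at_def)+

text \<open>The coefficient of T, or of W^(-1) at infinity, is 1 whatever x is, so linear factors
  can be inverted at every point.\<close>

lemma local_param_minus_const_nonzero: "local_param p - fls_const x \<noteq> 0"
proof
  assume *: "local_param p - fls_const x = 0"
  have "fls_nth (local_param p - fls_const x) (if p = None then -1 else 1) = 1"
    by (cases p) (simp_all add: local_param_def)
  with * show False by simp
qed

lemma local_param_nonzero: "local_param p \<noteq> 0"
  using local_param_minus_const_nonzero[of p 0] by simp

text \<open>a + T is a unit of the power series ring, so all its integral powers are free of
  negative exponents.\<close>

lemma fls_nth_power_int_const_plus_X:
  fixes a :: "'a::field"
  assumes "a \<noteq> 0"
  shows "fls_nth ((fls_const a + fls_X) powi k) (- 1) = 0"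
proof -
  have "fls_subdegree (fls_const a + fls_X) = 0"
    using assms by (intro fls_subdegree_eqI) auto
  then have "fls_subdegree ((fls_const a + fls_X) powi k) = 0"
    by simp
  then show ?thesis by (intro fls_eq0_below_subdegree) linarith
qed

text \<open>A power (Y - x)^k with k \<ge> 0 is a polynomial in Y = W^(-1), so no positive power of
  W occurs.\<close>

lemma fls_nth_power_X_inv_minus_const:
  fixes x :: "'a::field"
  shows "m > 0 \<Longrightarrow> fls_nth ((fls_X_inv - fls_const x) ^ k) m = 0"
proof (induction k arbitrary: m)
  case (Suc k)
  have "(fls_X_inv - fls_const x) ^ Suc k =
    fls_shift 1 ((fls_X_inv - fls_const x) ^ k) - fls_const x * (fls_X_inv - fls_const x) ^ k"
    by (simp add: left_diff_distrib fls_X_inv_times_conv_shift)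
  then show ?case using Suc by simp
qed simp

text \<open>Orders and leading coefficients are compared directly: the usual argument, that (Y -
  x)^k dY is exact for k \<noteq> -1, fails in characteristic p when p divides k + 1.\<close>

lemma residue_power_int:
  "residue_at p ((local_param p - fls_const x) powi k) =
     (if k = - 1 then if p = Some x then 1 else if p = None then - 1 else 0 else 0)"
proof (cases p)
  case (Some z)
  show ?thesis
  proof (cases "z = x")
    case True
    have "fls_nth ((fls_X :: 'a fls) powi k) (- 1) = (if k = - 1 then 1 else 0)"
      by (cases "k \<ge> 0") (auto simp: power_int_def fls_inverse_X)
    then show ?thesis using Some True by (simp add: local_param_def residue_at_def)
  next
    case False
    have "local_param p - fls_const x = fls_const (z - x) + fls_X"
      using Some by (simp add: local_param_def fls_minus_const)
    then show ?thesis using False Some fls_nth_power_int_const_plus_X[of "z - x" k]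
      by (auto simp: residue_at_def)
  qed
next
  case None
  define u :: "'a fls" where "u = fls_X_inv - fls_const x"
  have sub: "fls_subdegree u = - 1"
    unfolding u_def by (intro fls_subdegree_eqI) auto
  have u0: "u \<noteq> 0" using sub by auto
  have "fls_nth (u powi k) 1 = (if k = - 1 then 1 else 0)"
  proof -
    consider "k \<ge> 0" | "k = - 1" | "k < - 1" by linarith
    then show ?thesis
    proof cases
      case 1
      then show ?thesis
        using fls_nth_power_X_inv_minus_const[of 1 x "nat k"] by (simp add: power_int_def u_def)
    next
      case 2
      \<comment> \<open>1/u has order 1, so its coefficient at W is the leading one.\<close>
      have "fls_nth (inverse u) 1 = inverse (fls_nth u (- 1))"
        using fls_inverse_subdegree_base[of u] sub by simp
      moreover have "fls_nth u (- 1) = 1" by (simp add: u_def)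
      ultimately show ?thesis using 2 by simp
    next
      case 3
      then have "fls_subdegree (u powi k) = - k"
        using sub u0 by (simp add: power_int_def fls_subdegree_pow fls_inverse_subdegree)
      then show ?thesis using 3 by (simp add: fls_eq0_below_subdegree)
    qed
  qed
  then show ?thesis using None by (simp add: residue_at_def local_param_def u_def)
qed

text \<open>Vanishing off S and zero sum over S are kept together, for one fixed S, because both
  then pass to linear combinations. This is what the partial fraction induction needs.\<close>

definition residues_balanced :: "'a::field option set \<Rightarrow> ('a option \<Rightarrow> 'a fls) \<Rightarrow> bool" where
  "residues_balanced S g \<longleftrightarrow>
     (\<forall>p. p \<notin> S \<longrightarrow> residue_at p (g p) = 0) \<and> (\<Sum>p\<in>S. residue_at p (g p)) = 0"

lemma residues_balanced_add:
  "residues_balanced S g \<Longrightarrow> residues_balanced S h \<Longrightarrow> residues_balanced S (\<lambda>p. g p + h p)"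
  by (simp add: residues_balanced_def residue_at_add sum.distrib)

lemma residues_balanced_scale:
  "residues_balanced S g \<Longrightarrow> residues_balanced S (\<lambda>p. fls_const c * g p)"
  by (simp add: residues_balanced_def residue_at_scale flip: sum_distrib_left)

text \<open>
  Partial fractions: for x \<noteq> y, the identity (t - x) = (t - y) + (y - x) moves the exponent k of
  (t - x)^k / (t - y) towards 0.
\<close>

lemma residues_balanced_linear_factors:
  assumes S: "finite S" "None \<in> S"
  shows "Some x \<in> S \<Longrightarrow> Some ` set ys \<subseteq> S \<Longrightarrow>
    residues_balanced S (\<lambda>p. (local_param p - fls_const x) powi k
      / (\<Prod>y\<leftarrow>ys. local_param p - fls_const y))"
proof (induction ys arbitrary: x k)
  case Nil
  \<comment> \<open>Only x and infinity can contribute, and for k = -1 their residues 1 and -1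
    cancel.\<close>
  have "(\<Sum>p\<in>S. residue_at p ((local_param p - fls_const x) powi k)) =
    (\<Sum>p\<in>{Some x, None}. residue_at p ((local_param p - fls_const x) powi k))"
    using S Nil by (intro sum.mono_neutral_right) (auto simp: residue_power_int)
  then show ?case using S Nil by (auto simp: residues_balanced_def residue_power_int)
next
  case (Cons y ys)
  let ?t = "\<lambda>x p. local_param p - fls_const x"
  let ?d = "\<lambda>p. \<Prod>y\<leftarrow>ys. local_param p - fls_const y"
  have IH: "residues_balanced S (\<lambda>p. ?t x p powi k / ?d p)" if "Some x \<in> S" for x k
    using Cons that by auto
  show ?case
  proof (cases "x = y")
    case True
    have "?t x p powi k / (?t y p * ?d p) = ?t x p powi (k - 1) / ?d p" for p
      using local_param_minus_const_nonzero[of p y] True by (simp add: power_int_diff)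
    then show ?thesis using IH[of x "k - 1"] Cons by simp
  next
    case False
    have step: "?t x p powi (k + 1) / (?t y p * ?d p) =
        ?t x p powi k / ?d p + fls_const (y - x) * (?t x p powi k / (?t y p * ?d p))" for p k
    proof -
      have "?t x p powi (k + 1) = ?t x p powi k * (?t y p + fls_const (y - x))"
        using local_param_minus_const_nonzero[of p x] by (simp add: power_int_add fls_minus_const[symmetric])
      moreover have "?t x p powi k / ?d p = ?t x p powi k * ?t y p / (?t y p * ?d p)"
        using local_param_minus_const_nonzero[of p y] by simp
      ultimately show ?thesis by (simp add: ring_distribs add_divide_distrib mult.commute)
    qed
    have "residues_balanced S (\<lambda>p. ?t x p powi k / (?t y p * ?d p))"
    proof (induction k rule: int_induct[of _ 0])
      case base
      \<comment> \<open>For k = 0 the factor of y becomes the power with exponent -1 and y takes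
        over the role of x; this is why x is arbitrary in the induction over the list.\<close>
      have "?t y p powi (- 1) / ?d p = ?t x p powi 0 / (?t y p * ?d p)" for p
        by (simp add: divide_inverse)
      then show ?case using IH[of y "- 1"] Cons.prems by simp
    next
      case (step1 i)
      then show ?case unfolding step
        using IH[of x i] Cons.prems by (intro residues_balanced_add residues_balanced_scale) auto
    next
      case (step2 i)
      \<comment> \<open>Downwards, \<open>step\<close> at i - 1 is solved for its last summand,
        which requires y - x to be invertible.\<close>
      have c: "fls_const (inverse (y - x)) * fls_const (y - x) = 1"
        using False by (simp add: fls_const_mult_const)
      have "?t x p powi (i - 1) / (?t y p * ?d p) =
          fls_const (inverse (y - x)) * (?t x p powi i / (?t y p * ?d p)
            + fls_const (- 1) * (?t x p powi (i - 1) / ?d p))" for p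
        using step[of p "i - 1"] c by (simp add: mult.assoc[symmetric] fls_const_uminus)
      moreover have "residues_balanced S (\<lambda>p. fls_const (inverse (y - x)) * (?t x p powi i / (?t y p * ?d p)
            + fls_const (- 1) * (?t x p powi (i - 1) / ?d p)))"
        using step2 IH[of x "i - 1"] Cons.prems
        by (intro residues_balanced_add residues_balanced_scale) auto
      ultimately show ?case by simp
    qed
    then show ?thesis by simp
  qed
qed

text \<open>Y^i is the power (Y - x)^i at x = 0; hence the point 0 belongs to the set even when it
  is not a root of the denominator.\<close>

lemma residue_theorem:
  fixes xs :: "'a::field list"
  assumes "c \<noteq> 0"
  shows "residues_balanced (insert None (insert (Some 0) (Some ` set xs)))
    (\<lambda>p. local_param p powi i / eval_fls (local_param p) (smult c (\<Prod>x\<leftarrow>xs. [:- x, 1:])))"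
proof -
  have "local_param p powi i / eval_fls (local_param p) (smult c (\<Prod>x\<leftarrow>xs. [:- x, 1:]))
    = fls_const (inverse c) * ((local_param p - fls_const 0) powi i / (\<Prod>x\<leftarrow>xs. local_param p - fls_const x))"
    for p :: "'a option"
    using assms by (simp add: eval_fls_linear_factors divide_inverse fls_inverse_const ac_simps)
  then show ?thesis
    using residues_balanced_scale[OF residues_balanced_linear_factors[of
          "insert None (insert (Some 0) (Some ` set xs))" 0 xs i], of "inverse c"] by auto
qed


section \<open>Rings of skew Laurent polynomials and series\<close>

locale field_automorphism =
  fixes \<theta> :: "'k::field \<Rightarrow> 'k"
  assumes add: "\<theta> (a + b) = \<theta> a + \<theta> b"
    and mult: "\<theta> (a * b) = \<theta> a * \<theta> b"
    and bij: "bij \<theta>"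
begin

lemma zero [simp]: "\<theta> 0 = 0"
  by (metis add add.right_neutral add_left_cancel)

lemma inj: "\<theta> a = \<theta> b \<longleftrightarrow> a = b"
  using bij by (auto simp: bij_def inj_def)

lemma one [simp]: "\<theta> 1 = 1"
proof -
  have "\<theta> 1 \<noteq> 0" using inj[of 1 0] by simp
  then show ?thesis using mult[of 1 1] by simp
qed

lemma minus: "\<theta> (- a) = - \<theta> a"
  using add[of a "- a"] by (simp add: eq_neg_iff_add_eq_0 add.commute)

lemma inverse: "\<theta> (inverse a) = inverse (\<theta> a)"
  by (cases "a = 0") (auto intro!: inverse_unique[symmetric] simp flip: mult)

text \<open>The expansion at infinity is a series twisted by the inverse of \<theta>, so the facts
  about skew series are needed for that automorphism too.\<close>

lemma inv_automorphism: "field_automorphism (inv_into UNIV \<theta>)"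
proof
  show "bij (inv_into UNIV \<theta>)" using bij by (rule bij_imp_bij_inv)
  have [simp]: "\<theta> (inv_into UNIV \<theta> x) = x" for x
    using bij by (simp add: bij_is_surj surj_f_inv_f)
  show "inv_into UNIV \<theta> (a + b) = inv_into UNIV \<theta> a + inv_into UNIV \<theta> b"
    "inv_into UNIV \<theta> (a * b) = inv_into UNIV \<theta> a * inv_into UNIV \<theta> b" for a b
    by (simp_all add: add mult flip: inj)
qed

lemma aut_pow_0 [simp]: "aut_pow \<theta> 0 a = a"
  by (simp add: aut_pow_def)

lemma aut_pow_Suc: "aut_pow \<theta> (i + 1) a = \<theta> (aut_pow \<theta> i a)"
proof (cases "i \<ge> 0")
  case True
  then show ?thesis by (simp add: aut_pow_def nat_add_distrib)
next
  case False
  then have "nat (- i) = Suc (nat (- (i + 1)))" by simp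
  then have "\<theta> (aut_pow \<theta> i a) = (inv_into UNIV \<theta> ^^ nat (- (i + 1))) a"
    using False bij by (simp add: aut_pow_def bij_is_surj surj_f_inv_f)
  then show ?thesis using False by (cases "i = - 1") (auto simp: aut_pow_def)
qed

lemma aut_pow_pred: "\<theta> (aut_pow \<theta> (i - 1) a) = aut_pow \<theta> i a"
  using aut_pow_Suc[of "i - 1" a] by simp

lemma aut_pow_add: "aut_pow \<theta> (i + j) a = aut_pow \<theta> i (aut_pow \<theta> j a)"
proof (induction i rule: int_induct[of _ 0])
  case (step1 i)
  have "i + 1 + j = i + j + 1" by simp
  with step1 show ?case by (simp only: aut_pow_Suc)
next
  case (step2 i)
  have "\<theta> (aut_pow \<theta> (i - 1 + j) a) = \<theta> (aut_pow \<theta> (i - 1) (aut_pow \<theta> j a))"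
    using step2 aut_pow_pred[of "i + j" a] by (simp add: aut_pow_pred algebra_simps)
  then show ?case by (simp add: inj)
qed simp

lemma aut_pow_automorphism: "field_automorphism (aut_pow \<theta> i)"
proof -
  have *: "aut_pow \<theta> i (a + b) = aut_pow \<theta> i a + aut_pow \<theta> i b \<and>
    aut_pow \<theta> i (a * b) = aut_pow \<theta> i a * aut_pow \<theta> i b" for a b
  proof (induction i rule: int_induct[of _ 0])
    case (step2 i)
    then have "\<theta> (aut_pow \<theta> (i - 1) (a + b)) = \<theta> (aut_pow \<theta> (i - 1) a + aut_pow \<theta> (i - 1) b)"
      "\<theta> (aut_pow \<theta> (i - 1) (a * b)) = \<theta> (aut_pow \<theta> (i - 1) a * aut_pow \<theta> (i - 1) b)"
      by (simp_all add: aut_pow_pred add mult)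
    then show ?case by (simp add: inj)
  qed (auto simp: aut_pow_Suc add mult)
  have "aut_pow \<theta> i \<circ> aut_pow \<theta> (- i) = id" "aut_pow \<theta> (- i) \<circ> aut_pow \<theta> i = id"
    by (auto simp: fun_eq_iff simp flip: aut_pow_add)
  then show ?thesis using * by unfold_locales (auto intro: o_bij)
qed

lemmas aut_pow_plus = field_automorphism.add[OF aut_pow_automorphism]
  and aut_pow_mult = field_automorphism.mult[OF aut_pow_automorphism]
  and aut_pow_zero [simp] = field_automorphism.zero[OF aut_pow_automorphism]
  and aut_pow_one [simp] = field_automorphism.one[OF aut_pow_automorphism]
  and aut_pow_inj = field_automorphism.inj[OF aut_pow_automorphism]

lemma aut_pow_sum: "aut_pow \<theta> i (sum g S) = (\<Sum>s\<in>S. aut_pow \<theta> i (g s))"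
  by (induction S rule: infinite_finite_induct) (simp_all add: aut_pow_plus)

lemma aut_pow_eq_0_iff [simp]: "aut_pow \<theta> i a = 0 \<longleftrightarrow> a = 0"
  using aut_pow_inj[of i a 0] by simp

lemma aut_pow_inv: "aut_pow (inv_into UNIV \<theta>) i = aut_pow \<theta> (- i)"
  using bij by (auto simp: aut_pow_def inv_inv_eq)

lemma aut_pow_fixed: "a \<in> fixed_field \<theta> \<Longrightarrow> aut_pow \<theta> i a = a"
proof (induction i rule: int_induct[of _ 0])
  case (step2 i)
  then have "\<theta> (aut_pow \<theta> (i - 1) a) = \<theta> a" by (simp add: aut_pow_pred fixed_field_def)
  then show ?case by (simp add: inj)
qed (simp_all add: aut_pow_Suc fixed_field_def)

lemma fixed_field_inv: "fixed_field (inv_into UNIV \<theta>) = fixed_field \<theta>"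
proof -
  have "\<theta> (inv_into UNIV \<theta> x) = x" for x
    using bij by (simp add: bij_is_surj surj_f_inv_f)
  then show ?thesis unfolding fixed_field_def using inj by metis
qed

lemma fixed_field_closed:
  "0 \<in> fixed_field \<theta>" "1 \<in> fixed_field \<theta>"
  "a \<in> fixed_field \<theta> \<Longrightarrow> b \<in> fixed_field \<theta> \<Longrightarrow> a + b \<in> fixed_field \<theta>"
  "a \<in> fixed_field \<theta> \<Longrightarrow> b \<in> fixed_field \<theta> \<Longrightarrow> a * b \<in> fixed_field \<theta>"
  "a \<in> fixed_field \<theta> \<Longrightarrow> - a \<in> fixed_field \<theta>"
  "a \<in> fixed_field \<theta> \<Longrightarrow> inverse a \<in> fixed_field \<theta>"
  by (simp_all add: fixed_field_def add mult minus inverse)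

end

lemma skew_series_simps [simp]:
  "carrier (skew_series \<theta>) = {a. \<exists>m. \<forall>i<m. a i = 0}"
  "monoid.mult (skew_series \<theta>) = skew_mult \<theta>" "one (skew_series \<theta>) = skew_monom 1 0"
  "zero (skew_series \<theta>) = (\<lambda>_. 0)" "ring.add (skew_series \<theta>) = (\<lambda>a b i. a i + b i)"
  by (simp_all add: skew_series_def)

lemma skew_poly_simps [simp]:
  "carrier (skew_poly \<theta>) = {a. finite {i. a i \<noteq> 0}}"
  "monoid.mult (skew_poly \<theta>) = skew_mult \<theta>" "one (skew_poly \<theta>) = skew_monom 1 0"
  "zero (skew_poly \<theta>) = (\<lambda>_. 0)" "ring.add (skew_poly \<theta>) = (\<lambda>a b i. a i + b i)"
  by (simp_all add: skew_poly_def skew_series_def)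

lemma skew_monom_in_skew_poly: "skew_monom c n \<in> carrier (skew_poly \<theta>)"
  using finite_subset[of "{i. skew_monom c n i \<noteq> 0}" "{n}"] by (auto simp: skew_monom_def)

lemma skew_poly_subset_series: "carrier (skew_poly \<theta>) \<subseteq> carrier (skew_series \<theta>)"
proof
  fix a assume "a \<in> carrier (skew_poly \<theta>)"
  then have fin: "finite {i. a i \<noteq> 0}" by simp
  \<comment> \<open>Inserting 0 keeps the set nonempty, so that \<open>Min\<close> also serves for
    the zero polynomial.\<close>
  have "a i = 0" if "i < Min (insert 0 {i. a i \<noteq> 0})" for i
  proof (rule ccontr)
    assume "a i \<noteq> 0"
    then have "Min (insert 0 {i. a i \<noteq> 0}) \<le> i" using fin by (intro Min_le) auto
    with that show False by simp
  qed
  then show "a \<in> carrier (skew_series \<theta>)"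
    by (simp only: skew_series_simps mem_Collect_eq) blast
qed

context field_automorphism
begin

lemma skew_mult_eq_sum:
  assumes "finite S" "{i. a i \<noteq> 0 \<and> b (n - i) \<noteq> 0} \<subseteq> S"
  shows "skew_mult \<theta> a b n = (\<Sum>i\<in>S. a i * aut_pow \<theta> i (b (n - i)))"
  unfolding skew_mult_def using assms by (intro sum.mono_neutral_left) auto

text \<open>The bounds L and U may be chosen generously: an interval that does not depend on the
  outer index is what allows two summations to be interchanged.\<close>

lemma skew_mult_eq_sum_interval:
  assumes "\<forall>i<A. a i = 0" "\<forall>i<B. b i = 0" "L \<le> A" "n - B \<le> U"
  shows "skew_mult \<theta> a b n = (\<Sum>i=L..U. a i * aut_pow \<theta> i (b (n - i)))"
proof (intro skew_mult_eq_sum subsetI)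
  fix i assume "i \<in> {i. a i \<noteq> 0 \<and> b (n - i) \<noteq> 0}"
  then have "\<not> i < A" "\<not> n - i < B" using assms by auto
  then show "i \<in> {L..U}" using assms by simp
qed simp

lemma skew_mult_below:
  assumes "\<forall>i<A. a i = 0" "\<forall>i<B. b i = 0" "n < A + B"
  shows "skew_mult \<theta> a b n = 0"
  using skew_mult_eq_sum_interval[OF assms(1,2), of A n "n - B"] assms(3) by simp

lemma skew_mult_assoc:
  assumes "a \<in> carrier (skew_series \<theta>)" "b \<in> carrier (skew_series \<theta>)" "c \<in> carrier (skew_series \<theta>)"
  shows "skew_mult \<theta> (skew_mult \<theta> a b) c = skew_mult \<theta> a (skew_mult \<theta> b c)"
proof
  fix n
  obtain A B C where A: "\<forall>i<A. a i = 0" and B: "\<forall>i<B. b i = 0" and C: "\<forall>i<C. c i = 0"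
    using assms by auto
  have AB: "\<forall>i<A+B. skew_mult \<theta> a b i = 0" and BC: "\<forall>i<B+C. skew_mult \<theta> b c i = 0"
    using skew_mult_below A B C by blast+
  let ?g = "\<lambda>i j. a i * aut_pow \<theta> i (b j) * aut_pow \<theta> (i + j) (c (n - i - j))"
  have "skew_mult \<theta> (skew_mult \<theta> a b) c n
      = (\<Sum>l=A+B..n-C. skew_mult \<theta> a b l * aut_pow \<theta> l (c (n - l)))"
    by (rule skew_mult_eq_sum_interval[OF AB C]) auto
  \<comment> \<open>Since l \<le> n - C, the inner range can be enlarged to i \<le> n - B - C, which
    no longer depends on l.\<close>
  also have "\<dots> = (\<Sum>l=A+B..n-C. \<Sum>i=A..n-B-C. ?g i (l - i))"
    by (intro sum.cong refl, subst skew_mult_eq_sum_interval[OF A B, of A _ "n - B - C"])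
      (auto simp: sum_distrib_right)
  also have "\<dots> = (\<Sum>i=A..n-B-C. \<Sum>l=A+B..n-C. ?g i (l - i))"
    by (rule sum.swap)
  also have "\<dots> = (\<Sum>i=A..n-B-C. \<Sum>j=B..n-i-C. ?g i j)"
  proof (rule sum.cong[OF refl])
    fix i assume i: "i \<in> {A..n-B-C}"
    have "(\<Sum>l=A+B..n-C. ?g i (l - i)) = (\<Sum>j=A+B-i..n-C-i. ?g i j)"
      by (rule sum.reindex_bij_witness[of _ "\<lambda>j. j + i" "\<lambda>l. l - i"]) auto
    \<comment> \<open>As i \<ge> A, the old range starts at or below B, and b vanishes below
      B.\<close>
    also have "\<dots> = (\<Sum>j=B..n-i-C. ?g i j)"
      using i B by (intro sum.mono_neutral_right) auto
    finally show "(\<Sum>l=A+B..n-C. ?g i (l - i)) = (\<Sum>j=B..n-i-C. ?g i j)" .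
  qed
  also have "\<dots> = (\<Sum>i=A..n-B-C. a i * aut_pow \<theta> i (skew_mult \<theta> b c (n - i)))"
    by (intro sum.cong refl, subst skew_mult_eq_sum_interval[OF B C, of B])
      (auto simp: aut_pow_sum sum_distrib_left aut_pow_mult aut_pow_add mult.assoc)
  also have "\<dots> = skew_mult \<theta> a (skew_mult \<theta> b c) n"
    by (rule skew_mult_eq_sum_interval[symmetric, OF A BC]) auto
  finally show "skew_mult \<theta> (skew_mult \<theta> a b) c n = skew_mult \<theta> a (skew_mult \<theta> b c) n" .
qed

lemma skew_mult_monom_left: "skew_mult \<theta> (skew_monom c m) b n = c * aut_pow \<theta> m (b (n - m))"
  by (subst skew_mult_eq_sum[of "{m}"]) (auto simp: skew_monom_def)

lemma skew_mult_monom_right: "skew_mult \<theta> a (skew_monom c m) n = a (n - m) * aut_pow \<theta> (n - m) c"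
  by (subst skew_mult_eq_sum[of "{n - m}"]) (auto simp: skew_monom_def split: if_splits)

lemma skew_mult_add_left:
  assumes "a \<in> carrier (skew_series \<theta>)" "b \<in> carrier (skew_series \<theta>)" "c \<in> carrier (skew_series \<theta>)"
  shows "skew_mult \<theta> (\<lambda>i. a i + b i) c = (\<lambda>i. skew_mult \<theta> a c i + skew_mult \<theta> b c i)"
proof
  fix n
  obtain A B C where "\<forall>i<A. a i = 0" and "\<forall>i<B. b i = 0" and C: "\<forall>i<C. c i = 0"
    using assms by auto
  then have *: "\<forall>i<min A B. a i = 0" "\<forall>i<min A B. b i = 0" "\<forall>i<min A B. a i + b i = 0" by auto
  show "skew_mult \<theta> (\<lambda>i. a i + b i) c n = skew_mult \<theta> a c n + skew_mult \<theta> b c n"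
    unfolding *[THEN skew_mult_eq_sum_interval, OF C order_refl order_refl]
    by (simp add: sum.distrib ring_distribs)
qed

lemma skew_mult_add_right:
  assumes "a \<in> carrier (skew_series \<theta>)" "b \<in> carrier (skew_series \<theta>)" "c \<in> carrier (skew_series \<theta>)"
  shows "skew_mult \<theta> c (\<lambda>i. a i + b i) = (\<lambda>i. skew_mult \<theta> c a i + skew_mult \<theta> c b i)"
proof
  fix n
  obtain A B C where "\<forall>i<A. a i = 0" and "\<forall>i<B. b i = 0" and C: "\<forall>i<C. c i = 0"
    using assms by auto
  then have *: "\<forall>i<min A B. a i = 0" "\<forall>i<min A B. b i = 0" "\<forall>i<min A B. a i + b i = 0" by auto
  show "skew_mult \<theta> c (\<lambda>i. a i + b i) n = skew_mult \<theta> c a n + skew_mult \<theta> c b n"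
    unfolding *[THEN skew_mult_eq_sum_interval[OF C], OF order_refl order_refl]
    by (simp add: sum.distrib ring_distribs aut_pow_plus)
qed

lemma ring_skew_series: "ring (skew_series \<theta>)"
proof (intro ringI abelian_groupI monoidI)
  show "x \<oplus>\<^bsub>skew_series \<theta>\<^esub> y \<in> carrier (skew_series \<theta>)"
    if "x \<in> carrier (skew_series \<theta>)" "y \<in> carrier (skew_series \<theta>)" for x y
  proof -
    obtain A B where "\<forall>i<A. x i = 0" "\<forall>i<B. y i = 0" using \<open>x \<in> _\<close> \<open>y \<in> _\<close> by auto
    then show ?thesis by (auto intro!: exI[of _ "min A B"])
  qed
  show "\<exists>y\<in>carrier (skew_series \<theta>). y \<oplus>\<^bsub>skew_series \<theta>\<^esub> x = \<zero>\<^bsub>skew_series \<theta>\<^esub>"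
    if "x \<in> carrier (skew_series \<theta>)" for x
    using that by (intro bexI[of _ "\<lambda>i. - x i"]) auto
  show "x \<otimes>\<^bsub>skew_series \<theta>\<^esub> y \<in> carrier (skew_series \<theta>)"
    if "x \<in> carrier (skew_series \<theta>)" "y \<in> carrier (skew_series \<theta>)" for x y
    using that skew_mult_below[of _ x _ y] by auto
  show "\<one>\<^bsub>skew_series \<theta>\<^esub> \<in> carrier (skew_series \<theta>)"
    by (auto simp: skew_monom_def intro: exI[of _ 0])
  show "(x \<otimes>\<^bsub>skew_series \<theta>\<^esub> y) \<otimes>\<^bsub>skew_series \<theta>\<^esub> z =
      x \<otimes>\<^bsub>skew_series \<theta>\<^esub> (y \<otimes>\<^bsub>skew_series \<theta>\<^esub> z)"
    if "x \<in> carrier (skew_series \<theta>)" "y \<in> carrier (skew_series \<theta>)" "z \<in> carrier (skew_series \<theta>)" for x y z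
    using skew_mult_assoc[OF that] by simp
  show "(x \<oplus>\<^bsub>skew_series \<theta>\<^esub> y) \<otimes>\<^bsub>skew_series \<theta>\<^esub> z =
      x \<otimes>\<^bsub>skew_series \<theta>\<^esub> z \<oplus>\<^bsub>skew_series \<theta>\<^esub> y \<otimes>\<^bsub>skew_series \<theta>\<^esub> z"
    if "x \<in> carrier (skew_series \<theta>)" "y \<in> carrier (skew_series \<theta>)" "z \<in> carrier (skew_series \<theta>)" for x y z
    using skew_mult_add_left[OF that] by simp
  show "z \<otimes>\<^bsub>skew_series \<theta>\<^esub> (x \<oplus>\<^bsub>skew_series \<theta>\<^esub> y) =
      z \<otimes>\<^bsub>skew_series \<theta>\<^esub> x \<oplus>\<^bsub>skew_series \<theta>\<^esub> z \<otimes>\<^bsub>skew_series \<theta>\<^esub> y"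
    if "x \<in> carrier (skew_series \<theta>)" "y \<in> carrier (skew_series \<theta>)" "z \<in> carrier (skew_series \<theta>)" for x y z
    using skew_mult_add_right[OF that] by simp
qed (auto simp: fun_eq_iff skew_mult_monom_left skew_mult_monom_right ac_simps)

lemma skew_mult_closed_poly:
  assumes "a \<in> carrier (skew_poly \<theta>)" "b \<in> carrier (skew_poly \<theta>)"
  shows "skew_mult \<theta> a b \<in> carrier (skew_poly \<theta>)"
proof -
  have "{n. skew_mult \<theta> a b n \<noteq> 0} \<subseteq> (\<lambda>(i, j). i + j) ` ({i. a i \<noteq> 0} \<times> {i. b i \<noteq> 0})"
  proof
    fix n assume "n \<in> {n. skew_mult \<theta> a b n \<noteq> 0}"
    then obtain i where "a i \<noteq> 0" "b (n - i) \<noteq> 0"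
      unfolding skew_mult_def by (auto elim: sum.not_neutral_contains_not_neutral)
    then show "n \<in> (\<lambda>(i, j). i + j) ` ({i. a i \<noteq> 0} \<times> {i. b i \<noteq> 0})"
      by (intro image_eqI[of _ _ "(i, n - i)"]) auto
  qed
  then show ?thesis using assms finite_subset by fastforce
qed

text \<open>The operations are those of the series ring, so the identities are inherited and only
  closure of the finitely supported elements has to be checked.\<close>

lemma ring_skew_poly: "ring (skew_poly \<theta>)"
proof -
  interpret ring "skew_series \<theta>" by (rule ring_skew_series)
  have sub: "x \<in> carrier (skew_series \<theta>)" if "x \<in> carrier (skew_poly \<theta>)" for x
    using that skew_poly_subset_series by blast
  note assoc = m_assoc[OF sub sub sub] and distr = l_distr[OF sub sub sub] r_distr[OF sub sub sub]
    and units = l_one[OF sub] r_one[OF sub] and plus = a_assoc[OF sub sub sub] a_comm[OF sub sub] l_zero[OF sub]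
  show ?thesis
  proof (intro ringI abelian_groupI monoidI)
    show "x \<oplus>\<^bsub>skew_poly \<theta>\<^esub> y \<in> carrier (skew_poly \<theta>)"
      if "x \<in> carrier (skew_poly \<theta>)" "y \<in> carrier (skew_poly \<theta>)" for x y
      using that by (auto intro: finite_subset[of _ "{i. x i \<noteq> 0} \<union> {i. y i \<noteq> 0}"])
    show "\<exists>y\<in>carrier (skew_poly \<theta>). y \<oplus>\<^bsub>skew_poly \<theta>\<^esub> x = \<zero>\<^bsub>skew_poly \<theta>\<^esub>"
      if "x \<in> carrier (skew_poly \<theta>)" for x
      using that by (intro bexI[of _ "\<lambda>i. - x i"]) auto
    show "x \<otimes>\<^bsub>skew_poly \<theta>\<^esub> y \<in> carrier (skew_poly \<theta>)"
      if "x \<in> carrier (skew_poly \<theta>)" "y \<in> carrier (skew_poly \<theta>)" for x y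
      using that skew_mult_closed_poly[of x y] by simp
    show "\<one>\<^bsub>skew_poly \<theta>\<^esub> \<in> carrier (skew_poly \<theta>)"
      using skew_monom_in_skew_poly[of 1 0 \<theta>] by simp
    show "\<zero>\<^bsub>skew_poly \<theta>\<^esub> \<in> carrier (skew_poly \<theta>)" by simp
  qed
    (use assoc distr units plus in \<open>simp_all only: skew_series_simps skew_poly_simps\<close>)
qed

end


section \<open>Series in Y with coefficients in the fixed field\<close>

text \<open>Instantiated twice: by the fixed field F inside K and by F(z) inside F^s.\<close>

locale subfield_set =
  fixes F :: "'a::field set"
  assumes zero: "0 \<in> F" and one: "1 \<in> F"
    and add: "a \<in> F \<Longrightarrow> b \<in> F \<Longrightarrow> a + b \<in> F"
    and mult: "a \<in> F \<Longrightarrow> b \<in> F \<Longrightarrow> a * b \<in> F"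
    and minus: "a \<in> F \<Longrightarrow> - a \<in> F"
    and inverse: "a \<in> F \<Longrightarrow> inverse a \<in> F"
begin

lemma sum: "(\<And>i. i \<in> I \<Longrightarrow> g i \<in> F) \<Longrightarrow> sum g I \<in> F"
  by (induction I rule: infinite_finite_induct) (auto simp: zero add)

definition fls_over :: "'a fls \<Rightarrow> bool" where
  "fls_over g \<longleftrightarrow> (\<forall>n. fls_nth g n \<in> F)"

lemma fls_over_add: "fls_over g \<Longrightarrow> fls_over h \<Longrightarrow> fls_over (g + h)"
  by (simp add: fls_over_def add)

lemma fls_over_const: "a \<in> F \<Longrightarrow> fls_over (fls_const a)"
  by (simp add: fls_over_def zero)

lemma fls_over_X: "fls_over fls_X" and fls_over_X_inv: "fls_over fls_X_inv"
  by (simp_all add: fls_over_def zero one)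

lemma fls_over_mult: "fls_over g \<Longrightarrow> fls_over h \<Longrightarrow> fls_over (g * h)"
  unfolding fls_over_def fls_times_nth(2) by (auto intro!: sum mult)

text \<open>The equation g h = 1 determines each coefficient of h from the earlier ones by ring
  operations and division by the leading coefficient of g, all inside F.\<close>

lemma fls_over_inverse:
  assumes "fls_over g"
  shows "fls_over (inverse g)"
proof (cases "g = 0")
  case False
  define d h where "d = fls_subdegree g" and "h = inverse g"
  have d: "fls_nth g d \<noteq> 0" unfolding d_def using False by simp
  have sub: "fls_subdegree h = - d" by (simp add: h_def d_def)
  have "fls_nth h n \<in> F" for n
  proof (induction "nat (n + d)" arbitrary: n rule: less_induct)
    case less
    show ?case
    proof (cases "n < - d")
      case True
      then show ?thesis using sub fls_eq0_below_subdegree[of n h] zero by simp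
    next
      case False
      \<comment> \<open>The coefficient of g h at n + d is the first one to involve the n-th
        coefficient of h, namely in the term i = d. The upper limit is (n + d) - (- d), because h
        has order -d.\<close>
      have "(\<Sum>i=d..n + d + d. fls_nth g i * fls_nth h (n + d - i)) = fls_nth (g * h) (n + d)"
        by (subst fls_times_nth(2)) (simp add: sub flip: d_def)
      also have "\<dots> = (if n + d = 0 then 1 else 0)"
        using \<open>g \<noteq> 0\<close> by (simp add: h_def)
      also have "(\<Sum>i=d..n + d + d. fls_nth g i * fls_nth h (n + d - i)) =
          fls_nth g d * fls_nth h n + (\<Sum>i=d+1..n + d + d. fls_nth g i * fls_nth h (n + d - i))"
      proof -
        have "{d..n + d + d} = insert d {d+1..n + d + d}" using False by auto
        then show ?thesis by simp
      qed
      finally have "fls_nth h n = inverse (fls_nth g d) *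
          ((if n + d = 0 then 1 else 0) + - (\<Sum>i=d+1..n + d + d. fls_nth g i * fls_nth h (n + d - i)))"
        using d by (simp add: field_simps)
      moreover have "(\<Sum>i=d+1..n + d + d. fls_nth g i * fls_nth h (n + d - i)) \<in> F"
        using assms False by (intro sum mult less) (auto simp: fls_over_def)
      ultimately show ?thesis
        using assms by (auto simp: fls_over_def zero one intro!: mult inverse add minus)
    qed
  qed
  then show ?thesis by (simp add: fls_over_def h_def)
qed (simp add: fls_over_def zero)

lemma fls_over_divide: "fls_over g \<Longrightarrow> fls_over h \<Longrightarrow> fls_over (g / h)"
  by (simp add: divide_inverse fls_over_mult fls_over_inverse)

lemma fls_over_power_int: "fls_over g \<Longrightarrow> fls_over (g powi k)"
proof -
  have "fls_over (h ^ n)" if "fls_over h" for h n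
    using that fls_over_const[OF one] by (induction n) (simp_all add: fls_over_mult)
  then show "fls_over g \<Longrightarrow> fls_over (g powi k)" by (simp add: power_int_def fls_over_inverse)
qed

lemma fls_over_eval_fls: "P \<in> polys_over F \<Longrightarrow> fls_over u \<Longrightarrow> fls_over (eval_fls u P)"
proof (induction P)
  case 0
  then show ?case by (simp add: fls_over_def zero)
next
  case (pCons a P)
  have "\<forall>i. poly.coeff (pCons a P) i \<in> F" using pCons by (simp add: polys_over_def)
  then have "a \<in> F" "P \<in> polys_over F"
    unfolding polys_over_def by (auto dest: spec[of _ 0]) (metis coeff_pCons_Suc)
  then show ?case using pCons by (simp add: fls_over_add fls_over_mult fls_over_const)
qed

end

lemma polys_over_pCons_iff: "pCons a P \<in> polys_over F \<longleftrightarrow> a \<in> F \<and> P \<in> polys_over F"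
  by (auto simp: polys_over_def coeff_pCons split: nat.splits)

section \<open>Field embeddings extended to Laurent series\<close>

locale field_embedding =
  fixes e :: "'k::field \<Rightarrow> 's::field"
  assumes add: "e (a + b) = e a + e b" and mult: "e (a * b) = e a * e b" and one [simp]: "e 1 = 1"
begin

lemma zero [simp]: "e 0 = 0"
  by (metis add add.right_neutral add_left_cancel)

lemma minus: "e (- a) = - e a"
  using add[of a "- a"] by (simp add: eq_neg_iff_add_eq_0 add.commute)

lemma eq_0_iff [simp]: "e a = 0 \<longleftrightarrow> a = 0"
proof
  show "a = 0" if "e a = 0"
  proof (rule ccontr)
    assume "a \<noteq> 0"
    then have "e a * e (inverse a) = 1" by (simp flip: mult)
    with that show False by simp
  qed
qed simp

lemma inverse: "e (inverse a) = inverse (e a)"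
  by (cases "a = 0") (auto intro!: inverse_unique[symmetric] simp flip: mult)

lemma sum: "e (sum g I) = (\<Sum>i\<in>I. e (g i))"
  by (induction I rule: infinite_finite_induct) (simp_all add: add)

definition map_fls :: "'k fls \<Rightarrow> 's fls" where
  "map_fls g = Abs_fls (\<lambda>n. e (fls_nth g n))"

lemma map_fls_nth [simp]: "fls_nth (map_fls g) n = e (fls_nth g n)"
  unfolding map_fls_def
  by (rule nth_Abs_fls_lower_bound[of "fls_subdegree g"]) simp

text \<open>Injectivity of \<open>e\<close> preserves the leading coefficient, so in
  \<open>map_fls_mult\<close> both convolutions run over the same range.\<close>

lemma fls_subdegree_map_fls [simp]: "fls_subdegree (map_fls g) = fls_subdegree g"
proof (cases "g = 0")
  case True
  then have "map_fls g = 0" by (intro fls_eqI) simp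
  then show ?thesis using True by simp
qed (auto intro: fls_subdegree_eqI)

lemma map_fls_add: "map_fls (g + h) = map_fls g + map_fls h"
  by (intro fls_eqI) (simp add: add)

lemma map_fls_const: "map_fls (fls_const a) = fls_const (e a)"
  by (intro fls_eqI) simp

lemma map_fls_mult: "map_fls (g * h) = map_fls g * map_fls h"
  by (intro fls_eqI) (simp add: fls_times_nth(2) sum mult)

lemma map_fls_inverse: "map_fls (Fields.inverse g) = Fields.inverse (map_fls g)"
proof (cases "g = 0")
  case True
  moreover have "map_fls 0 = 0" by (intro fls_eqI) simp
  ultimately show ?thesis by simp
next
  case False
  then have "map_fls g * map_fls (Fields.inverse g) = map_fls 1"
    by (simp flip: map_fls_mult)
  also have "map_fls 1 = 1" by (intro fls_eqI) simp
  finally have "map_fls g * map_fls (Fields.inverse g) = 1" .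
  then show ?thesis by (intro inverse_unique[symmetric])
qed

lemma map_poly_pCons_embedding [simp]: "map_poly e (pCons a P) = pCons (e a) (map_poly e P)"
  by (cases "pCons a P = 0") (auto simp: map_poly_pCons)

lemma map_fls_eval_fls: "map_fls (eval_fls u P) = eval_fls (map_fls u) (map_poly e P)"
proof (induction P)
  case 0
  then show ?case by (intro fls_eqI) simp
qed (simp add: map_fls_add map_fls_mult map_fls_const)

text \<open>At 0 and at infinity the parameters have coefficients 0 and 1 only. Expansions there can
  therefore be computed over K, where the definitions of the partial residues place them, and
  transported by \<open>e\<close>.\<close>

lemma map_fls_local_param:
  "map_fls (local_param (Some 0)) = local_param (Some 0)"
  "map_fls (local_param None) = local_param None"
  by (intro fls_eqI; simp add: local_param_def)+

end

sublocale field_automorphism \<subseteq> fixed: subfield_set "fixed_field \<theta>"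
  by unfold_locales (auto intro: fixed_field_closed)

lemma eval_fls_X_nth:
  "fls_nth (eval_fls (local_param (Some 0)) P) n = (if n \<ge> 0 then poly.coeff P (nat n) else 0)"
proof (induction P arbitrary: n)
  case (pCons a P)
  then show ?case
    by (cases "n = 0")
      (auto simp: local_param_def fls_X_times_conv_shift coeff_pCons nat_diff_distrib split: nat.splits)
qed simp

lemma eval_fls_X_inv_nth:
  "fls_nth (eval_fls (local_param None) P) n = (if n \<le> 0 then poly.coeff P (nat (- n)) else 0)"
proof (induction P arbitrary: n)
  case (pCons a P)
  have "nat (- n) = Suc k \<Longrightarrow> nat (- n - 1) = k" for k by simp
  then show ?case using pCons
    by (cases "n = 0")
      (auto simp: local_param_def fls_X_inv_times_conv_shift coeff_pCons split: nat.splits)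
qed simp

text \<open>Carries products and inverses from commutative Laurent series in Y over to skew series
  in X.\<close>

definition fls_at_Y :: "nat \<Rightarrow> 'k::zero fls \<Rightarrow> int \<Rightarrow> 'k" where
  "fls_at_Y r g n = (if int r dvd n then fls_nth g (n div int r) else 0)"

lemma fls_at_Y_series:
  assumes "r > 0"
  shows "fls_at_Y r g \<in> carrier (skew_series \<theta>)"
proof -
  have "fls_at_Y r g n = 0" if "n < int r * fls_subdegree g" for n
    using that assms by (auto simp: fls_at_Y_def)
  then show ?thesis by auto
qed

text \<open>Negating exponents is the passage from X to its inverse, so the second part is the
  expansion of P at infinity.\<close>

lemma poly_at_Y_eq_fls_at_Y:
  assumes "r > 0"
  shows "poly_at_Y r P = fls_at_Y r (eval_fls (local_param (Some 0)) P)"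
    and "(\<lambda>n. poly_at_Y r P (- n)) = fls_at_Y r (eval_fls (local_param None) P)"
proof -
  have "n div int r \<le> 0 \<longleftrightarrow> n \<le> 0" if "int r dvd n" for n
    using that assms by (auto simp: mult_le_0_iff)
  with assms show "poly_at_Y r P = fls_at_Y r (eval_fls (local_param (Some 0)) P)"
    and "(\<lambda>n. poly_at_Y r P (- n)) = fls_at_Y r (eval_fls (local_param None) P)"
    by (auto simp: fun_eq_iff poly_at_Y_def fls_at_Y_def eval_fls_X_nth eval_fls_X_inv_nth
      pos_imp_zdiv_nonneg_iff dvd_neg_div)
qed


section \<open>Central elements for an automorphism of finite order\<close>

locale finite_order_automorphism = field_automorphism +
  fixes r :: nat
  assumes r: "r > 0" and order: "\<theta> ^^ r = id"
begin

lemma inv_finite_order: "finite_order_automorphism (inv_into UNIV \<theta>) r"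
proof -
  interpret inv: field_automorphism "inv_into UNIV \<theta>" by (rule inv_automorphism)
  show ?thesis
    using r order bij inv_fn[of \<theta> r] by unfold_locales auto
qed

lemma aut_pow_multiple [simp]: "aut_pow \<theta> (k * int r) a = a"
  using aut_pow_dvd[OF order, of "k * int r"] by simp

text \<open>The left factor has only exponents k r, and \<theta>^(k r) = id, so the product is an
  untwisted convolution.\<close>

lemma skew_mult_fls_at_Y:
  assumes g: "fixed.fls_over g"
    and S: "finite S" "\<And>k. fls_nth g k \<noteq> 0 \<Longrightarrow> b (n - k * int r) \<noteq> 0 \<Longrightarrow> k \<in> S"
  shows "skew_mult \<theta> (fls_at_Y r g) b n = (\<Sum>k\<in>S. fls_nth g k * b (n - k * int r))"
proof -
  have "skew_mult \<theta> (fls_at_Y r g) b n =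
      (\<Sum>i\<in>(\<lambda>k. k * int r) ` S. fls_at_Y r g i * aut_pow \<theta> i (b (n - i)))"
    using S r by (intro skew_mult_eq_sum)
      (auto simp: fls_at_Y_def mult.commute elim!: dvdE split: if_splits)
  also have "\<dots> = (\<Sum>k\<in>S. fls_nth g k * b (n - k * int r))"
    using r by (subst sum.reindex) (auto simp: fls_at_Y_def inj_on_def)
  finally show ?thesis .
qed

lemma fls_at_Y_mult:
  assumes "fixed.fls_over g"
  shows "skew_mult \<theta> (fls_at_Y r g) (fls_at_Y r h) = fls_at_Y r (g * h)"
proof
  fix n
  show "skew_mult \<theta> (fls_at_Y r g) (fls_at_Y r h) n = fls_at_Y r (g * h) n"
  proof (cases "int r dvd n")
    case False
    have "\<not> int r dvd n - k * int r" for k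
    proof
      assume "int r dvd n - k * int r"
      then have "int r dvd (n - k * int r) + k * int r" by (intro dvd_add) auto
      with False show False by simp
    qed
    then have "fls_at_Y r h (n - k * int r) = 0" for k by (simp add: fls_at_Y_def)
    then show ?thesis
      using False by (subst skew_mult_fls_at_Y[OF assms, of "{}"]) (auto simp: fls_at_Y_def)
  next
    case True
    then have n: "n = n div int r * int r" by simp
    then obtain m where n: "n = m * int r" by blast
    have h: "fls_at_Y r h (n - k * int r) = fls_nth h (m - k)" for k
      unfolding n left_diff_distrib[symmetric] using r by (simp add: fls_at_Y_def)
    have "skew_mult \<theta> (fls_at_Y r g) (fls_at_Y r h) n =
        (\<Sum>k=fls_subdegree g..m - fls_subdegree h. fls_nth g k * fls_nth h (m - k))"
    proof (subst skew_mult_fls_at_Y[OF assms])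
      fix k assume "fls_nth g k \<noteq> 0" "fls_at_Y r h (n - k * int r) \<noteq> 0"
      then have "fls_subdegree g \<le> k" "fls_subdegree h \<le> m - k"
        by (auto simp: h fls_subdegree_leI)
      then show "k \<in> {fls_subdegree g..m - fls_subdegree h}" by auto
    qed (simp_all add: h)
    then show ?thesis using r by (simp add: n fls_at_Y_def fls_times_nth(2))
  qed
qed

lemma fls_at_Y_1: "fls_at_Y r 1 = skew_monom 1 0"
  using r by (auto simp: fun_eq_iff fls_at_Y_def skew_monom_def)

lemma fls_at_Y_unit:
  assumes "fixed.fls_over g" "g \<noteq> 0"
  shows "fls_at_Y r g \<in> Units (skew_series \<theta>)"
    and "inv\<^bsub>skew_series \<theta>\<^esub> (fls_at_Y r g) = fls_at_Y r (Fields.inverse g)"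
proof -
  interpret ring "skew_series \<theta>" by (rule ring_skew_series)
  have *: "fls_at_Y r g \<otimes>\<^bsub>skew_series \<theta>\<^esub> fls_at_Y r (Fields.inverse g) = \<one>\<^bsub>skew_series \<theta>\<^esub>"
    "fls_at_Y r (Fields.inverse g) \<otimes>\<^bsub>skew_series \<theta>\<^esub> fls_at_Y r g = \<one>\<^bsub>skew_series \<theta>\<^esub>"
    using assms by (simp_all add: fls_at_Y_mult fixed.fls_over_inverse fls_at_Y_1)
  note carr = fls_at_Y_series[OF r, of _ \<theta>]
  show "fls_at_Y r g \<in> Units (skew_series \<theta>)"
    using * carr unfolding Units_def by blast
  show "inv\<^bsub>skew_series \<theta>\<^esub> (fls_at_Y r g) = fls_at_Y r (Fields.inverse g)"
    using * carr by (intro inv_char)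
qed

lemma poly_at_Y_in_centre:
  assumes "P \<in> polys_over (fixed_field \<theta>)"
  shows "poly_at_Y r P \<in> skew_centre \<theta> r"
proof -
  have "{n. poly_at_Y r P n \<noteq> 0} \<subseteq> (\<lambda>i. int i * int r) ` {..degree P}"
  proof
    fix n assume "n \<in> {n. poly_at_Y r P n \<noteq> 0}"
    then have n: "n \<ge> 0" "int r dvd n" "poly.coeff P (nat (n div int r)) \<noteq> 0"
      by (auto simp: poly_at_Y_def split: if_splits)
    then have "n = int (nat (n div int r)) * int r"
      using r by (auto simp: pos_imp_zdiv_nonneg_iff)
    moreover have "nat (n div int r) \<le> degree P" using n(3) by (rule le_degree)
    ultimately show "n \<in> (\<lambda>i. int i * int r) ` {..degree P}" by blast
  qed
  then have "finite {n. poly_at_Y r P n \<noteq> 0}" by (rule finite_subset) simp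
  moreover have "int r dvd n \<and> poly_at_Y r P n \<in> fixed_field \<theta>" if "poly_at_Y r P n \<noteq> 0" for n
    using that assms by (auto simp: poly_at_Y_def polys_over_def split: if_splits)
  ultimately show ?thesis by (simp add: skew_centre_def)
qed

lemma poly_at_Y_eq_0_iff: "poly_at_Y r P = (\<lambda>_. 0) \<longleftrightarrow> P = 0"
proof
  assume *: "poly_at_Y r P = (\<lambda>_. 0)"
  have "poly.coeff P i = poly_at_Y r P (int i * int r)" for i
    using r by (simp add: poly_at_Y_def)
  then show "P = 0" using * by (intro poly_eqI) simp
qed (auto simp: poly_at_Y_def)

text \<open>With D on the left, its exponents are multiples of r and give no twist; with D on the
  right, its coefficients are fixed by every power of \<theta>.\<close>

lemma centre_central:
  assumes "D \<in> skew_centre \<theta> r"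
  shows "skew_mult \<theta> D b = skew_mult \<theta> b D"
proof
  fix n
  have D: "int r dvd i" "D i \<in> fixed_field \<theta>" if "D i \<noteq> 0" for i
    using assms that by (auto simp: skew_centre_def)
  have "(\<Sum>i | D i \<noteq> 0 \<and> b (n - i) \<noteq> 0. D i * aut_pow \<theta> i (b (n - i))) =
      (\<Sum>i | b i \<noteq> 0 \<and> D (n - i) \<noteq> 0. b i * aut_pow \<theta> i (D (n - i)))"
    by (rule sum.reindex_bij_witness[of _ "\<lambda>i. n - i" "\<lambda>i. n - i"])
      (auto simp: D aut_pow_fixed aut_pow_dvd[OF order])
  then show "skew_mult \<theta> D b n = skew_mult \<theta> b D n" by (simp add: skew_mult_def)
qed

text \<open>Multiplication by a power of Y clears the negative exponents. It reduces the
  invertibility of the image of a central element to that of the image of a polynomial.\<close>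

lemma centre_shift_poly:
  assumes "D \<in> skew_centre \<theta> r" "D \<noteq> (\<lambda>_. 0)"
  obtains m P where "P \<in> polys_over (fixed_field \<theta>)" "P \<noteq> 0"
    "skew_mult \<theta> (skew_monom 1 (m * int r)) D = poly_at_Y r P"
proof -
  have D: "int r dvd i" if "D i \<noteq> 0" for i
    using assms that by (auto simp: skew_centre_def)
  have fin: "finite {i. D i \<noteq> 0}" using assms by (simp add: skew_centre_def)
  have DF: "D i \<in> fixed_field \<theta>" for i
    using assms fixed.zero by (cases "D i = 0") (auto simp: skew_centre_def)
  obtain m :: nat where m: "\<bar>i\<bar> \<le> int m" if "D i \<noteq> 0" for i
  proof -
    have "\<exists>m::nat. \<forall>i\<in>{i. D i \<noteq> 0}. nat \<bar>i\<bar> \<le> m"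
      using fin by (metis finite_imageI finite_nat_set_iff_bounded_le imageI)
    then show ?thesis using that by (metis (mono_tags) mem_Collect_eq nat_le_iff)
  qed
  define s where "s = int m * int r"
  have s: "s \<ge> int m" using r unfolding s_def by (simp add: mult_le_cancel_left1)
  \<comment> \<open>The bound 2 m is large enough: j > 2 m gives j r - s \<ge> (m + 1) r > m,
    outside the support of D.\<close>
  define P where "P = (\<Sum>j\<le>2*m. Polynomial.monom (D (int j * int r - s)) j)"
  have cP: "poly.coeff P j = D (int j * int r - s)" for j
  proof (cases "j \<le> 2 * m")
    case True
    then show ?thesis unfolding P_def by (simp add: coeff_sum)
  next
    case False
    then have "int (2 * m + 1) * int r \<le> int j * int r" by (intro mult_right_mono) auto
    then have "int j * int r - s > int m" using r s by (simp add: s_def algebra_simps)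
    then have "D (int j * int r - s) = 0" using m[of "int j * int r - s"] by auto
    then show ?thesis using False unfolding P_def by (simp add: coeff_sum)
  qed
  have "skew_mult \<theta> (skew_monom 1 s) D n = poly_at_Y r P n" for n
  proof (cases "n \<ge> 0 \<and> int r dvd n")
    case True
    then show ?thesis using r
      by (auto simp: poly_at_Y_def cP skew_mult_monom_left s_def pos_imp_zdiv_nonneg_iff)
  next
    case False
    have "D (n - s) = 0"
    proof (rule ccontr)
      assume h: "D (n - s) \<noteq> 0"
      then have "n \<ge> 0" using m[OF h] s by linarith
      moreover have "int r dvd n" using D[OF h] unfolding s_def by (simp add: dvd_diff_left_iff)
      ultimately show False using False by blast
    qed
    then show ?thesis using False by (auto simp: poly_at_Y_def skew_mult_monom_left)
  qed
  then have eq: "skew_mult \<theta> (skew_monom 1 (int m * int r)) D = poly_at_Y r P"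
    by (auto simp: s_def)
  moreover have "P \<noteq> 0"
  proof
    assume "P = 0"
    then have "D ((n + s) - s) = 0" for n
      using fun_cong[OF eq, of "n + s"] by (simp add: skew_mult_monom_left s_def poly_at_Y_def)
    then show False using assms(2) by auto
  qed
  moreover have "P \<in> polys_over (fixed_field \<theta>)" by (simp add: polys_over_def cP DF)
  ultimately show ?thesis using that by blast
qed

end

text \<open>A factor of a unit in a noncommutative monoid has in general an inverse on one side
  only; commutation of the factors supplies the other side.\<close>

lemma (in monoid) unit_of_commuting_product:
  assumes "x \<in> carrier G" "y \<in> carrier G" "x \<otimes> y = y \<otimes> x" "x \<otimes> y \<in> Units G"
  shows "y \<in> Units G"
proof -
  let ?u = "inv (x \<otimes> y)"
  have u: "?u \<in> carrier G" using assms by simp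
  have l: "(?u \<otimes> x) \<otimes> y = \<one>" using assms u by (simp add: m_assoc)
  have "y \<otimes> (x \<otimes> ?u) = (x \<otimes> y) \<otimes> ?u"
    using m_assoc[OF assms(2,1) u] assms(3) by simp
  then have r: "y \<otimes> (x \<otimes> ?u) = \<one>" using Units_r_inv[OF assms(4)] by simp
  have "?u \<otimes> x = x \<otimes> ?u" using inv_unique[OF l r] assms u by simp
  then show ?thesis using l r assms u unfolding Units_def by auto
qed

lemma (in monoid) inv_commute:
  assumes "x \<in> Units G" "y \<in> carrier G" "x \<otimes> y = y \<otimes> x"
  shows "inv x \<otimes> y = y \<otimes> inv x"
proof -
  have x: "x \<in> carrier G" "inv x \<in> carrier G" using assms(1) by auto
  have "inv x \<otimes> y = inv x \<otimes> (y \<otimes> (x \<otimes> inv x))" using assms x by simp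
  also have "\<dots> = inv x \<otimes> ((x \<otimes> y) \<otimes> inv x)"
    using m_assoc[of y x "inv x"] assms x by simp
  also have "\<dots> = (inv x \<otimes> x) \<otimes> (y \<otimes> inv x)"
    using assms(2) x by (simp only: m_assoc m_closed)
  finally show ?thesis using assms x by simp
qed

section \<open>Evaluation of the maps induced on fractions\<close>

context finite_order_automorphism
begin

lemma skew_centre_closed: "D \<in> skew_centre \<theta> r \<Longrightarrow> D \<in> carrier (skew_poly \<theta>)"
  by (simp add: skew_centre_def)

text \<open>Up to a power of Y the element D is a polynomial in Y over F, so its image is a factor
  of a unit; centrality of D makes the two factors commute.\<close>

lemma centre_image_unit:
  assumes "monoid R" and carr: "\<And>a. a \<in> carrier (skew_poly \<theta>) \<Longrightarrow> h a \<in> carrier R"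
    and hom: "\<And>a b. a \<in> carrier (skew_poly \<theta>) \<Longrightarrow> b \<in> carrier (skew_poly \<theta>) \<Longrightarrow>
      h (skew_mult \<theta> a b) = h a \<otimes>\<^bsub>R\<^esub> h b"
    and unit: "\<And>P. P \<in> polys_over (fixed_field \<theta>) \<Longrightarrow> P \<noteq> 0 \<Longrightarrow> h (poly_at_Y r P) \<in> Units R"
    and D: "D \<in> skew_centre \<theta> r" "D \<noteq> (\<lambda>_. 0)"
  shows "h D \<in> Units R"
proof -
  interpret monoid R by fact
  obtain m P where P: "P \<in> polys_over (fixed_field \<theta>)" "P \<noteq> 0"
      "skew_mult \<theta> (skew_monom 1 (m * int r)) D = poly_at_Y r P"
    using centre_shift_poly[OF D] .
  let ?Y = "skew_monom 1 (m * int r)"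
  note cl = skew_monom_in_skew_poly[of 1 "m * int r" \<theta>] skew_centre_closed[OF D(1)]
  have "h ?Y \<otimes>\<^bsub>R\<^esub> h D = h D \<otimes>\<^bsub>R\<^esub> h ?Y"
    using centre_central[OF D(1), of ?Y] hom[OF cl] hom[OF cl(2,1)] by metis
  moreover have "h ?Y \<otimes>\<^bsub>R\<^esub> h D \<in> Units R"
    using unit[OF P(1,2)] P(3) hom[OF cl] by metis
  ultimately show ?thesis
    using unit_of_commuting_product carr[OF cl(1)] carr[OF cl(2)] by metis
qed

text \<open>\<open>frac_map\<close> is defined through \<open>the_elem\<close>, so all
  representatives must give the same value. The relation between two of them is transported by h,
  and centrality lets the inverse of one denominator pass the other. Afterwards the residues can be
  computed from the representative with the split denominator P.\<close>

lemma frac_map_eq: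
  assumes "monoid R" and carr: "\<And>a. a \<in> carrier (skew_poly \<theta>) \<Longrightarrow> h a \<in> carrier R"
    and hom: "\<And>a b. a \<in> carrier (skew_poly \<theta>) \<Longrightarrow> b \<in> carrier (skew_poly \<theta>) \<Longrightarrow>
      h (skew_mult \<theta> a b) = h a \<otimes>\<^bsub>R\<^esub> h b"
    and unit: "\<And>P. P \<in> polys_over (fixed_field \<theta>) \<Longrightarrow> P \<noteq> 0 \<Longrightarrow> h (poly_at_Y r P) \<in> Units R"
    and f: "f \<in> skew_frac \<theta> r" "(D, a) \<in> f"
  shows "frac_map R h f = inv\<^bsub>R\<^esub> (h D) \<otimes>\<^bsub>R\<^esub> h a"
proof -
  interpret monoid R by fact
  obtain E b where fE: "f = frac_rel \<theta> r `` {(E, b)}"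
    using f(1) unfolding skew_frac_def quotient_def by auto
  have *: "inv\<^bsub>R\<^esub> (h D) \<otimes>\<^bsub>R\<^esub> h a = inv\<^bsub>R\<^esub> (h E) \<otimes>\<^bsub>R\<^esub> h b" if "(D, a) \<in> f" for D a
  proof -
    have rel: "((E, b), (D, a)) \<in> frac_rel \<theta> r" using that fE by auto
    then have DE: "D \<in> skew_centre \<theta> r" "D \<noteq> (\<lambda>_. 0)" "E \<in> skew_centre \<theta> r" "E \<noteq> (\<lambda>_. 0)"
      and ab: "a \<in> carrier (skew_poly \<theta>)" "b \<in> carrier (skew_poly \<theta>)"
      and eq: "skew_mult \<theta> D b = skew_mult \<theta> E a"
      by (auto simp: frac_rel_def frac_pairs_def)
    note cl = DE(1,3)[THEN skew_centre_closed]
    have U: "h D \<in> Units R" "h E \<in> Units R"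
      using centre_image_unit[OF \<open>monoid R\<close> carr hom unit] DE by blast+
    note [simp] = carr[OF ab(1)] carr[OF ab(2)] U Units_closed[OF U(1)] Units_closed[OF U(2)]
    have "h D \<otimes>\<^bsub>R\<^esub> h b = h E \<otimes>\<^bsub>R\<^esub> h a" using eq hom cl ab by metis
    then have "inv\<^bsub>R\<^esub> (h E) \<otimes>\<^bsub>R\<^esub> (h D \<otimes>\<^bsub>R\<^esub> h b) = h a"
      by (simp add: m_assoc[symmetric])
    moreover have "inv\<^bsub>R\<^esub> (h E) \<otimes>\<^bsub>R\<^esub> h D = h D \<otimes>\<^bsub>R\<^esub> inv\<^bsub>R\<^esub> (h E)"
      using centre_central[OF DE(1), of E] hom[OF cl] hom[OF cl(2,1)] by (intro inv_commute) auto
    ultimately have "h a = h D \<otimes>\<^bsub>R\<^esub> (inv\<^bsub>R\<^esub> (h E) \<otimes>\<^bsub>R\<^esub> h b)"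
      by (simp add: m_assoc[symmetric])
    then show ?thesis by (simp add: m_assoc[symmetric])
  qed
  then have "(\<lambda>(D, a). inv\<^bsub>R\<^esub> (h D) \<otimes>\<^bsub>R\<^esub> h a) ` f = {inv\<^bsub>R\<^esub> (h D) \<otimes>\<^bsub>R\<^esub> h a}"
    using f(2) by force
  then show ?thesis by (simp add: frac_map_def)
qed

end


section \<open>The tensor product and the residues at 0 and infinity\<close>

locale tensor =
  fixes F :: "'k::field set" and e :: "'k \<Rightarrow> 's::field"
begin

abbreviation free_group :: "('k \<times> 's \<Rightarrow>\<^sub>0 int) monoid" where
  "free_group \<equiv> free_Abelian_group UNIV"

lemma tensor_subgroup_normal: "tensor_subgroup F e \<lhd> free_group"
proof -
  interpret comm_group free_group by (rule abelian_free_Abelian_group)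
  show ?thesis
    unfolding tensor_subgroup_def by (intro subgroup_imp_normal generate_is_subgroup) auto
qed

sublocale normal "tensor_subgroup F e" free_group
  rewrites "\<one>\<^bsub>free_group\<^esub> = 0" and "x \<otimes>\<^bsub>free_group\<^esub> y = x + y"
  using tensor_subgroup_normal by simp_all

sublocale T: comm_group "tensor_product F e"
  unfolding tensor_product_def
  using comm_group.abelian_FactGroup[OF abelian_free_Abelian_group tensor_subgroup_normal[THEN normal_imp_subgroup]] .

lemma coset_closed: "tensor_subgroup F e #>\<^bsub>free_group\<^esub> x \<in> carrier (tensor_product F e)"
  using r_coset_hom_Mod by (auto simp: tensor_product_def hom_def)

lemma coset_add:
  "tensor_subgroup F e #>\<^bsub>free_group\<^esub> (x + y) =
    (tensor_subgroup F e #>\<^bsub>free_group\<^esub> x) \<otimes>\<^bsub>tensor_product F e\<^esub> (tensor_subgroup F e #>\<^bsub>free_group\<^esub> y)"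
  using r_coset_hom_Mod by (simp add: tensor_product_def hom_def)

lemma coset_relator:
  assumes "x - y \<in> tensor_relators F e"
  shows "tensor_subgroup F e #>\<^bsub>free_group\<^esub> x = tensor_subgroup F e #>\<^bsub>free_group\<^esub> y"
proof -
  have "x - y \<in> tensor_subgroup F e"
    unfolding tensor_subgroup_def using assms by (rule generate.incl)
  then have "tensor_subgroup F e #>\<^bsub>free_group\<^esub> (x - y) = \<one>\<^bsub>tensor_product F e\<^esub>"
    using rcos_const[OF group_free_Abelian_group] by (simp add: tensor_product_def FactGroup_def)
  then show ?thesis
    using coset_add[of "x - y" y] coset_closed by simp
qed

lemma pure_closed [simp]: "pure_tensor F e a s \<in> carrier (tensor_product F e)"
  by (simp add: pure_tensor_def coset_closed)

lemma pure_add_left: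
  "pure_tensor F e (a + b) s = pure_tensor F e a s \<otimes>\<^bsub>tensor_product F e\<^esub> pure_tensor F e b s"
  unfolding pure_tensor_def coset_add[symmetric]
  \<comment> \<open>\<open>diff_diff_add\<close> brings the difference of the two sides to the shape
    in which the relators are written.\<close>
  by (intro coset_relator, unfold tensor_relators_def diff_diff_add[symmetric]) blast

lemma pure_add_right:
  "pure_tensor F e a (s + t) = pure_tensor F e a s \<otimes>\<^bsub>tensor_product F e\<^esub> pure_tensor F e a t"
  unfolding pure_tensor_def coset_add[symmetric]
  by (intro coset_relator, unfold tensor_relators_def diff_diff_add[symmetric]) blast

lemma pure_balanced: "c \<in> F \<Longrightarrow> pure_tensor F e (a * c) s = pure_tensor F e a (e c * s)"
  unfolding pure_tensor_def by (intro coset_relator, unfold tensor_relators_def) blast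

lemma pure_0_left [simp]: "pure_tensor F e 0 s = \<one>\<^bsub>tensor_product F e\<^esub>"
  using pure_add_left[of 0 0 s] by (simp add: T.r_cancel_one')

lemma pure_0_right [simp]: "pure_tensor F e a 0 = \<one>\<^bsub>tensor_product F e\<^esub>"
  using pure_add_right[of a 0 0] by (simp add: T.r_cancel_one')

text \<open>Elements of F cross the tensor sign. This brings the residues at 0 and infinity, which
  are elements of K, to the form that the other points have.\<close>

lemma pure_sum:
  "finite S \<Longrightarrow> (\<And>i. i \<in> S \<Longrightarrow> x i \<in> F) \<Longrightarrow>
    pure_tensor F e (\<Sum>i\<in>S. c i * x i) 1 =
    finprod (tensor_product F e) (\<lambda>i. pure_tensor F e (c i) (e (x i))) S"
  by (induction S rule: finite_induct) (auto simp: pure_add_left pure_balanced)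

lemma pure_sum_right:
  "finite S \<Longrightarrow> pure_tensor F e a (\<Sum>i\<in>S. x i) =
    finprod (tensor_product F e) (\<lambda>i. pure_tensor F e a (x i)) S"
  by (induction S rule: finite_induct) (auto simp: pure_add_right)

text \<open>The common form of all partial residues: the sum of the c_i \<otimes> \<phi>_i. With
  \<phi>_i = z^i it is the map behind \<open>iota\<close>; with \<phi>_i the residue of Y^i / P at a
  point it is the partial residue at that point.\<close>

definition tensor_sum :: "(int \<Rightarrow> 's) \<Rightarrow> (int \<Rightarrow> 'k) \<Rightarrow> ('k \<times> 's \<Rightarrow>\<^sub>0 int) set" where
  "tensor_sum \<phi> c = finprod (tensor_product F e) (\<lambda>i. pure_tensor F e (c i) (\<phi> i)) {i. c i \<noteq> 0}"

lemma tensor_sum_closed [simp]: "tensor_sum \<phi> c \<in> carrier (tensor_product F e)"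
  by (simp add: tensor_sum_def)

lemma tensor_sum_eq:
  assumes "finite S" "{i. c i \<noteq> 0} \<subseteq> S"
  shows "tensor_sum \<phi> c = finprod (tensor_product F e) (\<lambda>i. pure_tensor F e (c i) (\<phi> i)) S"
  unfolding tensor_sum_def
  using assms by (intro T.finprod_mono_neutral_cong_left) auto

lemma tensor_sum_0 [simp]: "tensor_sum \<phi> (\<lambda>_. 0) = \<one>\<^bsub>tensor_product F e\<^esub>"
  by (simp add: tensor_sum_def)

lemma tensor_sum_add:
  assumes "finite {i. c i \<noteq> 0}" "finite {i. d i \<noteq> 0}"
  shows "tensor_sum \<phi> (\<lambda>i. c i + d i) = tensor_sum \<phi> c \<otimes>\<^bsub>tensor_product F e\<^esub> tensor_sum \<phi> d"
proof -
  have "finite ({i. c i \<noteq> 0} \<union> {i. d i \<noteq> 0})" using assms by simp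
  note * = tensor_sum_eq[OF this]
  show ?thesis by (subst (1 2 3) *) (auto simp: pure_add_left T.finprod_multf)
qed

lemma tensor_sum_single: "tensor_sum \<phi> (\<lambda>i. if i = m then a else 0) = pure_tensor F e a (\<phi> m)"
  by (subst tensor_sum_eq[of "{m}"]) auto

lemma tensor_sum_zero_weight [simp]: "tensor_sum (\<lambda>_. 0) c = \<one>\<^bsub>tensor_product F e\<^esub>"
  by (simp add: tensor_sum_def)

lemma tensor_sum_add_weight:
  assumes "finite {i. c i \<noteq> 0}"
  shows "tensor_sum (\<lambda>i. \<phi> i + \<psi> i) c = tensor_sum \<phi> c \<otimes>\<^bsub>tensor_product F e\<^esub> tensor_sum \<psi> c"
  using assms by (simp add: tensor_sum_def pure_add_right T.finprod_multf)

text \<open>Additivity in the weights moves the sum over the points into F^s.\<close>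

lemma finprod_tensor_sum:
  assumes "finite {i. c i \<noteq> 0}" "finite S"
  shows "finprod (tensor_product F e) (\<lambda>p. tensor_sum (\<phi> p) c) S = tensor_sum (\<lambda>i. \<Sum>p\<in>S. \<phi> p i) c"
  using assms(2)
  by (induction S rule: finite_induct) (simp_all add: tensor_sum_add_weight assms(1))

end

locale skew_tensor = finite_order_automorphism \<theta> r + e: field_embedding e +
    tensor: tensor "fixed_field \<theta>" e
  for \<theta> :: "'k::field \<Rightarrow> 'k" and r :: nat and e :: "'k \<Rightarrow> 's::field"
begin

text \<open>The inverse of g(Y) is supported on multiples of r, so a coefficient at such an exponent
  sees only those coefficients of a that the 0-th section retains.\<close>

lemma series_quotient_nth:
  assumes "fixed.fls_over g" "g \<noteq> 0" "finite S" "{i. a (i * int r) \<noteq> 0} \<subseteq> S"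
  shows "(inv\<^bsub>skew_series \<theta>\<^esub> (fls_at_Y r g) \<otimes>\<^bsub>skew_series \<theta>\<^esub> a) (m * int r) =
    (\<Sum>i\<in>S. fls_nth (inverse g) (m - i) * a (i * int r))"
proof -
  have "(inv\<^bsub>skew_series \<theta>\<^esub> (fls_at_Y r g) \<otimes>\<^bsub>skew_series \<theta>\<^esub> a) (m * int r) =
    (\<Sum>k\<in>(\<lambda>i. m - i) ` S. fls_nth (inverse g) k * a (m * int r - k * int r))"
    unfolding fls_at_Y_unit[OF assms(1,2)] skew_series_simps
  proof (rule skew_mult_fls_at_Y)
    fix k assume "a (m * int r - k * int r) \<noteq> 0"
    then have "m - k \<in> S" using assms(4) by (auto simp: left_diff_distrib)
    then show "k \<in> (\<lambda>i. m - i) ` S" by (intro image_eqI[of _ _ "m - k"]) auto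
  qed (use assms in \<open>auto simp: fixed.fls_over_inverse\<close>)
  then show ?thesis by (simp add: sum.reindex inj_on_def algebra_simps)
qed

end

lemma fls_X_inv_power_int: "fls_X_inv powi i = (fls_shift i 1 :: 'a::field fls)"
  by (cases "i \<ge> 0")
    (auto simp: power_int_def fls_inverse_X_inv fls_X_power_conv_shift_1 fls_X_inv_power_conv_shift_1)

text \<open>The classical residue at p of the form Y^i dY / Q(Y).\<close>

definition residue_weight :: "'s::field poly \<Rightarrow> 's option \<Rightarrow> int \<Rightarrow> 's" where
  "residue_weight Q p i = residue_at p (local_param p powi i / eval_fls (local_param p) Q)"

lemma residue_weight_zero:
  "residue_weight Q (Some 0) i = fls_nth (inverse (eval_fls (local_param (Some 0)) Q)) (- 1 - i)"
  by (simp add: residue_weight_def residue_at_def divide_inverse local_param_def fls_X_intpow_times_conv_shift)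

text \<open>Here Y^i = W^(-i), so the coefficient of W in the quotient is the coefficient of W^(1 +
  i) in 1/Q.\<close>

lemma residue_weight_infinity:
  "residue_weight Q None i = - fls_nth (inverse (eval_fls (local_param None) Q)) (1 + i)"
  by (simp add: residue_weight_def residue_at_def divide_inverse local_param_def
      fls_X_inv_power_int fls_shifted_times_simps add.commute)

lemma sect_0: "sect r 0 a i = a (i * int r)"
  by (simp add: sect_def)

lemma finite_sect:
  assumes "finite {i. a i \<noteq> 0}" "r > 0"
  shows "finite {i. sect r 0 a i \<noteq> 0}"
proof -
  have "(\<lambda>i. i * int r) ` {i. sect r 0 a i \<noteq> 0} \<subseteq> {i. a i \<noteq> 0}" by (auto simp: sect_0)
  then have "finite ((\<lambda>i. i * int r) ` {i. sect r 0 a i \<noteq> 0})" using assms(1) finite_subset by blast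
  then show ?thesis using assms(2) by (auto simp: inj_on_def dest!: finite_imageD)
qed

context finite_order_automorphism
begin

lemma eval_fls_over:
  "P \<in> polys_over (fixed_field \<theta>) \<Longrightarrow> fixed.fls_over (eval_fls (local_param (Some 0)) P)"
  "P \<in> polys_over (fixed_field \<theta>) \<Longrightarrow> fixed.fls_over (eval_fls (local_param None) P)"
  using fixed.fls_over_X fixed.fls_over_X_inv
  by (intro fixed.fls_over_eval_fls; simp add: local_param_def)+

lemma eval_fls_nonzero:
  assumes "P \<noteq> 0"
  shows "eval_fls (local_param (Some 0)) P \<noteq> 0" "eval_fls (local_param None) P \<noteq> 0"
proof -
  obtain n where "poly.coeff P n \<noteq> 0" using assms by (auto simp: poly_eq_iff)
  then show "eval_fls (local_param (Some 0)) P \<noteq> 0" "eval_fls (local_param None) P \<noteq> 0"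
    using eval_fls_X_nth[of P "int n"] eval_fls_X_inv_nth[of P "- int n"] by auto
qed

end

section \<open>Partial residues at 0 and at infinity\<close>

context skew_tensor
begin

interpretation inv: finite_order_automorphism "inv_into UNIV \<theta>" r
  by (rule inv_finite_order)

lemma TS_zero_eq:
  assumes f: "f \<in> skew_frac \<theta> r" "(poly_at_Y r P, a) \<in> f"
    and P: "P \<in> polys_over (fixed_field \<theta>)" "P \<noteq> 0"
  shows "TS_zero \<theta> f =
    inv\<^bsub>skew_series \<theta>\<^esub> (fls_at_Y r (eval_fls (local_param (Some 0)) P)) \<otimes>\<^bsub>skew_series \<theta>\<^esub> a"
  unfolding TS_zero_def poly_at_Y_eq_fls_at_Y(1)[OF r, symmetric]
proof (rule frac_map_eq[OF _ _ _ _ f])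
  show "monoid (skew_series \<theta>)" using ring_skew_series by (rule ring.is_monoid)
  show "poly_at_Y r P \<in> Units (skew_series \<theta>)" if "P \<in> polys_over (fixed_field \<theta>)" "P \<noteq> 0" for P
    unfolding poly_at_Y_eq_fls_at_Y(1)[OF r] using that by (intro fls_at_Y_unit eval_fls_over eval_fls_nonzero)
qed (use skew_poly_subset_series in auto)

text \<open>X^i is the power of X^(-1) with exponent -i, and the power -i of the inverse of \<theta>
  is \<theta>^i; hence both products twist coefficients in the same way.\<close>

lemma skew_mult_reverse:
  "skew_mult (inv_into UNIV \<theta>) (\<lambda>n. a (- n)) (\<lambda>n. b (- n)) = (\<lambda>n. skew_mult \<theta> a b (- n))"
proof
  fix n
  show "skew_mult (inv_into UNIV \<theta>) (\<lambda>n. a (- n)) (\<lambda>n. b (- n)) n = skew_mult \<theta> a b (- n)"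
    unfolding skew_mult_def aut_pow_inv
    by (rule sum.reindex_bij_witness[of _ uminus uminus])
      (auto simp: minus_diff_commute)
qed

lemma TS_infinity_eq:
  assumes f: "f \<in> skew_frac \<theta> r" "(poly_at_Y r P, a) \<in> f"
    and P: "P \<in> polys_over (fixed_field \<theta>)" "P \<noteq> 0"
  shows "TS_infinity \<theta> f =
    inv\<^bsub>skew_series (inv_into UNIV \<theta>)\<^esub> (fls_at_Y r (eval_fls (local_param None) P))
      \<otimes>\<^bsub>skew_series (inv_into UNIV \<theta>)\<^esub> (\<lambda>n. a (- n))"
  unfolding TS_infinity_def poly_at_Y_eq_fls_at_Y(2)[OF r, symmetric]
proof (rule frac_map_eq[OF _ _ _ _ f])
  show "monoid (skew_series (inv_into UNIV \<theta>))" using inv.ring_skew_series by (rule ring.is_monoid)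
  show "(\<lambda>n. poly_at_Y r P (- n)) \<in> Units (skew_series (inv_into UNIV \<theta>))"
    if "P \<in> polys_over (fixed_field \<theta>)" "P \<noteq> 0" for P
    unfolding poly_at_Y_eq_fls_at_Y(2)[OF r] using that
    by (intro inv.fls_at_Y_unit inv.eval_fls_over inv.eval_fls_nonzero) (simp_all add: fixed_field_inv)
  show "(\<lambda>n. a (- n)) \<in> carrier (skew_series (inv_into UNIV \<theta>))"
    if "a \<in> carrier (skew_poly \<theta>)" for a
  proof -
    have "{n. a (- n) \<noteq> 0} = uminus ` {n. a n \<noteq> 0}"
      by (auto simp: image_iff intro!: exI[of _ "- _"])
    then have "(\<lambda>n. a (- n)) \<in> carrier (skew_poly (inv_into UNIV \<theta>))" using that by simp
    then show ?thesis using skew_poly_subset_series by blast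
  qed
qed (simp add: skew_mult_reverse)

lemma finite_support_representative:
  assumes "f \<in> skew_frac \<theta> r" "(D, a) \<in> f"
  shows "finite {i. a i \<noteq> 0}" "D \<noteq> (\<lambda>_. 0)"
  using assms by (auto simp: skew_frac_def quotient_def frac_rel_def frac_pairs_def)

lemma psres_zero:
  assumes f: "f \<in> skew_frac \<theta> r" "(poly_at_Y r P, a) \<in> f"
    and P: "P \<in> polys_over (fixed_field \<theta>)" "P \<noteq> 0"
  shows "psres \<theta> r e \<tau> 0 (Some 0) f =
    tensor.tensor_sum (residue_weight (map_poly e P) (Some 0)) (sect r 0 a)"
proof -
  let ?S = "{i. sect r 0 a i \<noteq> 0}" and ?g = "eval_fls (local_param (Some 0)) P"
  have fin: "finite ?S" using finite_support_representative[OF f] r by (intro finite_sect)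
  \<comment> \<open>X^(-r) is Y^(-1), so \<open>series_quotient_nth\<close> is used at m =
    -1.\<close>
  have "TS_zero \<theta> f (- int r) = (\<Sum>i\<in>?S. fls_nth (inverse ?g) (- 1 - i) * a (i * int r))"
    using series_quotient_nth[OF eval_fls_over(1)[OF P(1)] eval_fls_nonzero(1)[OF P(2)] fin, of a "- 1"]
    by (simp add: TS_zero_eq[OF f P] sect_0)
  then have "TS_zero \<theta> f (- int r) = (\<Sum>i\<in>?S. sect r 0 a i * fls_nth (inverse ?g) (- 1 - i))"
    by (simp add: sect_0 mult.commute)
  moreover have "fls_nth (inverse ?g) n \<in> fixed_field \<theta>" for n
    using fixed.fls_over_inverse[OF eval_fls_over(1)[OF P(1)]] by (simp add: fixed.fls_over_def)
  \<comment> \<open>The parameter at 0 is preserved by \<open>e\<close>, so expanding over K and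
    then embedding agrees with expanding over F^s.\<close>
  moreover have "e (fls_nth (inverse ?g) (- 1 - i)) = residue_weight (map_poly e P) (Some 0) i" for i
    unfolding residue_weight_zero e.map_fls_local_param(1)[symmetric]
    by (simp flip: e.map_fls_eval_fls e.map_fls_inverse)
  ultimately show ?thesis
    using fin by (simp add: psres_def tensor.pure_sum tensor.tensor_sum_def)
qed

lemma psres_infinity:
  assumes f: "f \<in> skew_frac \<theta> r" "(poly_at_Y r P, a) \<in> f"
    and P: "P \<in> polys_over (fixed_field \<theta>)" "P \<noteq> 0"
  shows "psres \<theta> r e \<tau> 0 None f =
    tensor.tensor_sum (residue_weight (map_poly e P) None) (sect r 0 a)"
proof -
  let ?S = "{i. sect r 0 a i \<noteq> 0}" and ?g = "eval_fls (local_param None) P"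
  have fin: "finite ?S" using finite_support_representative[OF f] r by (intro finite_sect)
  have P': "P \<in> polys_over (fixed_field (inv_into UNIV \<theta>))" using P by (simp add: fixed_field_inv)
  interpret inv: skew_tensor "inv_into UNIV \<theta>" r e by unfold_locales
  \<comment> \<open>In the variable X^(-1) the exponents of a are negated, hence the reflected index
    set.\<close>
  have sub: "{i. a (- (i * int r)) \<noteq> 0} \<subseteq> uminus ` ?S"
  proof
    fix i assume "i \<in> {i. a (- (i * int r)) \<noteq> 0}"
    then have "- i \<in> ?S" by (simp add: sect_0)
    then show "i \<in> uminus ` ?S" by force
  qed
  have "TS_infinity \<theta> f (int r) = (\<Sum>i\<in>uminus ` ?S. fls_nth (inverse ?g) (1 - i) * a (- (i * int r)))"
    using inv.series_quotient_nth[OF inv.eval_fls_over(2)[OF P'] inv.eval_fls_nonzero(2)[OF P(2)],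
        of "uminus ` ?S" "\<lambda>n. a (- n)" 1, OF finite_imageI[OF fin] sub]
    by (simp add: TS_infinity_eq[OF f P])
  then have "- TS_infinity \<theta> f (int r) = (\<Sum>i\<in>?S. sect r 0 a i * - fls_nth (inverse ?g) (1 + i))"
    by (simp add: sum.reindex sect_0 mult.commute sum_negf)
  moreover have "fls_nth (inverse ?g) n \<in> fixed_field \<theta>" for n
    using fixed.fls_over_inverse[OF eval_fls_over(2)[OF P(1)]] by (simp add: fixed.fls_over_def)
  moreover have "e (- fls_nth (inverse ?g) (1 + i)) = residue_weight (map_poly e P) None i" for i
    unfolding residue_weight_infinity e.map_fls_local_param(2)[symmetric]
    by (simp add: e.minus flip: e.map_fls_eval_fls e.map_fls_inverse)
  ultimately show ?thesis
    using fin by (simp add: psres_def tensor.pure_sum tensor.tensor_sum_def fixed.minus del: mult_minus_right)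
qed

end


section \<open>Laurent series over a ring and the completion at a central element\<close>

lemma laurent_series_simps [simp]:
  "carrier (laurent_series R) = {f. (\<forall>i. f i \<in> carrier R) \<and> (\<exists>m. \<forall>i<m. f i = \<zero>\<^bsub>R\<^esub>)}"
  "one (laurent_series R) = (\<lambda>i. if i = 0 then \<one>\<^bsub>R\<^esub> else \<zero>\<^bsub>R\<^esub>)"
  "zero (laurent_series R) = (\<lambda>_. \<zero>\<^bsub>R\<^esub>)"
  "ring.add (laurent_series R) = (\<lambda>f g i. f i \<oplus>\<^bsub>R\<^esub> g i)"
  by (simp_all add: laurent_series_def)

definition const_series :: "('a, 'm) ring_scheme \<Rightarrow> 'a \<Rightarrow> int \<Rightarrow> 'a" where
  "const_series R b = (\<lambda>i. if i = 0 then b else \<zero>\<^bsub>R\<^esub>)"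

context ring
begin

lemma finsum_swap:
  assumes "finite A" "finite B" "\<And>i j. i \<in> A \<Longrightarrow> j \<in> B \<Longrightarrow> g i j \<in> carrier R"
  shows "(\<Oplus>i\<in>A. \<Oplus>j\<in>B. g i j) = (\<Oplus>j\<in>B. \<Oplus>i\<in>A. g i j)"
  using assms(1,3)
proof (induction A rule: finite_induct)
  case (insert a A)
  then have [simp]: "g a \<in> B \<rightarrow> carrier R" "(\<lambda>j. \<Oplus>i\<in>A. g i j) \<in> B \<rightarrow> carrier R"
    "(\<lambda>i. \<Oplus>j\<in>B. g i j) \<in> A \<rightarrow> carrier R" "(\<Oplus>j\<in>B. g a j) \<in> carrier R"
    by (auto intro!: finsum_closed)
  have "(\<Oplus>j\<in>B. \<Oplus>i\<in>insert a A. g i j) = (\<Oplus>j\<in>B. g a j \<oplus> (\<Oplus>i\<in>A. g i j))"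
    using insert by (intro finsum_cong' refl) (auto simp: finsum_insert intro!: finsum_closed)
  also have "\<dots> = (\<Oplus>j\<in>B. g a j) \<oplus> (\<Oplus>j\<in>B. \<Oplus>i\<in>A. g i j)"
    by (intro finsum_addf) auto
  finally show ?case using insert by (simp add: finsum_insert)
qed (simp add: finsum_zero)

abbreviation laurent :: "(int \<Rightarrow> 'a) ring" where
  "laurent \<equiv> laurent_series R"

lemma laurent_mult_eq_finsum:
  assumes "\<And>i. f i \<in> carrier R" "\<And>i. g i \<in> carrier R"
    and "finite S" "{i. f i \<noteq> \<zero> \<and> g (n - i) \<noteq> \<zero>} \<subseteq> S"
  shows "(f \<otimes>\<^bsub>laurent\<^esub> g) n = (\<Oplus>i\<in>S. f i \<otimes> g (n - i))"
proof -
  have "(\<Oplus>i\<in>{i. f i \<noteq> \<zero> \<and> g (n - i) \<noteq> \<zero>}. f i \<otimes> g (n - i)) = (\<Oplus>i\<in>S. f i \<otimes> g (n - i))"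
    using assms by (intro add.finprod_mono_neutral_cong_left) auto
  then show ?thesis by (simp add: laurent_series_def)
qed

lemma laurent_mult_interval:
  assumes "\<And>i. f i \<in> carrier R" "\<And>i. g i \<in> carrier R"
    and "\<forall>i<A. f i = \<zero>" "\<forall>i<B. g i = \<zero>" "L \<le> A" "n - B \<le> U"
  shows "(f \<otimes>\<^bsub>laurent\<^esub> g) n = (\<Oplus>i\<in>{L..U}. f i \<otimes> g (n - i))"
proof (intro laurent_mult_eq_finsum assms(1,2) subsetI)
  fix i assume "i \<in> {i. f i \<noteq> \<zero> \<and> g (n - i) \<noteq> \<zero>}"
  then have "\<not> i < A" "\<not> n - i < B" using assms by auto
  then show "i \<in> {L..U}" using assms by simp
qed simp

lemma laurent_mult_nth_closed:
  assumes "\<And>i. f i \<in> carrier R" "\<And>i. g i \<in> carrier R"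
  shows "(f \<otimes>\<^bsub>laurent\<^esub> g) n \<in> carrier R"
  using assms by (auto simp: laurent_series_def intro!: finsum_closed)

lemma laurent_mult_below:
  assumes "\<And>i. f i \<in> carrier R" "\<And>i. g i \<in> carrier R"
    and "\<forall>i<A. f i = \<zero>" "\<forall>i<B. g i = \<zero>" "n < A + B"
  shows "(f \<otimes>\<^bsub>laurent\<^esub> g) n = \<zero>"
  using laurent_mult_interval[OF assms(1-4), of A n "n - B"] assms(5) by simp

text \<open>The interchange of summations is that of \<open>skew_mult_assoc\<close>, now for
  \<open>finsum\<close> in a ring record, where membership of each summand in the carrier has to
  accompany the computation.\<close>

lemma laurent_mult_assoc:
  assumes fc: "\<And>i. f i \<in> carrier R" and gc: "\<And>i. g i \<in> carrier R" and hc: "\<And>i. h i \<in> carrier R"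
    and A: "\<forall>i<A. f i = \<zero>" and B: "\<forall>i<B. g i = \<zero>" and C: "\<forall>i<C. h i = \<zero>"
  shows "(f \<otimes>\<^bsub>laurent\<^esub> g) \<otimes>\<^bsub>laurent\<^esub> h = f \<otimes>\<^bsub>laurent\<^esub> (g \<otimes>\<^bsub>laurent\<^esub> h)"
proof
  fix n
  note fg = laurent_mult_nth_closed[of f g, OF fc gc] and gh = laurent_mult_nth_closed[of g h, OF gc hc]
  have AB: "\<forall>i<A+B. (f \<otimes>\<^bsub>laurent\<^esub> g) i = \<zero>" and BC: "\<forall>i<B+C. (g \<otimes>\<^bsub>laurent\<^esub> h) i = \<zero>"
    using laurent_mult_below[of f g, OF fc gc A B] laurent_mult_below[of g h, OF gc hc B C] by auto
  let ?t = "\<lambda>i j. f i \<otimes> g j \<otimes> h (n - i - j)"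
  have "((f \<otimes>\<^bsub>laurent\<^esub> g) \<otimes>\<^bsub>laurent\<^esub> h) n = (\<Oplus>l\<in>{A+B..n-C}. (f \<otimes>\<^bsub>laurent\<^esub> g) l \<otimes> h (n - l))"
    by (rule laurent_mult_interval[OF fg hc AB C]) auto
  also have "\<dots> = (\<Oplus>l\<in>{A+B..n-C}. \<Oplus>i\<in>{A..n-B-C}. ?t i (l - i))"
  proof (rule finsum_cong'[OF refl])
    fix l assume "l \<in> {A+B..n-C}"
    then have "(f \<otimes>\<^bsub>laurent\<^esub> g) l = (\<Oplus>i\<in>{A..n-B-C}. f i \<otimes> g (l - i))"
      by (intro laurent_mult_interval[OF fc gc A B]) auto
    then show "(f \<otimes>\<^bsub>laurent\<^esub> g) l \<otimes> h (n - l) = (\<Oplus>i\<in>{A..n-B-C}. ?t i (l - i))"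
      using fc gc hc by (simp add: finsum_ldistr algebra_simps)
  qed (use fc gc hc in \<open>auto intro!: finsum_closed\<close>)
  also have "\<dots> = (\<Oplus>i\<in>{A..n-B-C}. \<Oplus>l\<in>{A+B..n-C}. ?t i (l - i))"
    using fc gc hc by (intro finsum_swap) auto
  also have "\<dots> = (\<Oplus>i\<in>{A..n-B-C}. f i \<otimes> (g \<otimes>\<^bsub>laurent\<^esub> h) (n - i))"
  proof (rule finsum_cong'[OF refl])
    fix i assume i: "i \<in> {A..n-B-C}"
    have "(\<Oplus>l\<in>{A+B..n-C}. ?t i (l - i)) = (\<Oplus>j\<in>(\<lambda>l. l - i) ` {A+B..n-C}. ?t i j)"
      using fc gc hc by (intro add.finprod_reindex[symmetric]) (auto simp: inj_on_def)
    also have "(\<lambda>l. l - i) ` {A+B..n-C} = {A+B-i..n-C-i}"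
      by simp
    also have "(\<Oplus>j\<in>{A+B-i..n-C-i}. ?t i j) = (\<Oplus>j\<in>{A+B-i..n-C-i}. f i \<otimes> (g j \<otimes> h (n - i - j)))"
      using fc gc hc by (simp add: m_assoc)
    also have "\<dots> = f i \<otimes> (\<Oplus>j\<in>{A+B-i..n-C-i}. g j \<otimes> h (n - i - j))"
      using fc gc hc by (simp add: finsum_rdistr)
    also have "(\<Oplus>j\<in>{A+B-i..n-C-i}. g j \<otimes> h (n - i - j)) = (g \<otimes>\<^bsub>laurent\<^esub> h) (n - i)"
      using i by (intro laurent_mult_interval[symmetric, OF gc hc B C]) auto
    finally show "(\<Oplus>l\<in>{A+B..n-C}. ?t i (l - i)) = f i \<otimes> (g \<otimes>\<^bsub>laurent\<^esub> h) (n - i)" .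
  qed (use fc gh in auto)
  also have "\<dots> = (f \<otimes>\<^bsub>laurent\<^esub> (g \<otimes>\<^bsub>laurent\<^esub> h)) n"
    by (rule laurent_mult_interval[symmetric, OF fc gh A BC]) auto
  finally show "((f \<otimes>\<^bsub>laurent\<^esub> g) \<otimes>\<^bsub>laurent\<^esub> h) n = (f \<otimes>\<^bsub>laurent\<^esub> (g \<otimes>\<^bsub>laurent\<^esub> h)) n" .
qed

lemma const_series_closed: "b \<in> carrier R \<Longrightarrow> const_series R b \<in> carrier laurent"
  by (auto simp: const_series_def intro: exI[of _ 0])

lemma const_series_mult_left:
  assumes "b \<in> carrier R" "\<And>i. f i \<in> carrier R"
  shows "(const_series R b \<otimes>\<^bsub>laurent\<^esub> f) n = b \<otimes> f n"
  using assms by (subst laurent_mult_eq_finsum[of _ _ "{0}"]) (auto simp: const_series_def finsum_insert)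

lemma const_series_mult_right:
  assumes "b \<in> carrier R" "\<And>i. f i \<in> carrier R"
  shows "(f \<otimes>\<^bsub>laurent\<^esub> const_series R b) n = f n \<otimes> b"
  using assms
  by (subst laurent_mult_eq_finsum[of _ _ "{n}"]) (auto simp: const_series_def finsum_insert split: if_splits)

lemma laurent_one_eq: "\<one>\<^bsub>laurent\<^esub> = const_series R \<one>"
  by (simp add: const_series_def)

lemma monoid_laurent: "monoid laurent"
proof
  show "f \<otimes>\<^bsub>laurent\<^esub> g \<in> carrier laurent" if "f \<in> carrier laurent" "g \<in> carrier laurent" for f g
  proof -
    obtain A B where "\<forall>i<A. f i = \<zero>" "\<forall>i<B. g i = \<zero>" using \<open>f \<in> _\<close> \<open>g \<in> _\<close> by auto
    then have "\<forall>n<A + B. (f \<otimes>\<^bsub>laurent\<^esub> g) n = \<zero>" using that by (auto intro: laurent_mult_below)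
    then show ?thesis using that laurent_mult_nth_closed[of f g] by auto
  qed
  show "f \<otimes>\<^bsub>laurent\<^esub> g \<otimes>\<^bsub>laurent\<^esub> h = f \<otimes>\<^bsub>laurent\<^esub> (g \<otimes>\<^bsub>laurent\<^esub> h)"
    if "f \<in> carrier laurent" "g \<in> carrier laurent" "h \<in> carrier laurent" for f g h
    using that by (auto intro: laurent_mult_assoc)
  show "\<one>\<^bsub>laurent\<^esub> \<in> carrier laurent"
    unfolding laurent_one_eq by (simp only: const_series_closed one_closed)
  show "\<one>\<^bsub>laurent\<^esub> \<otimes>\<^bsub>laurent\<^esub> f = f" "f \<otimes>\<^bsub>laurent\<^esub> \<one>\<^bsub>laurent\<^esub> = f" if "f \<in> carrier laurent" for f
    using that unfolding laurent_one_eq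
    by (auto simp: fun_eq_iff const_series_mult_left const_series_mult_right)
qed

lemma laurent_r_distr:
  assumes "f \<in> carrier laurent" "g \<in> carrier laurent" "h \<in> carrier laurent"
  shows "(f \<otimes>\<^bsub>laurent\<^esub> (g \<oplus>\<^bsub>laurent\<^esub> h)) n = (f \<otimes>\<^bsub>laurent\<^esub> g) n \<oplus> (f \<otimes>\<^bsub>laurent\<^esub> h) n"
proof -
  have c: "\<And>i. f i \<in> carrier R" "\<And>i. g i \<in> carrier R" "\<And>i. h i \<in> carrier R" using assms by auto
  obtain A B C where A: "\<forall>i<A. f i = \<zero>" and "\<forall>i<B. g i = \<zero>" "\<forall>i<C. h i = \<zero>"
    using assms by auto
  then have *: "\<forall>i<min B C. g i = \<zero>" "\<forall>i<min B C. h i = \<zero>" "\<forall>i<min B C. g i \<oplus> h i = \<zero>" by auto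
  have "(f \<otimes>\<^bsub>laurent\<^esub> (\<lambda>i. g i \<oplus> h i)) n = (\<Oplus>i\<in>{A..n - min B C}. f i \<otimes> (g (n - i) \<oplus> h (n - i)))"
    by (rule laurent_mult_interval[OF c(1) _ A *(3)]) (use c in auto)
  also have "\<dots> = (\<Oplus>i\<in>{A..n - min B C}. f i \<otimes> g (n - i)) \<oplus> (\<Oplus>i\<in>{A..n - min B C}. f i \<otimes> h (n - i))"
    using c by (simp add: r_distr finsum_addf)
  also have "(\<Oplus>i\<in>{A..n - min B C}. f i \<otimes> g (n - i)) = (f \<otimes>\<^bsub>laurent\<^esub> g) n"
    by (rule laurent_mult_interval[symmetric, OF c(1,2) A *(1)]) auto
  also have "(\<Oplus>i\<in>{A..n - min B C}. f i \<otimes> h (n - i)) = (f \<otimes>\<^bsub>laurent\<^esub> h) n"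
    by (rule laurent_mult_interval[symmetric, OF c(1,3) A *(2)]) auto
  finally show ?thesis by simp
qed

text \<open>\<open>ideal\<close> is two-sided; centrality of x turns a left multiple of x b into x
  times an element.\<close>

lemma central_ideal_generated:
  assumes x: "x \<in> carrier R" and central: "\<And>y. y \<in> carrier R \<Longrightarrow> x \<otimes> y = y \<otimes> x"
  shows "ideal (x <# carrier R) R"
proof (intro idealI subgroup.intro)
  show "ring R" by (rule ring_axioms)
  show "x <# carrier R \<subseteq> carrier (add_monoid R)" using x by (auto simp: l_coset_def)
  show "a \<otimes>\<^bsub>add_monoid R\<^esub> b \<in> x <# carrier R" if "a \<in> x <# carrier R" "b \<in> x <# carrier R" for a b
    using that x by (auto simp: l_coset_def simp flip: r_distr)
  show "\<one>\<^bsub>add_monoid R\<^esub> \<in> x <# carrier R"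
    using x by (auto simp: l_coset_def intro!: bexI[of _ \<zero>])
  show "inv\<^bsub>add_monoid R\<^esub> a \<in> x <# carrier R" if a: "a \<in> x <# carrier R" for a
  proof -
    have "\<exists>y\<in>carrier R. a = x \<otimes> y" using a by (simp add: l_coset_def)
    then obtain y where y: "y \<in> carrier R" "a = x \<otimes> y" by (elim bexE)
    then have "inv\<^bsub>add_monoid R\<^esub> a = x \<otimes> (\<ominus> y)" using x by (simp add: r_minus a_inv_def[symmetric])
    then show ?thesis using y by (auto simp: l_coset_def)
  qed
  show "y \<otimes> a \<in> x <# carrier R" "a \<otimes> y \<in> x <# carrier R" if a: "a \<in> x <# carrier R" and "y \<in> carrier R" for a y
  proof -
    obtain b where b: "b \<in> carrier R" "a = x \<otimes> b" using a by (auto simp: l_coset_def)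
    then have "y \<otimes> a = x \<otimes> (y \<otimes> b)" "a \<otimes> y = x \<otimes> (b \<otimes> y)"
      using x that central[of y] by (simp_all add: m_assoc[symmetric])
    then show "y \<otimes> a \<in> x <# carrier R" "a \<otimes> y \<in> x <# carrier R"
      using b that by (auto simp: l_coset_def)
  qed
qed

lemma central_pow:
  assumes x: "x \<in> carrier R" and central: "\<And>y. y \<in> carrier R \<Longrightarrow> x \<otimes> y = y \<otimes> x"
    and y: "y \<in> carrier R"
  shows "x [^] (m::nat) \<otimes> y = y \<otimes> x [^] m"
proof (induction m)
  case (Suc m)
  have "x [^] Suc m \<otimes> y = x [^] m \<otimes> (y \<otimes> x)" using x y by (simp add: m_assoc central)
  also have "\<dots> = y \<otimes> x [^] Suc m" using x y Suc by (simp add: m_assoc[symmetric])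
  finally show ?case .
qed (use y in simp)

end

context field_automorphism
begin

lemma skew_quot_facts:
  assumes "N \<in> carrier (skew_poly \<theta>)" "\<And>b. skew_mult \<theta> N b = skew_mult \<theta> b N"
  shows "ideal (central_ideal \<theta> N) (skew_poly \<theta>)" "ring (skew_quot \<theta> N)"
    "skew_class \<theta> N \<in> ring_hom (skew_poly \<theta>) (skew_quot \<theta> N)"
proof -
  interpret ring "skew_poly \<theta>" by (rule ring_skew_poly)
  show id: "ideal (central_ideal \<theta> N) (skew_poly \<theta>)"
    unfolding central_ideal_def
    by (intro central_ideal_generated assms(1)) (simp add: assms(2))
  show "ring (skew_quot \<theta> N)"
    unfolding skew_quot_def using id by (rule ideal.quotient_is_ring)
  show "skew_class \<theta> N \<in> ring_hom (skew_poly \<theta>) (skew_quot \<theta> N)"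
    using ideal.rcos_ring_hom[OF id] unfolding skew_quot_def skew_class_def[abs_def] .
qed

lemma to_completion_hom:
  assumes N: "N \<in> carrier (skew_poly \<theta>)" and central: "\<And>b. skew_mult \<theta> N b = skew_mult \<theta> b N"
  shows "to_completion \<theta> N \<in> ring_hom (skew_poly \<theta>) (completion \<theta> N)"
proof -
  interpret ring "skew_poly \<theta>" by (rule ring_skew_poly)
  let ?N = "\<lambda>m::nat. N [^]\<^bsub>skew_poly \<theta>\<^esub> m"
  have Nm: "?N m \<in> carrier (skew_poly \<theta>)" for m using N by (rule nat_pow_closed)
  have id: "ideal (central_ideal \<theta> (?N m)) (skew_poly \<theta>)" for m
    unfolding central_ideal_def using central_pow[OF N, of _ m] central
    by (intro central_ideal_generated Nm) simp
  have hom: "skew_class \<theta> (?N m) \<in> ring_hom (skew_poly \<theta>) (skew_quot \<theta> (?N m))" for m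
    using ideal.rcos_ring_hom[OF id[of m]] unfolding skew_quot_def skew_class_def[abs_def] .
  \<comment> \<open>Compatibility with the transition maps: N^(m+1) A lies in N^m A, so the cosets
    of one element are nested.\<close>
  have sub: "skew_class \<theta> (?N (Suc m)) a \<subseteq> skew_class \<theta> (?N m) a" for m a
  proof -
    have "central_ideal \<theta> (?N (Suc m)) \<subseteq> central_ideal \<theta> (?N m)"
    proof
      fix x assume "x \<in> central_ideal \<theta> (?N (Suc m))"
      then obtain y where y: "y \<in> carrier (skew_poly \<theta>)" "x = ?N (Suc m) \<otimes>\<^bsub>skew_poly \<theta>\<^esub> y"
        by (auto simp: central_ideal_def l_coset_def)
      then have "x = ?N m \<otimes>\<^bsub>skew_poly \<theta>\<^esub> (N \<otimes>\<^bsub>skew_poly \<theta>\<^esub> y)"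
        using m_assoc[OF Nm N y(1)] by (simp only: nat_pow_Suc)
      moreover have "N \<otimes>\<^bsub>skew_poly \<theta>\<^esub> y \<in> carrier (skew_poly \<theta>)" using N y(1) by (rule m_closed)
      ultimately show "x \<in> central_ideal \<theta> (?N m)" by (auto simp: central_ideal_def l_coset_def)
    qed
    then show ?thesis by (auto simp: skew_class_def a_r_coset_def r_coset_def)
  qed
  show ?thesis
    using ring_hom_closed[OF hom] ring_hom_mult[OF hom] ring_hom_add[OF hom] ring_hom_one[OF hom] sub
    unfolding to_completion_def completion_def Let_def
    by (intro ring_hom_memI) auto
qed

lemma skew_poly_induct [consumes 1, case_names monom add]:
  assumes "a \<in> carrier (skew_poly \<theta>)"
    and monom: "\<And>c n. Q (skew_monom c n)"
    and add: "\<And>a b. a \<in> carrier (skew_poly \<theta>) \<Longrightarrow> b \<in> carrier (skew_poly \<theta>) \<Longrightarrow> Q a \<Longrightarrow> Q b \<Longrightarrow>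
      Q (\<lambda>i. a i + b i)"
  shows "Q a"
proof -
  have "finite S \<Longrightarrow> {i. a i \<noteq> 0} \<subseteq> S \<Longrightarrow> Q a" for S
  proof (induction S arbitrary: a rule: finite_induct)
    case empty
    then have "a = skew_monom 0 0" by (auto simp: skew_monom_def)
    then show ?case using monom by simp
  next
    case (insert n S)
    let ?b = "\<lambda>i. if i = n then 0 else a i"
    have sub: "{i. ?b i \<noteq> 0} \<subseteq> S" using insert by auto
    have "?b \<in> carrier (skew_poly \<theta>)"
      using finite_subset[OF sub insert(1)] by (simp only: skew_poly_simps mem_Collect_eq)
    moreover have "a = (\<lambda>i. ?b i + skew_monom (a n) n i)" by (auto simp: skew_monom_def)
    ultimately show ?case using add[OF _ skew_monom_in_skew_poly insert.IH[OF sub] monom] by metis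
  qed
  then show ?thesis using assms(1) by simp
qed

end

section \<open>Division with remainder over a subfield\<close>

context subfield_set
begin

lemma polys_over_0: "0 \<in> polys_over F"
  by (simp add: polys_over_def zero)

lemma polys_over_add: "P \<in> polys_over F \<Longrightarrow> Q \<in> polys_over F \<Longrightarrow> P + Q \<in> polys_over F"
  by (simp add: polys_over_def add)

lemma polys_over_minus: "P \<in> polys_over F \<Longrightarrow> - P \<in> polys_over F"
  by (simp add: polys_over_def minus)

lemma polys_over_smult: "c \<in> F \<Longrightarrow> P \<in> polys_over F \<Longrightarrow> smult c P \<in> polys_over F"
  by (simp add: polys_over_def mult)

lemma polys_over_mult: "P \<in> polys_over F \<Longrightarrow> Q \<in> polys_over F \<Longrightarrow> P * Q \<in> polys_over F"
  by (simp add: polys_over_def coeff_mult sum mult)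

lemma polys_over_const: "[:c:] \<in> polys_over F \<longleftrightarrow> c \<in> F"
  by (simp add: polys_over_pCons_iff polys_over_0)

lemma polys_over_diff: "P \<in> polys_over F \<Longrightarrow> Q \<in> polys_over F \<Longrightarrow> P - Q \<in> polys_over F"
  using polys_over_add[OF _ polys_over_minus] by fastforce

text \<open>Polynomials over F are only a set of polynomials over the larger field, so division is
  taken there. Each new coefficient of the quotient is a coefficient divided by the leading one of B
  and thus stays in F.\<close>

lemma polys_over_div_mod:
  assumes B: "B \<in> polys_over F" "B \<noteq> 0"
  shows "M \<in> polys_over F \<Longrightarrow> M div B \<in> polys_over F \<and> M mod B \<in> polys_over F"
proof (induction M)
  case (pCons a M)
  define b where "b = poly.coeff (pCons a (M mod B)) (degree B) / lead_coeff B"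
  have *: "pCons a M div B = pCons b (M div B)" "pCons a M mod B = pCons a (M mod B) - smult b B"
    using B(2) by (simp_all add: b_def div_pCons_eq mod_pCons_eq)
  have aM: "a \<in> F" "pCons a (M mod B) \<in> polys_over F" "M div B \<in> polys_over F"
    using pCons by (simp_all add: polys_over_pCons_iff)
  moreover have "poly.coeff Q i \<in> F" if "Q \<in> polys_over F" for Q i
    using that by (simp add: polys_over_def)
  ultimately have "b \<in> F" unfolding b_def divide_inverse using B(1) by (intro mult inverse) blast+
  then show ?case unfolding * using aM B(1)
    by (simp add: polys_over_pCons_iff polys_over_diff polys_over_smult)
qed (simp add: polys_over_0)

end


section \<open>The residue field at an algebraic point\<close>

context field_embedding
begin

lemma map_poly_add: "map_poly e (P + Q) = map_poly e P + map_poly e Q"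
  by (intro poly_eqI) (simp add: coeff_map_poly add)

lemma map_poly_mult: "map_poly e (P * Q) = map_poly e P * map_poly e Q"
  by (intro poly_eqI) (simp add: coeff_map_poly coeff_mult sum mult)

lemma map_poly_minus: "map_poly e (- P) = - map_poly e P"
  by (intro poly_eqI) (simp add: coeff_map_poly minus)

lemma map_poly_one: "map_poly e 1 = 1"
  by (simp add: one_pCons)

lemma degree_map_poly_embedding: "degree (map_poly e P) = degree P"
  by (rule degree_map_poly) simp

lemma map_poly_eq_0_iff_embedding: "map_poly e P = 0 \<longleftrightarrow> P = 0"
  by (auto simp: poly_eq_iff coeff_map_poly)

end

text \<open>The Taylor expansion at z is the expansion at 0 of the translated polynomial, which
  gives nonvanishing at every z.\<close>

lemma eval_fls_shift: "eval_fls (fls_const z + fls_X) Q = eval_fls fls_X (pcompose Q [:z, 1:])"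
  by (induction Q) (simp_all add: pcompose_pCons eval_fls_add eval_fls_mult algebra_simps)

lemma eval_fls_local_param_nonzero:
  assumes "Q \<noteq> 0"
  shows "eval_fls (local_param (Some z)) Q \<noteq> 0"
proof -
  have "pcompose Q [:z, 1:] \<noteq> 0"
    using assms pcompose_eq_0[of Q "[:z, 1:]"] by auto
  then obtain n where "poly.coeff (pcompose Q [:z, 1:]) n \<noteq> 0" by (auto simp: poly_eq_iff)
  then show ?thesis
    using eval_fls_X_nth[of "pcompose Q [:z, 1:]" "int n"]
    by (auto simp: local_param_def eval_fls_shift)
qed

locale algebraic_point = skew_tensor \<theta> r e
  for \<theta> :: "'k::field \<Rightarrow> 'k" and r :: nat and e :: "'k \<Rightarrow> 's::field" +
  fixes z :: 's
  assumes algebraic: "\<exists>P\<in>polys_over (fixed_field \<theta>). P \<noteq> 0 \<and> poly (map_poly e P) z = 0"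
begin

abbreviation F :: "'k set" where "F \<equiv> fixed_field \<theta>"

definition ev :: "'k poly \<Rightarrow> 's" where
  "ev P = poly (map_poly e P) z"

lemma ev_simps [simp]:
  "ev 0 = 0" "ev 1 = 1" "ev (P + Q) = ev P + ev Q" "ev (P * Q) = ev P * ev Q" "ev (- P) = - ev P"
  "ev (pCons c P) = e c + z * ev P"
  by (simp_all add: ev_def e.map_poly_add e.map_poly_mult e.map_poly_minus e.map_poly_one)

lemma ev_diff: "ev (P - Q) = ev P - ev Q"
  using ev_simps(3)[of P "- Q"] by simp

definition N :: "'k poly" where
  "N = min_poly F e z"

text \<open>The description in \<open>min_poly\<close> is shown to be uniquely satisfied. A nonzero
  polynomial of least degree vanishing at z, made monic, satisfies it; the difference of two
  distinct solutions would vanish at z and have smaller degree.\<close>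

lemma N_props: "N \<in> polys_over F" "lead_coeff N = 1" "ev N = 0"
  and N_minimal: "\<And>M. M \<in> polys_over F \<Longrightarrow> M \<noteq> 0 \<Longrightarrow> ev M = 0 \<Longrightarrow> degree N \<le> degree M"
proof -
  let ?Q = "\<lambda>P. P \<in> polys_over F \<and> P \<noteq> 0 \<and> ev P = 0"
  let ?R = "\<lambda>N. N \<in> polys_over F \<and> lead_coeff N = 1 \<and> ev N = 0 \<and>
    (\<forall>M\<in>polys_over F. M \<noteq> 0 \<and> ev M = 0 \<longrightarrow> degree N \<le> degree M)"
  obtain P where P: "?Q P" and min: "\<And>M. ?Q M \<Longrightarrow> degree P \<le> degree M"
    using algebraic ex_has_least_nat[of ?Q _ degree] unfolding ev_def by blast
  define c where "c = inverse (lead_coeff P)"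
  have c: "c \<noteq> 0" "c \<in> F"
    using P by (auto simp: c_def polys_over_def intro!: fixed.inverse)
  have ex: "?R (smult c P)"
  proof (intro conjI ballI impI)
    show "smult c P \<in> polys_over F" using P c by (simp add: fixed.polys_over_smult)
    show "lead_coeff (smult c P) = 1" using P by (simp add: c_def)
    have "ev (smult c P) = ev ([:c:] * P)" by simp
    also have "\<dots> = 0" unfolding ev_simps(4) using P by simp
    finally show "ev (smult c P) = 0" .
    show "degree (smult c P) \<le> degree M" if "M \<in> polys_over F" "M \<noteq> 0 \<and> ev M = 0" for M
      using min[of M] that c by simp
  qed
  have unique: "A = B" if A: "?R A" and B: "?R B" for A B
  proof (rule ccontr)
    assume "A \<noteq> B"
    then have AB: "A - B \<noteq> 0" by simp
    have "A \<noteq> 0" "B \<noteq> 0" using A B by auto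
    then have deg: "degree A = degree B" using A B by (intro order_antisym) auto
    have "degree A \<le> degree (A - B)" using A B AB by (simp add: fixed.polys_over_diff ev_diff)
    moreover have "degree (A - B) \<le> degree A" using deg degree_diff_le_max[of A B] by simp
    ultimately have "lead_coeff (A - B) = 0" using A B deg by simp
    with AB show False by (simp only: leading_coeff_0_iff)
  qed
  have "N = (THE N. ?R N)" by (simp add: N_def min_poly_def ev_def)
  then have "?R N" using theI[of ?R, OF ex unique[OF _ ex]] by simp
  then show "N \<in> polys_over F" "lead_coeff N = 1" "ev N = 0"
    "\<And>M. M \<in> polys_over F \<Longrightarrow> M \<noteq> 0 \<Longrightarrow> ev M = 0 \<Longrightarrow> degree N \<le> degree M" by auto
qed

lemma N_nonzero: "N \<noteq> 0"
  using N_props(2) by auto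

lemma ev_eq_0_imp_multiple:
  assumes "M \<in> polys_over F" "ev M = 0"
  obtains U where "U \<in> polys_over F" "M = N * U"
proof -
  have dm: "M div N \<in> polys_over F" "M mod N \<in> polys_over F"
    using fixed.polys_over_div_mod[OF N_props(1) N_nonzero assms(1)] by auto
  have "ev (N * (M div N) + M mod N) = 0" using assms(2) by simp
  then have "ev (M mod N) = 0" by (simp only: ev_simps N_props) simp
  then have "M mod N = 0"
    using N_minimal[OF dm(2)] degree_mod_less'[OF N_nonzero, of M] by (meson not_le)
  then show ?thesis using that[of "M div N"] dm by (metis add.right_neutral mult_div_mod_eq)
qed

text \<open>A Euclidean descent: N = M Q + R gives ev M ev Q = - ev R, so an inverse of ev R, with R
  of smaller degree than M, yields one of ev M.\<close>

lemma ev_inverse: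
  "M \<in> polys_over F \<Longrightarrow> ev M \<noteq> 0 \<Longrightarrow> \<exists>U\<in>polys_over F. ev U * ev M = 1"
proof (induction "degree M" arbitrary: M rule: less_induct)
  case less
  have M0: "M \<noteq> 0" using less.prems by auto
  show ?case
  proof (cases "degree M = 0")
    case True
    then obtain c where c: "M = [:c:]" by (metis degree_eq_zeroE)
    then have "[:inverse c:] \<in> polys_over F" "c \<noteq> 0"
      using less.prems by (auto simp: fixed.polys_over_const intro: fixed.inverse)
    then show ?thesis using c by (intro bexI[of _ "[:inverse c:]"]) (auto simp: e.inverse)
  next
    case False
    let ?Q = "N div M" and ?R = "N mod M"
    have QR: "?Q \<in> polys_over F" "?R \<in> polys_over F"
      using fixed.polys_over_div_mod[OF less.prems(1) M0 N_props(1)] by auto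
    have "ev (M * ?Q + ?R) = 0" using N_props(3) by simp
    then have eq: "ev M * ev ?Q + ev ?R = 0" by (simp only: ev_simps)
    show ?thesis
    proof (cases "ev ?R = 0")
      case True
      \<comment> \<open>Either Q = 0, and then M has larger degree than N and is replaced by its
        remainder modulo N, or Q has degree at least that of N, which contradicts N = M Q + R with M
        not constant.\<close>
      then have Q: "ev ?Q = 0" using eq less.prems by simp
      show ?thesis
      proof (cases "?Q = 0")
        case True
        let ?M = "M mod N"
        have "ev (N * (M div N) + ?M) = ev M" by simp
        then have evM: "ev ?M = ev M" by (simp only: ev_simps N_props) simp
        have "degree N < degree M" using True N_nonzero M0 by (simp add: div_poly_eq_0_iff)
        moreover have "?M \<noteq> 0" using evM less.prems by auto
        ultimately have "degree ?M < degree M"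
          using degree_mod_less[OF N_nonzero, of M] by simp
        then have "\<exists>U\<in>polys_over F. ev U * ev ?M = 1"
          using less.hyps[of ?M] evM less.prems fixed.polys_over_div_mod[OF N_props(1) N_nonzero] by auto
        then show ?thesis using evM by simp
      next
        case False
        then have "degree N \<le> degree ?Q" using N_minimal QR Q by blast
        moreover have "degree N = degree (M * ?Q)"
        proof -
          have "degree (M * ?Q) = degree M + degree ?Q" using M0 False by (rule degree_mult_eq)
          moreover have "?R = 0 \<or> degree ?R < degree M" using degree_mod_less[OF M0] .
          moreover have "degree (M * ?Q + ?R) = degree (M * ?Q)" if "degree ?R < degree (M * ?Q)"
            using that by (rule degree_add_eq_left)
          ultimately show ?thesis by (cases "?R = 0") auto
        qed
        ultimately show ?thesis using M0 False \<open>degree M \<noteq> 0\<close> by (simp add: degree_mult_eq)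
      qed
    next
      case R: False
      then have "degree ?R < degree M" using degree_mod_less[OF M0, of N] by auto
      then obtain U where U: "U \<in> polys_over F" "ev U * ev ?R = 1"
        using less.hyps[of ?R] QR R by auto
      have "ev ?R = - (ev ?Q * ev M)" using eq by (simp add: eq_neg_iff_add_eq_0 add.commute mult.commute)
      then have "ev (- (U * ?Q)) * ev M = 1" using U by (simp add: algebra_simps)
      moreover have "- (U * ?Q) \<in> polys_over F"
        using U QR by (intro fixed.polys_over_minus fixed.polys_over_mult)
      ultimately show ?thesis by blast
    qed
  qed
qed

text \<open>This is the field F(z): as z is algebraic, the values of polynomials are already closed
  under inverses.\<close>

definition Fz :: "'s set" where
  "Fz = ev ` polys_over F"

sublocale Fz: subfield_set Fz
proof
  have "0 \<in> polys_over F" "1 \<in> polys_over F"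
    by (auto simp: polys_over_def coeff_1 fixed.zero fixed.one)
  then show "0 \<in> Fz" "1 \<in> Fz" unfolding Fz_def using ev_simps(1,2) by (metis imageI)+
  fix a b
  show "a + b \<in> Fz" "a * b \<in> Fz" if "a \<in> Fz" "b \<in> Fz"
    using that unfolding Fz_def
    by (auto simp flip: ev_simps(3,4) intro!: imageI fixed.polys_over_add fixed.polys_over_mult)
  show "- a \<in> Fz" if "a \<in> Fz"
    using that unfolding Fz_def by (auto simp flip: ev_simps(5) intro!: imageI fixed.polys_over_minus)
  show "inverse a \<in> Fz" if a: "a \<in> Fz"
  proof (cases "a = 0")
    case True
    then show ?thesis using \<open>0 \<in> Fz\<close> by simp
  next
    case False
    obtain M where M: "M \<in> polys_over F" "a = ev M" using a unfolding Fz_def by blast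
    then obtain U where U: "U \<in> polys_over F" "ev U * ev M = 1" using ev_inverse False by blast
    then have "inverse a = ev U" using M by (metis inverse_unique mult.commute)
    then show ?thesis using U by (auto simp: Fz_def)
  qed
qed

lemma ev_in_Fz: "M \<in> polys_over F \<Longrightarrow> ev M \<in> Fz"
  by (simp add: Fz_def)

lemma z_in_Fz: "z \<in> Fz"
proof -
  have "[:0, 1:] \<in> polys_over F"
    by (simp add: polys_over_pCons_iff fixed.zero fixed.one fixed.polys_over_0)
  then show ?thesis using ev_in_Fz by fastforce
qed

lemma e_in_Fz: "c \<in> F \<Longrightarrow> e c \<in> Fz"
  using ev_in_Fz[of "[:c:]"] by (simp add: fixed.polys_over_const)

section \<open>The copy of F(z) in A/NA\<close>

abbreviation NY :: "int \<Rightarrow> 'k" where "NY \<equiv> min_poly_Y \<theta> r e z"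

lemma NY_eq: "NY = poly_at_Y r N"
  by (simp add: min_poly_Y_def N_def)

lemma NY_centre: "NY \<in> skew_centre \<theta> r"
  unfolding NY_eq using N_props(1) by (rule poly_at_Y_in_centre)

lemmas NY_closed = skew_centre_closed[OF NY_centre] and NY_central = centre_central[OF NY_centre]

abbreviation "A \<equiv> skew_poly \<theta>"
abbreviation "B \<equiv> skew_quot \<theta> NY"
abbreviation "cl \<equiv> skew_class \<theta> NY"

sublocale A: ring A by (rule ring_skew_poly)
sublocale B: ring B by (rule skew_quot_facts(2)[OF NY_closed NY_central])
sublocale id: ideal "central_ideal \<theta> NY" A by (rule skew_quot_facts(1)[OF NY_closed NY_central])
sublocale L: monoid "laurent_series B" by (rule B.monoid_laurent)

lemma cl_hom: "cl \<in> ring_hom A B"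
  by (rule skew_quot_facts(3)[OF NY_closed NY_central])

lemmas cl_closed [simp] = ring_hom_closed[OF cl_hom]
  and cl_mult = ring_hom_mult[OF cl_hom] and cl_add = ring_hom_add[OF cl_hom]
  and cl_one = ring_hom_one[OF cl_hom]

lemma cl_zero: "cl (\<lambda>_. 0) = \<zero>\<^bsub>B\<^esub>"
  using ring_hom_zero[OF cl_hom A.ring_axioms B.ring_axioms] by simp

lemma poly_at_Y_closed: "P \<in> polys_over F \<Longrightarrow> poly_at_Y r P \<in> carrier A"
  by (intro skew_centre_closed poly_at_Y_in_centre)

lemma poly_at_Y_add: "poly_at_Y r (P + Q) = poly_at_Y r P \<oplus>\<^bsub>A\<^esub> poly_at_Y r Q"
  by (auto simp: poly_at_Y_def)

lemma poly_at_Y_mult: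
  "P \<in> polys_over F \<Longrightarrow> poly_at_Y r (P * Q) = poly_at_Y r P \<otimes>\<^bsub>A\<^esub> poly_at_Y r Q"
  unfolding poly_at_Y_eq_fls_at_Y(1)[OF r] by (simp add: fls_at_Y_mult eval_fls_over eval_fls_mult)

lemma poly_at_Y_monom: "poly_at_Y r (Polynomial.monom c i) = skew_monom c (int i * int r)"
proof
  fix n
  show "poly_at_Y r (Polynomial.monom c i) n = skew_monom c (int i * int r) n"
  proof (cases "n \<ge> 0 \<and> int r dvd n")
    case True
    then have "n = int (nat (n div int r)) * int r"
      using r by (auto simp: pos_imp_zdiv_nonneg_iff)
    then obtain k :: nat where "n = int k * int r" by blast
    then show ?thesis using r by (auto simp: poly_at_Y_def skew_monom_def)
  next
    case False
    then show ?thesis by (auto simp: poly_at_Y_def skew_monom_def)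
  qed
qed

lemma poly_at_Y_const: "poly_at_Y r [:c:] = skew_monom c 0"
  using poly_at_Y_monom[of c 0] by (simp add: monom_0)

lemma poly_at_Y_Y: "poly_at_Y r [:0, 1:] = skew_monom 1 (int r)"
  using poly_at_Y_monom[of 1 1] by (simp add: monom_Suc monom_0)

text \<open>Two polynomials with the same value at z differ by a multiple of N, whose class is zero.
  Hence the choice in the definition of \<open>\<psi>\<close> is immaterial.\<close>

lemma cl_eq_if_ev_eq:
  assumes "M \<in> polys_over F" "M' \<in> polys_over F" "ev M = ev M'"
  shows "cl (poly_at_Y r M) = cl (poly_at_Y r M')"
proof -
  have "M - M' \<in> polys_over F" "ev (M - M') = 0"
    using assms by (simp_all add: fixed.polys_over_diff ev_diff)
  then obtain U where U: "U \<in> polys_over F" "M - M' = N * U" by (rule ev_eq_0_imp_multiple)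
  have clN: "cl (poly_at_Y r N) = \<zero>\<^bsub>B\<^esub>"
  proof -
    have "poly_at_Y r N \<in> central_ideal \<theta> NY"
      using A.r_one[OF NY_closed] A.one_closed
      unfolding central_ideal_def l_coset_def NY_eq by blast
    then show ?thesis
      using id.a_rcos_const by (simp add: skew_class_def skew_quot_def FactRing_def)
  qed
  have "M = M' + N * U" using U by (simp add: algebra_simps)
  then have "cl (poly_at_Y r M) = cl (poly_at_Y r M') \<oplus>\<^bsub>B\<^esub> cl (poly_at_Y r N) \<otimes>\<^bsub>B\<^esub> cl (poly_at_Y r U)"
    using U(1) assms(2) N_props(1)
    by (simp only: poly_at_Y_add poly_at_Y_mult cl_add cl_mult poly_at_Y_closed A.m_closed)
  also have "\<dots> = cl (poly_at_Y r M')"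
    unfolding clN using U assms(2) poly_at_Y_closed by (simp del: skew_poly_simps)
  finally show ?thesis .
qed

text \<open>The inverse of the identification of Z/NZ with F(z), followed by the inclusion into A/NA.\<close>

definition \<psi> :: "'s \<Rightarrow> (int \<Rightarrow> 'k) set" where
  "\<psi> y = cl (poly_at_Y r (SOME M. M \<in> polys_over F \<and> ev M = y))"

lemma \<psi>_ev: "M \<in> polys_over F \<Longrightarrow> \<psi> (ev M) = cl (poly_at_Y r M)"
  unfolding \<psi>_def by (rule someI2[of _ M]) (use cl_eq_if_ev_eq in blast)+

lemma \<psi>_closed: "y \<in> Fz \<Longrightarrow> \<psi> y \<in> carrier B"
  by (auto simp: Fz_def \<psi>_ev poly_at_Y_closed simp del: skew_poly_simps)

lemma \<psi>_add: "x \<in> Fz \<Longrightarrow> y \<in> Fz \<Longrightarrow> \<psi> (x + y) = \<psi> x \<oplus>\<^bsub>B\<^esub> \<psi> y"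
  by (auto simp: Fz_def \<psi>_ev fixed.polys_over_add poly_at_Y_closed poly_at_Y_add cl_add
      simp del: skew_poly_simps ev_simps simp flip: ev_simps(3))

lemma \<psi>_mult: "x \<in> Fz \<Longrightarrow> y \<in> Fz \<Longrightarrow> \<psi> (x * y) = \<psi> x \<otimes>\<^bsub>B\<^esub> \<psi> y"
  by (auto simp: Fz_def \<psi>_ev fixed.polys_over_mult poly_at_Y_closed poly_at_Y_mult cl_mult
      simp del: skew_poly_simps ev_simps simp flip: ev_simps(4))

lemma \<psi>_e: "c \<in> F \<Longrightarrow> \<psi> (e c) = cl (skew_monom c 0)"
  using \<psi>_ev[of "[:c:]"] by (simp add: fixed.polys_over_const poly_at_Y_const)

lemma \<psi>_z: "\<psi> z = cl (skew_monom 1 (int r))"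
  using \<psi>_ev[of "[:0, 1:]"] fixed.zero fixed.one
  by (simp add: poly_at_Y_Y polys_over_pCons_iff fixed.polys_over_0)

lemma \<psi>_0: "\<psi> 0 = \<zero>\<^bsub>B\<^esub>" and \<psi>_1: "\<psi> 1 = \<one>\<^bsub>B\<^esub>"
proof -
  have "skew_monom (0::'k) 0 = (\<lambda>_. 0)" by (auto simp: skew_monom_def)
  then show "\<psi> 0 = \<zero>\<^bsub>B\<^esub>" using \<psi>_e[of 0] cl_zero fixed.zero by simp
  show "\<psi> 1 = \<one>\<^bsub>B\<^esub>" using \<psi>_e[of 1] cl_one fixed.one by simp
qed

lemma \<psi>_sum:
  "finite I \<Longrightarrow> (\<And>i. i \<in> I \<Longrightarrow> g i \<in> Fz) \<Longrightarrow> \<psi> (\<Sum>i\<in>I. g i) = (\<Oplus>\<^bsub>B\<^esub>i\<in>I. \<psi> (g i))"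
proof (induction I rule: finite_induct)
  case (insert x I)
  then show ?case
    by (subst B.finsum_insert) (auto simp: \<psi>_add \<psi>_closed Fz.sum)
qed (simp add: \<psi>_0)

text \<open>On series over F(z) this is the embedding of F(z)((T)) into (A/NA)((T)). Inverses of
  denominators are found on the commutative side and transported.\<close>

definition \<Psi> :: "'s fls \<Rightarrow> int \<Rightarrow> (int \<Rightarrow> 'k) set" where
  "\<Psi> g = (\<lambda>n. \<psi> (fls_nth g n))"

lemma \<Psi>_nth_closed: "Fz.fls_over g \<Longrightarrow> \<Psi> g n \<in> carrier B"
  by (simp add: \<Psi>_def Fz.fls_over_def \<psi>_closed)

lemma \<Psi>_closed: "Fz.fls_over g \<Longrightarrow> \<Psi> g \<in> carrier (laurent_series B)"
  using \<Psi>_nth_closed by (auto simp: \<Psi>_def \<psi>_0 intro!: exI[of _ "fls_subdegree g"])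

lemma \<Psi>_add:
  "Fz.fls_over g \<Longrightarrow> Fz.fls_over h \<Longrightarrow> \<Psi> (g + h) = \<Psi> g \<oplus>\<^bsub>laurent_series B\<^esub> \<Psi> h"
  by (auto simp: \<Psi>_def Fz.fls_over_def \<psi>_add)

lemma \<Psi>_mult:
  assumes "Fz.fls_over g" "Fz.fls_over h"
  shows "\<Psi> (g * h) = \<Psi> g \<otimes>\<^bsub>laurent_series B\<^esub> \<Psi> h"
proof
  fix n
  have "(\<Psi> g \<otimes>\<^bsub>laurent_series B\<^esub> \<Psi> h) n =
      (\<Oplus>\<^bsub>B\<^esub>i\<in>{fls_subdegree g..n - fls_subdegree h}. \<Psi> g i \<otimes>\<^bsub>B\<^esub> \<Psi> h (n - i))"
    by (rule B.laurent_mult_interval[of _ _ "fls_subdegree g" "fls_subdegree h"])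
      (use assms in \<open>auto simp: \<Psi>_nth_closed\<close>, auto simp: \<Psi>_def \<psi>_0)
  also have "\<dots> = (\<Oplus>\<^bsub>B\<^esub>i\<in>{fls_subdegree g..n - fls_subdegree h}. \<psi> (fls_nth g i * fls_nth h (n - i)))"
    using assms by (intro B.finsum_cong' refl) (auto simp: \<Psi>_def Fz.fls_over_def \<psi>_mult \<psi>_closed Fz.mult)
  also have "\<dots> = \<Psi> (g * h) n"
    using assms by (simp add: \<Psi>_def fls_times_nth(2) \<psi>_sum Fz.fls_over_def Fz.mult)
  finally show "\<Psi> (g * h) n = (\<Psi> g \<otimes>\<^bsub>laurent_series B\<^esub> \<Psi> h) n" by simp
qed

lemma \<Psi>_const: "\<Psi> (fls_const y) = const_series B (\<psi> y)"
  by (auto simp: fun_eq_iff \<Psi>_def const_series_def \<psi>_0)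

lemma \<Psi>_1: "\<Psi> 1 = \<one>\<^bsub>laurent_series B\<^esub>"
  using \<Psi>_const[of 1] by (simp add: \<psi>_1 const_series_def)

lemma fls_over_local_param: "Fz.fls_over (local_param (Some z))"
  by (simp add: local_param_def Fz.fls_over_add Fz.fls_over_const z_in_Fz Fz.fls_over_X)

lemma fls_over_eval:
  assumes "P \<in> polys_over F"
  shows "Fz.fls_over (eval_fls (local_param (Some z)) (map_poly e P))"
  using assms by (intro Fz.fls_over_eval_fls fls_over_local_param)
    (auto simp: polys_over_def coeff_map_poly intro: e_in_Fz)

lemma \<Psi>_unit:
  assumes "Fz.fls_over g" "g \<noteq> 0"
  shows "\<Psi> g \<in> Units (laurent_series B)"
    and "inv\<^bsub>laurent_series B\<^esub> (\<Psi> g) = \<Psi> (inverse g)"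
proof -
  have *: "\<Psi> g \<otimes>\<^bsub>laurent_series B\<^esub> \<Psi> (inverse g) = \<one>\<^bsub>laurent_series B\<^esub>"
    "\<Psi> (inverse g) \<otimes>\<^bsub>laurent_series B\<^esub> \<Psi> g = \<one>\<^bsub>laurent_series B\<^esub>"
    using assms by (simp_all add: Fz.fls_over_inverse \<Psi>_1 flip: \<Psi>_mult)
  note carr = \<Psi>_closed[OF assms(1)] \<Psi>_closed[OF Fz.fls_over_inverse[OF assms(1)]]
  show "\<Psi> g \<in> Units (laurent_series B)" using * carr unfolding Units_def by blast
  show "inv\<^bsub>laurent_series B\<^esub> (\<Psi> g) = \<Psi> (inverse g)"
    using * carr by (intro L.inv_char)
qed

end


section \<open>Residues at the nonzero points\<close>

context algebraic_point
begin

abbreviation T where "T \<equiv> tensor_product F e"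

text \<open>The 0-th section followed by \<open>iota\<close>, on representatives in A; that it
  descends to cosets of NA is proved by \<open>sect_tensor_ideal\<close> and
  \<open>\<chi>_cl\<close>.\<close>

definition sect_tensor :: "(int \<Rightarrow> 'k) \<Rightarrow> ('k \<times> 's \<Rightarrow>\<^sub>0 int) set" where
  "sect_tensor v = tensor.tensor_sum (\<lambda>i. z powi i) (sect r 0 v)"

lemma sect_tensor_closed [simp]: "sect_tensor v \<in> carrier T"
  by (simp add: sect_tensor_def)

lemma sect_tensor_add:
  assumes "u \<in> carrier A" "v \<in> carrier A"
  shows "sect_tensor (\<lambda>i. u i + v i) = sect_tensor u \<otimes>\<^bsub>T\<^esub> sect_tensor v"
proof -
  have "sect r 0 (\<lambda>i. u i + v i) = (\<lambda>i. sect r 0 u i + sect r 0 v i)"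
    by (simp add: sect_def)
  then show ?thesis
    using assms r by (simp add: sect_tensor_def tensor.tensor_sum_add finite_sect)
qed

text \<open>The coefficient function is that of d Y^m M(Y). The coefficients of M lie in F and cross
  the tensor sign, so the sum collapses to the value of Y^m M at z.\<close>

lemma tensor_sum_shifted_poly:
  assumes "z \<noteq> 0" "M \<in> polys_over F"
  shows "tensor.tensor_sum (\<lambda>i. z powi i) (\<lambda>j. if j \<ge> m then d * poly.coeff M (nat (j - m)) else 0) =
    pure_tensor F e d (z powi m * ev M)"
proof -
  let ?S = "(\<lambda>k. int k + m) ` {..degree M}"
  have "tensor.tensor_sum (\<lambda>i. z powi i) (\<lambda>j. if j \<ge> m then d * poly.coeff M (nat (j - m)) else 0) =
      finprod T (\<lambda>j. pure_tensor F e (if j \<ge> m then d * poly.coeff M (nat (j - m)) else 0) (z powi j)) ?S"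
  proof (rule tensor.tensor_sum_eq)
    show "{i. (if m \<le> i then d * poly.coeff M (nat (i - m)) else 0) \<noteq> 0} \<subseteq> ?S"
    proof
      fix i assume "i \<in> {i. (if m \<le> i then d * poly.coeff M (nat (i - m)) else 0) \<noteq> 0}"
      then have "m \<le> i" "poly.coeff M (nat (i - m)) \<noteq> 0" by (auto split: if_splits)
      then show "i \<in> ?S" by (intro image_eqI[of _ _ "nat (i - m)"]) (auto intro: le_degree)
    qed
  qed simp
  also have "\<dots> = finprod T (\<lambda>k. pure_tensor F e (d * poly.coeff M k) (z powi (int k + m))) {..degree M}"
    by (subst tensor.T.finprod_reindex) (auto simp: inj_on_def)
  also have "\<dots> = finprod T (\<lambda>k. pure_tensor F e d (z powi m * (e (poly.coeff M k) * z ^ k))) {..degree M}"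
    using assms by (intro tensor.T.finprod_cong')
      (auto simp: tensor.pure_balanced polys_over_def power_int_add ac_simps)
  also have "\<dots> = pure_tensor F e d (z powi m * ev M)"
    by (simp add: ev_def poly_altdef e.degree_map_poly_embedding coeff_map_poly sum_distrib_left
        tensor.pure_sum_right)
  finally show ?thesis .
qed

lemma skew_mult_poly_at_Y_right:
  "M \<in> polys_over F \<Longrightarrow> skew_mult \<theta> (skew_monom c n) (poly_at_Y r M) k = c * poly_at_Y r M (k - n)"
  by (simp add: skew_mult_monom_left aut_pow_fixed poly_at_Y_def polys_over_def fixed.zero)

lemma poly_at_Y_multiple:
  "poly_at_Y r M (q * int r) = (if q \<ge> 0 then poly.coeff M (nat q) else 0)"
  using r by (simp add: poly_at_Y_def zero_le_mult_iff)

lemma sect_poly_at_Y_shift: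
  fixes c :: 'k
  assumes "n = m * int r"
  shows "sect r 0 (\<lambda>k. c * poly_at_Y r M (k - n)) = (\<lambda>j. if j \<ge> m then c * poly.coeff M (nat (j - m)) else 0)"
proof
  fix j
  have "j * int r - n = (j - m) * int r" using assms by (simp add: left_diff_distrib)
  then show "sect r 0 (\<lambda>k. c * poly_at_Y r M (k - n)) j = (if j \<ge> m then c * poly.coeff M (nat (j - m)) else 0)"
    by (simp add: sect_0 poly_at_Y_multiple)
qed

lemma sect_tensor_scaled_poly:
  assumes "z \<noteq> 0" "M \<in> polys_over F"
  shows "sect_tensor (skew_monom c 0 \<otimes>\<^bsub>A\<^esub> poly_at_Y r M) = pure_tensor F e c (ev M)"
proof -
  have "skew_monom c 0 \<otimes>\<^bsub>A\<^esub> poly_at_Y r M = (\<lambda>k. c * poly_at_Y r M (k - 0))"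
    using assms by (simp add: fun_eq_iff skew_mult_poly_at_Y_right)
  then show ?thesis
    unfolding sect_tensor_def
    using tensor_sum_shifted_poly[OF assms, of 0 c] sect_poly_at_Y_shift[of 0 0 c M] by simp
qed

text \<open>For w = c Y^m the result is c \<otimes> z^m N(z) = 0; a monomial whose exponent is not
  divisible by r has zero section even after multiplication by N.\<close>

lemma sect_tensor_ideal:
  assumes "z \<noteq> 0" "w \<in> carrier A"
  shows "sect_tensor (NY \<otimes>\<^bsub>A\<^esub> w) = \<one>\<^bsub>T\<^esub>"
  using assms(2)
proof (induction w rule: skew_poly_induct)
  case (monom c n)
  \<comment> \<open>Centrality moves N to the right of the monomial, where its coefficients, being
    in F, are not twisted.\<close>
  have eq: "NY \<otimes>\<^bsub>A\<^esub> skew_monom c n = (\<lambda>k. c * poly_at_Y r N (k - n))"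
    using N_props(1) by (simp add: NY_central) (simp add: fun_eq_iff NY_eq skew_mult_poly_at_Y_right)
  show ?case
  proof (cases "int r dvd n")
    case True
    then have n: "n = n div int r * int r" by simp
    show ?thesis
      unfolding sect_tensor_def eq sect_poly_at_Y_shift[OF n]
        tensor_sum_shifted_poly[OF assms(1) N_props(1)] by (simp add: N_props)
  next
    case False
    have "\<not> int r dvd j * int r - n" for j
    proof
      assume "int r dvd j * int r - n"
      from dvd_diff[OF dvd_triv_right this, of j] have "int r dvd n" by simp
      with False show False by simp
    qed
    then have "sect r 0 (\<lambda>k. c * poly_at_Y r N (k - n)) = (\<lambda>_. 0)"
      by (auto simp: fun_eq_iff sect_0 poly_at_Y_def)
    then show ?thesis unfolding sect_tensor_def eq by simp
  qed
next
  case (add a b)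
  have "NY \<otimes>\<^bsub>A\<^esub> (\<lambda>i. a i + b i) = (NY \<otimes>\<^bsub>A\<^esub> a) \<oplus>\<^bsub>A\<^esub> (NY \<otimes>\<^bsub>A\<^esub> b)"
    using A.r_distr[OF add(1,2) NY_closed] by simp
  then show ?case
    using sect_tensor_add[OF A.m_closed[OF NY_closed add(1)] A.m_closed[OF NY_closed add(2)]] add(3,4)
    by simp
qed

definition \<chi> :: "(int \<Rightarrow> 'k) set \<Rightarrow> ('k \<times> 's \<Rightarrow>\<^sub>0 int) set" where
  "\<chi> u = iota F e z (sect r 0 ` u)"

text \<open>\<open>iota\<close> takes the value on a coset through \<open>the_elem\<close>;
  \<open>sect_tensor_ideal\<close> makes this value the same for all representatives.\<close>

lemma \<chi>_cl:
  assumes "z \<noteq> 0" "v \<in> carrier A"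
  shows "\<chi> (cl v) = sect_tensor v"
proof -
  have "sect_tensor u = sect_tensor v" if u: "u \<in> cl v" for u
  proof -
    obtain x where "x \<in> central_ideal \<theta> NY" "u = x \<oplus>\<^bsub>A\<^esub> v"
      using u by (auto simp: skew_class_def a_r_coset_def r_coset_def)
    then obtain w where w: "w \<in> carrier A" "u = (NY \<otimes>\<^bsub>A\<^esub> w) \<oplus>\<^bsub>A\<^esub> v"
      by (auto simp: central_ideal_def l_coset_def)
    then have "sect_tensor u = sect_tensor (NY \<otimes>\<^bsub>A\<^esub> w) \<otimes>\<^bsub>T\<^esub> sect_tensor v"
      using sect_tensor_add[OF A.m_closed[OF NY_closed w(1)] assms(2)] by simp
    then show ?thesis using sect_tensor_ideal[OF assms(1) w(1)] by simp
  qed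
  moreover have "v \<in> cl v"
    using id.a_rcos_self[OF assms(2)] by (simp add: skew_class_def)
  ultimately have "sect_tensor ` cl v = {sect_tensor v}" by blast
  moreover have "(\<lambda>c. finprod T (\<lambda>i. pure_tensor F e (c i) (z powi i)) {i. c i \<noteq> 0}) ` sect r 0 ` cl v
      = sect_tensor ` cl v"
    by (simp add: image_image sect_tensor_def tensor.tensor_sum_def)
  ultimately show ?thesis by (simp add: \<chi>_def iota_def)
qed

lemma cl_surj: "u \<in> carrier B \<Longrightarrow> \<exists>v\<in>carrier A. u = cl v"
  by (auto simp: skew_quot_def FactRing_def A_RCOSETS_def RCOSETS_def skew_class_def a_r_coset_def)

lemma \<chi>_add:
  assumes "z \<noteq> 0" "u \<in> carrier B" "w \<in> carrier B"
  shows "\<chi> (u \<oplus>\<^bsub>B\<^esub> w) = \<chi> u \<otimes>\<^bsub>T\<^esub> \<chi> w"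
proof -
  obtain x y where xy: "x \<in> carrier A" "y \<in> carrier A" "u = cl x" "w = cl y"
    using cl_surj assms by metis
  then have "u \<oplus>\<^bsub>B\<^esub> w = cl (x \<oplus>\<^bsub>A\<^esub> y)" by (simp only: cl_add)
  then have "\<chi> (u \<oplus>\<^bsub>B\<^esub> w) = sect_tensor (x \<oplus>\<^bsub>A\<^esub> y)"
    using \<chi>_cl[OF assms(1) A.a_closed[OF xy(1,2)]] by simp
  then show ?thesis using sect_tensor_add[OF xy(1,2)] \<chi>_cl[OF assms(1)] xy by simp
qed

text \<open>Any polynomial that represents y in A/NA is evaluated back to y at z.\<close>

lemma \<chi>_scaled:
  assumes "z \<noteq> 0" "y \<in> Fz"
  shows "\<chi> (cl (skew_monom c 0) \<otimes>\<^bsub>B\<^esub> \<psi> y) = pure_tensor F e c y"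
proof -
  obtain M where M: "M \<in> polys_over F" "y = ev M" using assms unfolding Fz_def by blast
  have "cl (skew_monom c 0) \<otimes>\<^bsub>B\<^esub> \<psi> y = cl (skew_monom c 0 \<otimes>\<^bsub>A\<^esub> poly_at_Y r M)"
    unfolding M(2) \<psi>_ev[OF M(1)] using cl_mult[OF skew_monom_in_skew_poly poly_at_Y_closed[OF M(1)]] by simp
  then show ?thesis
    using \<chi>_cl[OF assms(1) A.m_closed[OF skew_monom_in_skew_poly poly_at_Y_closed[OF M(1)]]]
      sect_tensor_scaled_poly[OF assms(1) M(1)] M(2) by simp
qed

text \<open>The 0-th section turns the two sides of the hypothesis into multiples of one element by a and b.\<close>

lemma \<chi>_twisted:
  assumes "z \<noteq> 0" "w \<in> carrier B" "b \<noteq> a"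
    and twist: "w \<otimes>\<^bsub>B\<^esub> cl (skew_monom a 0) = cl (skew_monom b 0) \<otimes>\<^bsub>B\<^esub> w"
  shows "\<chi> w = \<one>\<^bsub>T\<^esub>"
proof -
  obtain v where v: "v \<in> carrier A" "w = cl v" using cl_surj[OF assms(2)] by blast
  \<comment> \<open>With this d, d b = d a + 1. The scaling by d takes place in A, before the
    section, since the tensor product is available here only as a group.\<close>
  define d where "d = inverse (b - a)"
  have d: "d * b = 1 + d * a" using assms(3) by (simp add: d_def field_simps)
  note mon = skew_monom_in_skew_poly[of _ 0 \<theta>]
  let ?l = "skew_monom d 0 \<otimes>\<^bsub>A\<^esub> (v \<otimes>\<^bsub>A\<^esub> skew_monom a 0)"
    and ?r = "skew_monom d 0 \<otimes>\<^bsub>A\<^esub> (skew_monom b 0 \<otimes>\<^bsub>A\<^esub> v)"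
  have lc: "?l \<in> carrier A" and rc: "?r \<in> carrier A"
    using A.m_closed mon v(1) by blast+
  have "cl ?l = cl ?r"
    using twist v mon by (simp only: cl_mult A.m_closed)
  then have eq: "sect_tensor ?l = sect_tensor ?r"
    using \<chi>_cl[OF assms(1) lc] \<chi>_cl[OF assms(1) rc] by simp
  \<comment> \<open>At exponents divisible by r the twist is trivial, so the factor a on the right
    acts like a factor on the left.\<close>
  have sl: "sect r 0 ?l = (\<lambda>i. d * a * sect r 0 v i)"
    by (simp add: fun_eq_iff sect_0 skew_mult_monom_left skew_mult_monom_right ac_simps)
  have "sect r 0 ?r = (\<lambda>i. sect r 0 v i + sect r 0 ?l i)"
    unfolding sl by (simp add: fun_eq_iff sect_0 skew_mult_monom_left d mult.assoc[symmetric] ring_distribs)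
  moreover have "finite {i. sect r 0 v i \<noteq> 0}" "finite {i. sect r 0 ?l i \<noteq> 0}"
    using v(1) lc r by (auto intro!: finite_sect)
  ultimately have "sect_tensor ?r = sect_tensor v \<otimes>\<^bsub>T\<^esub> sect_tensor ?l"
    unfolding sect_tensor_def by (simp add: tensor.tensor_sum_add del: skew_poly_simps)
  with eq have "sect_tensor v \<otimes>\<^bsub>T\<^esub> sect_tensor ?l = sect_tensor ?l" by simp
  then have "sect_tensor v = \<one>\<^bsub>T\<^esub>" by (simp add: tensor.T.r_cancel_one)
  then show ?thesis using \<chi>_cl[OF assms(1) v(1)] v(2) by simp
qed

end

section \<open>Expansions under an admissible morphism\<close>

locale admissible_point = algebraic_point \<theta> r e z
  for \<theta> :: "'k::field \<Rightarrow> 'k" and r e and z :: "'s::field" +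
  fixes \<tau> :: "(nat \<Rightarrow> (int \<Rightarrow> 'k) set) \<Rightarrow> int \<Rightarrow> (int \<Rightarrow> 'k) set"
  assumes z: "z \<noteq> 0" and admissible: "z_admissible \<theta> r e z \<tau>"
    and exact_order: "\<And>m. 0 < m \<Longrightarrow> m < r \<Longrightarrow> \<theta> ^^ m \<noteq> id"
begin

definition h :: "(int \<Rightarrow> 'k) \<Rightarrow> int \<Rightarrow> (int \<Rightarrow> 'k) set" where
  "h a = \<tau> (to_completion \<theta> NY a)"

lemma h_hom: "h \<in> ring_hom A (power_series B)"
proof -
  have "\<tau> \<in> ring_hom (completion \<theta> NY) (power_series B)"
    using admissible by (simp add: z_admissible_def Let_def)
  from ring_hom_trans[OF to_completion_hom[OF NY_closed NY_central] this]
  have "\<tau> \<circ> to_completion \<theta> NY \<in> ring_hom A (power_series B)" .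
  moreover have "h = \<tau> \<circ> to_completion \<theta> NY" by (auto simp: h_def)
  ultimately show ?thesis by simp
qed

text \<open>The morphism takes values in power series, but denominators become invertible only among
  Laurent series.\<close>

lemma power_series_ops:
  "carrier (power_series B) \<subseteq> carrier (laurent_series B)"
  "monoid.mult (power_series B) = monoid.mult (laurent_series B)"
  "ring.add (power_series B) = ring.add (laurent_series B)"
  "one (power_series B) = one (laurent_series B)"
  by (auto simp: power_series_def)

lemma h_closed: "a \<in> carrier A \<Longrightarrow> h a \<in> carrier (laurent_series B)"
  using ring_hom_closed[OF h_hom] power_series_ops(1) by blast

lemma h_mult: "a \<in> carrier A \<Longrightarrow> b \<in> carrier A \<Longrightarrow> h (a \<otimes>\<^bsub>A\<^esub> b) = h a \<otimes>\<^bsub>laurent_series B\<^esub> h b"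
  using ring_hom_mult[OF h_hom] power_series_ops(2) by metis

lemma h_add: "a \<in> carrier A \<Longrightarrow> b \<in> carrier A \<Longrightarrow> h (a \<oplus>\<^bsub>A\<^esub> b) = h a \<oplus>\<^bsub>laurent_series B\<^esub> h b"
  using ring_hom_add[OF h_hom] power_series_ops(3) by metis

lemma h_one: "h \<one>\<^bsub>A\<^esub> = \<one>\<^bsub>laurent_series B\<^esub>"
  using ring_hom_one[OF h_hom] power_series_ops(4) by metis

lemma h_const: "h (skew_monom c 0) = const_series B (cl (skew_monom c 0))"
  using admissible by (simp add: z_admissible_def Let_def h_def const_series_def)

lemma h_Y: "h (skew_monom 1 (int r)) = \<Psi> (local_param (Some z))"
  using admissible
  by (auto simp: z_admissible_def Let_def h_def \<Psi>_def local_param_def fun_eq_iff \<psi>_0 \<psi>_1 \<psi>_z)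

lemma poly_at_Y_pCons:
  assumes "P \<in> polys_over F"
  shows "poly_at_Y r (pCons c P) =
    skew_monom c 0 \<oplus>\<^bsub>A\<^esub> (skew_monom 1 (int r) \<otimes>\<^bsub>A\<^esub> poly_at_Y r P)"
proof -
  have "pCons c P = [:c:] + [:0, 1:] * P" by simp
  moreover have "[:0, 1:] \<in> polys_over F"
    by (simp add: polys_over_pCons_iff fixed.zero fixed.one fixed.polys_over_0)
  ultimately show ?thesis
    by (simp only: poly_at_Y_add poly_at_Y_mult poly_at_Y_const poly_at_Y_Y)
qed

text \<open>On F[Y] the morphism and the commutative Taylor expansion at z agree on F and at Y;
  Horner's scheme propagates this to all polynomials.\<close>

lemma h_poly: "P \<in> polys_over F \<Longrightarrow> h (poly_at_Y r P) = \<Psi> (eval_fls (local_param (Some z)) (map_poly e P))"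
proof (induction P)
  case 0
  have "h (poly_at_Y r [:0:]) = \<Psi> 0"
    unfolding poly_at_Y_const h_const using \<Psi>_const[of 0] \<psi>_e[of 0] fixed.zero by simp
  then show ?case by simp
next
  case (pCons c P)
  then have cP: "c \<in> F" "P \<in> polys_over F" by (simp_all add: polys_over_pCons_iff)
  note mon = skew_monom_in_skew_poly
  have "h (poly_at_Y r (pCons c P)) = h (skew_monom c 0) \<oplus>\<^bsub>laurent_series B\<^esub>
      (h (skew_monom 1 (int r)) \<otimes>\<^bsub>laurent_series B\<^esub> h (poly_at_Y r P))"
    unfolding poly_at_Y_pCons[OF cP(2)] h_add[OF mon A.m_closed[OF mon poly_at_Y_closed[OF cP(2)]]]
      h_mult[OF mon poly_at_Y_closed[OF cP(2)]] ..
  also have "\<dots> = \<Psi> (fls_const (e c)) \<oplus>\<^bsub>laurent_series B\<^esub>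
      (\<Psi> (local_param (Some z)) \<otimes>\<^bsub>laurent_series B\<^esub> \<Psi> (eval_fls (local_param (Some z)) (map_poly e P)))"
    using cP pCons by (simp only: h_const h_Y \<Psi>_const \<psi>_e)
  also have "\<dots> = \<Psi> (eval_fls (local_param (Some z)) (map_poly e (pCons c P)))"
    using cP fls_over_local_param fls_over_eval[OF cP(2)]
    by (simp only: e.map_poly_pCons_embedding eval_fls_pCons \<Psi>_add \<Psi>_mult
        Fz.fls_over_mult Fz.fls_over_const e_in_Fz)
  finally show ?case .
qed

lemma h_poly_unit:
  assumes "P \<in> polys_over F" "P \<noteq> 0"
  shows "h (poly_at_Y r P) \<in> Units (laurent_series B)"
    and "inv\<^bsub>laurent_series B\<^esub> (h (poly_at_Y r P)) =
      \<Psi> (inverse (eval_fls (local_param (Some z)) (map_poly e P)))"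
  using \<Psi>_unit[OF fls_over_eval[OF assms(1)]] eval_fls_local_param_nonzero[of "map_poly e P" z] assms
  by (simp_all add: h_poly e.map_poly_eq_0_iff_embedding)

lemma skew_monom_mult_Y:
  "skew_monom c (m * int r) \<otimes>\<^bsub>A\<^esub> skew_monom d n = skew_monom (c * d) (m * int r + n)"
proof
  fix k
  have "(skew_monom c (m * int r) \<otimes>\<^bsub>A\<^esub> skew_monom d n) k = c * skew_monom d n (k - m * int r)"
    by (simp add: skew_mult_monom_left)
  then show "(skew_monom c (m * int r) \<otimes>\<^bsub>A\<^esub> skew_monom d n) k = skew_monom (c * d) (m * int r + n) k"
    by (auto simp: skew_monom_def)
qed

lemma h_Y_power: "h (skew_monom 1 (i * int r)) = \<Psi> (local_param (Some z) powi i)"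
proof -
  let ?u = "local_param (Some z)" and ?Y = "\<lambda>i::int. skew_monom (1::'k) (i * int r)"
  have nat: "h (?Y (int n)) = \<Psi> (?u ^ n)" for n
  proof -
    have "poly_at_Y r (Polynomial.monom 1 n) = ?Y (int n)" by (rule poly_at_Y_monom)
    moreover have "Polynomial.monom 1 n \<in> polys_over F"
      by (simp add: polys_over_def fixed.zero fixed.one)
    moreover have "eval_fls ?u (map_poly e (Polynomial.monom 1 n)) = ?u ^ n"
      by (induction n) (simp_all add: monom_Suc monom_0)
    ultimately show ?thesis using h_poly by metis
  qed
  show ?thesis
  proof (cases "i \<ge> 0")
    case True
    then show ?thesis using nat[of "nat i"] by (simp add: power_int_def)
  next
    case False
    define n where "n = nat (- i)"
    have i: "i = - int n" using False by (simp add: n_def)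
    have over: "Fz.fls_over (?u ^ n)" "?u ^ n \<noteq> 0"
      using Fz.fls_over_power_int[OF fls_over_local_param, of "int n"] local_param_nonzero[of "Some z"]
      by simp_all
    have one: "skew_monom (1::'k) 0 = \<one>\<^bsub>A\<^esub>" by simp
    \<comment> \<open>A negative power of Y is not a polynomial in Y; its image is recognized as the
      two-sided inverse of the image of Y^n.\<close>
    have "h (?Y (int n)) \<otimes>\<^bsub>laurent_series B\<^esub> h (?Y i) = \<one>\<^bsub>laurent_series B\<^esub>"
      "h (?Y i) \<otimes>\<^bsub>laurent_series B\<^esub> h (?Y (int n)) = \<one>\<^bsub>laurent_series B\<^esub>"
      using h_one unfolding h_mult[OF skew_monom_in_skew_poly skew_monom_in_skew_poly, symmetric] skew_monom_mult_Y
      by (simp_all add: i)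
    then have "inv\<^bsub>laurent_series B\<^esub> (h (?Y (int n))) = h (?Y i)"
      by (intro L.inv_char h_closed skew_monom_in_skew_poly)
    then have "h (?Y i) = \<Psi> (inverse (?u ^ n))" using \<Psi>_unit(2)[OF over] nat by simp
    then show ?thesis by (simp add: i power_int_minus)
  qed
qed

lemma \<chi>_TS_coeff:
  assumes P: "P \<in> polys_over F" "P \<noteq> 0" and "a \<in> carrier A"
  shows "\<chi> ((inv\<^bsub>laurent_series B\<^esub> (h (poly_at_Y r P)) \<otimes>\<^bsub>laurent_series B\<^esub> h a) (- 1)) =
    tensor.tensor_sum (residue_weight (map_poly e P) (Some z)) (sect r 0 a)"
  using assms(3)
proof (induction a rule: skew_poly_induct)
  case (monom c n)
  let ?G = "eval_fls (local_param (Some z)) (map_poly e P)"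
  let ?V = "inv\<^bsub>laurent_series B\<^esub> (h (poly_at_Y r P))"
  note mon = skew_monom_in_skew_poly
  note U = h_poly_unit(1)[OF P]
  have V: "?V \<in> carrier (laurent_series B)" using U by (rule L.Units_inv_closed)
  \<comment> \<open>P(Y) is central in A, so the inverse of its image commutes with the image of K.
    Hence dividing by P(Y) preserves the relation between a monomial and the constants.\<close>
  have V_commute: "?V \<otimes>\<^bsub>laurent_series B\<^esub> h (skew_monom c 0) = h (skew_monom c 0) \<otimes>\<^bsub>laurent_series B\<^esub> ?V" for c
  proof (rule L.inv_commute[OF U h_closed[OF mon]])
    have "poly_at_Y r P \<otimes>\<^bsub>A\<^esub> skew_monom c 0 = skew_monom c 0 \<otimes>\<^bsub>A\<^esub> poly_at_Y r P"
      using centre_central[OF poly_at_Y_in_centre[OF P(1)]] by simp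
    then show "h (poly_at_Y r P) \<otimes>\<^bsub>laurent_series B\<^esub> h (skew_monom c 0) =
        h (skew_monom c 0) \<otimes>\<^bsub>laurent_series B\<^esub> h (poly_at_Y r P)"
      using h_mult[OF poly_at_Y_closed[OF P(1)] mon[of c 0]]
        h_mult[OF mon[of c 0] poly_at_Y_closed[OF P(1)]] by metis
  qed
  show ?case
  proof (cases "int r dvd n")
    case True
    then have "n = n div int r * int r" by simp
    then obtain i where n: "n = i * int r" by blast
    let ?g = "local_param (Some z) powi i / ?G"
    have g: "Fz.fls_over ?g"
      by (intro Fz.fls_over_divide Fz.fls_over_power_int fls_over_local_param fls_over_eval P)
    have "h (skew_monom c n) = h (skew_monom c 0) \<otimes>\<^bsub>laurent_series B\<^esub> h (skew_monom 1 n)"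
      using h_mult[OF mon mon, of c 0 1 n] skew_monom_mult_Y[of c 0 1 n] by simp
    then have "?V \<otimes>\<^bsub>laurent_series B\<^esub> h (skew_monom c n) =
        h (skew_monom c 0) \<otimes>\<^bsub>laurent_series B\<^esub> (?V \<otimes>\<^bsub>laurent_series B\<^esub> h (skew_monom 1 n))"
      using V_commute[of c] L.m_assoc[OF V h_closed[OF mon] h_closed[OF mon]]
        L.m_assoc[OF h_closed[OF mon] V h_closed[OF mon]] by metis
    also have "?V \<otimes>\<^bsub>laurent_series B\<^esub> h (skew_monom 1 n) = \<Psi> ?g"
      unfolding h_poly_unit(2)[OF P] n h_Y_power
      using Fz.fls_over_inverse[OF fls_over_eval[OF P(1)]] Fz.fls_over_power_int[OF fls_over_local_param]
      by (simp add: divide_inverse mult.commute flip: \<Psi>_mult)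
    finally have "(?V \<otimes>\<^bsub>laurent_series B\<^esub> h (skew_monom c n)) (- 1) =
        cl (skew_monom c 0) \<otimes>\<^bsub>B\<^esub> \<psi> (fls_nth ?g (- 1))"
      using B.const_series_mult_left[OF cl_closed[OF mon] \<Psi>_nth_closed[OF g]]
      by (simp add: h_const \<Psi>_def)
    moreover have "fls_nth ?g (- 1) \<in> Fz" using g by (simp add: Fz.fls_over_def)
    moreover have "sect r 0 (skew_monom c n) = (\<lambda>j. if j = i then c else 0)"
      using r by (auto simp: fun_eq_iff sect_0 skew_monom_def n)
    ultimately show ?thesis
      using \<chi>_scaled[OF z] by (simp add: tensor.tensor_sum_single residue_weight_def residue_at_def)
  next
    case False
    \<comment> \<open>Since \<theta>^n = \<theta>^m and 0 < m < r, the exactness of the order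
      provides an x that \<theta>^n moves.\<close>
    define m where "m = nat (n mod int r)"
    have m: "int m = n mod int r" using r by (simp add: m_def)
    have "0 < m" "m < r"
      using False r m by (auto simp: dvd_eq_mod_eq_0 intro!: gr0I) (metis of_nat_less_iff pos_mod_bound of_nat_0_less_iff)
    then obtain x where x: "(\<theta> ^^ m) x \<noteq> x" using exact_order by (auto simp: fun_eq_iff)
    have "n = n div int r * int r + int m" using m by simp
    then have "aut_pow \<theta> n x = aut_pow \<theta> (n div int r * int r) (aut_pow \<theta> (int m) x)"
      using aut_pow_add[of "n div int r * int r" "int m" x] by simp
    then have y: "aut_pow \<theta> n x \<noteq> x" using x by (simp add: aut_pow_def[of _ "int m"])
    let ?y = "aut_pow \<theta> n x"
    have "skew_monom c n \<otimes>\<^bsub>A\<^esub> skew_monom x 0 = skew_monom ?y 0 \<otimes>\<^bsub>A\<^esub> skew_monom c n"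
    proof
      fix k
      have "c * aut_pow \<theta> n (skew_monom x 0 (k - n)) = ?y * skew_monom c n k"
        by (auto simp: skew_monom_def)
      then show "(skew_monom c n \<otimes>\<^bsub>A\<^esub> skew_monom x 0) k = (skew_monom ?y 0 \<otimes>\<^bsub>A\<^esub> skew_monom c n) k"
        by (simp add: skew_mult_monom_left)
    qed
    then have hh: "h (skew_monom c n) \<otimes>\<^bsub>laurent_series B\<^esub> h (skew_monom x 0) =
        h (skew_monom ?y 0) \<otimes>\<^bsub>laurent_series B\<^esub> h (skew_monom c n)"
      using h_mult[OF mon mon] by metis
    let ?w = "?V \<otimes>\<^bsub>laurent_series B\<^esub> h (skew_monom c n)"
    have wc: "?w \<in> carrier (laurent_series B)" using V h_closed[OF mon] by (rule L.m_closed)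
    then have wn: "?w i \<in> carrier B" for i by simp
    have "?w \<otimes>\<^bsub>laurent_series B\<^esub> h (skew_monom x 0) = h (skew_monom ?y 0) \<otimes>\<^bsub>laurent_series B\<^esub> ?w"
      using hh V_commute[of ?y] L.m_assoc V h_closed[OF mon] by metis
    \<comment> \<open>Constant series act coefficientwise on either side, so the relation can be
      read off at T^(-1).\<close>
    then have "?w (- 1) \<otimes>\<^bsub>B\<^esub> cl (skew_monom x 0) = cl (skew_monom ?y 0) \<otimes>\<^bsub>B\<^esub> ?w (- 1)"
      using B.const_series_mult_right[OF cl_closed[OF mon[of x 0]] wn]
        B.const_series_mult_left[OF cl_closed[OF mon[of ?y 0]] wn] by (simp add: h_const fun_eq_iff)
    then have "\<chi> (?w (- 1)) = \<one>\<^bsub>T\<^esub>" using \<chi>_twisted[OF z wn y] by simp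
    moreover have "sect r 0 (skew_monom c n) = (\<lambda>_. 0)"
      using False by (auto simp: fun_eq_iff sect_0 skew_monom_def)
    ultimately show ?thesis by simp
  qed
next
  case (add a b)
  let ?V = "inv\<^bsub>laurent_series B\<^esub> (h (poly_at_Y r P))"
  have V: "?V \<in> carrier (laurent_series B)"
    using h_poly_unit(1)[OF P] by (rule L.Units_inv_closed)
  have c: "(?V \<otimes>\<^bsub>laurent_series B\<^esub> h a) (- 1) \<in> carrier B" if "a \<in> carrier A" for a
    using L.m_closed[OF V h_closed[OF that]] by simp
  have "h (\<lambda>i. a i + b i) = h a \<oplus>\<^bsub>laurent_series B\<^esub> h b" using h_add[OF add(1,2)] by simp
  then have "(?V \<otimes>\<^bsub>laurent_series B\<^esub> h (\<lambda>i. a i + b i)) (- 1) =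
      (?V \<otimes>\<^bsub>laurent_series B\<^esub> h a) (- 1) \<oplus>\<^bsub>B\<^esub> (?V \<otimes>\<^bsub>laurent_series B\<^esub> h b) (- 1)"
    using B.laurent_r_distr[OF V h_closed[OF add(1)] h_closed[OF add(2)]] by simp
  moreover have "sect r 0 (\<lambda>i. a i + b i) = (\<lambda>i. sect r 0 a i + sect r 0 b i)"
    by (simp add: sect_def)
  ultimately show ?case
    using \<chi>_add[OF z c[OF add(1)] c[OF add(2)]] add r
    by (simp add: tensor.tensor_sum_add finite_sect)
qed

end

context skew_tensor
begin

lemma psres_nonzero:
  assumes "algebraic_point \<theta> r e z" "z \<noteq> 0" "z_admissible \<theta> r e z (\<tau> z)"
    and "\<And>m. 0 < m \<Longrightarrow> m < r \<Longrightarrow> \<theta> ^^ m \<noteq> id"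
    and f: "f \<in> skew_frac \<theta> r" "(poly_at_Y r P, a) \<in> f"
    and P: "P \<in> polys_over (fixed_field \<theta>)" "P \<noteq> 0"
  shows "psres \<theta> r e \<tau> 0 (Some z) f =
    tensor.tensor_sum (residue_weight (map_poly e P) (Some z)) (sect r 0 a)"
proof -
  interpret admissible_point \<theta> r e z "\<tau> z"
    using assms by (intro admissible_point.intro admissible_point_axioms.intro)
  have "TS \<theta> r e \<tau> z f =
      inv\<^bsub>laurent_series B\<^esub> (h (poly_at_Y r P)) \<otimes>\<^bsub>laurent_series B\<^esub> h a"
    unfolding TS_def Let_def h_def[symmetric]
  proof (rule frac_map_eq[OF B.monoid_laurent])
    show "h (skew_mult \<theta> a b) = h a \<otimes>\<^bsub>laurent_series B\<^esub> h b"
      if "a \<in> carrier A" "b \<in> carrier A" for a b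
      using h_mult[OF that] by (simp only: skew_poly_simps(2))
  qed (use f in \<open>auto intro: h_poly_unit(1) h_closed simp del: skew_poly_simps laurent_series_simps\<close>)
  moreover have "a \<in> carrier A" using finite_support_representative[OF f] by simp
  ultimately show ?thesis
    using \<chi>_TS_coeff[OF P] z by (simp add: psres_def sres_def \<chi>_def)
qed

end

theorem theorem3p2p1:
  fixes \<theta> :: "'k::field \<Rightarrow> 'k" and r :: nat and e :: "'k \<Rightarrow> 's::field"
    and \<tau> :: "'s \<Rightarrow> (nat \<Rightarrow> (int \<Rightarrow> 'k) set) \<Rightarrow> int \<Rightarrow> (int \<Rightarrow> 'k) set"
    and f :: "((int \<Rightarrow> 'k) \<times> (int \<Rightarrow> 'k)) set"
  assumes "\<theta> \<in> ring_iso ring_of_type_algebra ring_of_type_algebra"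
    and "r > 0" and "\<theta> ^^ r = id" and "\<And>m. 0 < m \<Longrightarrow> m < r \<Longrightarrow> \<theta> ^^ m \<noteq> id"
    and "e \<in> ring_hom ring_of_type_algebra ring_of_type_algebra"
    and "separable_closure (fixed_field \<theta>) e"
    and "\<And>z. z \<noteq> 0 \<Longrightarrow> z_admissible \<theta> r e z (\<tau> z)"
    and "f \<in> skew_frac \<theta> r"
    and "separable_poles \<theta> r e f"
  shows "finite {p. psres \<theta> r e \<tau> 0 p f \<noteq> \<one>\<^bsub>tensor_product (fixed_field \<theta>) e\<^esub>} \<and>
    gfinprod (tensor_product (fixed_field \<theta>) e) (\<lambda>p. psres \<theta> r e \<tau> 0 p f) UNIV
      = \<one>\<^bsub>tensor_product (fixed_field \<theta>) e\<^esub>"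
proof -
  have \<theta>: "bij \<theta>" "\<theta> (x + y) = \<theta> x + \<theta> y" "\<theta> (x * y) = \<theta> x * \<theta> y" for x y
    using assms(1) by (auto simp: ring_iso_def ring_hom_def ring_of_type_algebra_def)
  have e: "e (x + y) = e x + e y" "e (x * y) = e x * e y" "e 1 = 1" for x y
    using assms(5) by (auto simp: ring_hom_def ring_of_type_algebra_def)
  interpret skew_tensor \<theta> r e
    using \<theta> e assms(2,3) by unfold_locales auto
  let ?T = "tensor_product (fixed_field \<theta>) e"
  obtain P a c xs where P: "P \<in> polys_over (fixed_field \<theta>)" and f: "(poly_at_Y r P, a) \<in> f"
    and split: "map_poly e P = smult c (\<Prod>x\<leftarrow>xs. [:- x, 1:])"
    using assms(9) unfolding separable_poles_def by blast
  have P0: "P \<noteq> 0"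
    using finite_support_representative(2)[OF assms(8) f] poly_at_Y_eq_0_iff by blast
  then have c: "c \<noteq> 0" using split e.map_poly_eq_0_iff_embedding[of P] by auto
  have alg: "algebraic_point \<theta> r e z" for z
  proof unfold_locales
    obtain Q where "Q \<in> polys_over (fixed_field \<theta>)" "separable_poly (map_poly e Q)"
      "poly (map_poly e Q) z = 0" using assms(6) unfolding separable_closure_def by blast
    \<comment> \<open>The zero polynomial is not coprime to its derivative, so separability excludes
      it.\<close>
    moreover from this have "Q \<noteq> 0" by (auto simp: separable_poly_def)
    ultimately show "\<exists>P\<in>polys_over (fixed_field \<theta>). P \<noteq> 0 \<and> poly (map_poly e P) z = 0" by blast
  qed
  let ?w = "residue_weight (map_poly e P)" and ?c = "sect r 0 a"
  have res: "psres \<theta> r e \<tau> 0 p f = tensor.tensor_sum (?w p) ?c" for p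
  proof (cases p)
    case None
    then show ?thesis using psres_infinity[OF assms(8) f P P0] by simp
  next
    case (Some z)
    show ?thesis
    proof (cases "z = 0")
      case True
      then show ?thesis using Some psres_zero[OF assms(8) f P P0] by simp
    next
      case False
      then show ?thesis
        using Some psres_nonzero[OF alg False _ assms(4) assms(8) f P P0] assms(7) by simp
    qed
  qed
  \<comment> \<open>One finite set for all i: each Y^i / P has its poles among 0, infinity and the
    roots of P.\<close>
  define S where "S = insert None (insert (Some 0) (Some ` set xs))"
  have bal: "?w p i = 0" if "p \<notin> S" for p i
    using residue_theorem[OF c, of xs i] that
    by (simp add: residues_balanced_def residue_weight_def split S_def)
  have sum: "(\<Sum>p\<in>S. ?w p i) = 0" for i
    using residue_theorem[OF c, of xs i] by (simp add: residues_balanced_def residue_weight_def split S_def)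
  have "psres \<theta> r e \<tau> 0 p f = \<one>\<^bsub>?T\<^esub>" if "p \<notin> S" for p
  proof -
    have "?w p = (\<lambda>_. 0)" using bal[OF that] by auto
    then show ?thesis by (simp add: res)
  qed
  then have sub: "{p. psres \<theta> r e \<tau> 0 p f \<noteq> \<one>\<^bsub>?T\<^esub>} \<subseteq> S" by blast
  have fin: "finite S" by (simp add: S_def)
  have "gfinprod ?T (\<lambda>p. psres \<theta> r e \<tau> 0 p f) UNIV = finprod ?T (\<lambda>p. psres \<theta> r e \<tau> 0 p f) S"
  proof -
    \<comment> \<open>\<open>gfinprod\<close> runs over the support, which is enlarged to S because
      the classical residue theorem is stated over S.\<close>
    have "finprod ?T (\<lambda>p. psres \<theta> r e \<tau> 0 p f) {p. psres \<theta> r e \<tau> 0 p f \<noteq> \<one>\<^bsub>?T\<^esub>} =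
        finprod ?T (\<lambda>p. psres \<theta> r e \<tau> 0 p f) S"
      using sub fin by (intro tensor.T.finprod_mono_neutral_cong_left) (auto simp: res)
    then show ?thesis using finite_subset[OF sub fin] by (simp add: gfinprod_def)
  qed
  also have "\<dots> = tensor.tensor_sum (\<lambda>i. \<Sum>p\<in>S. ?w p i) ?c"
    unfolding res using finite_support_representative(1)[OF assms(8) f] r fin
    by (intro tensor.finprod_tensor_sum finite_sect)
  also have "\<dots> = \<one>\<^bsub>?T\<^esub>" by (simp add: sum)
  finally show ?thesis using finite_subset[OF sub fin] by blast
qed

end
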